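(* Let $T$ be any one of the three intervals $\left(-1,-\frac13\right)$, $\left(-\frac13,0\right)$, $\left(0,\frac13\right)$, and let $h$ be absolutely monotone with $h^{(6)}>0$ (on $(-1,1)$). Then for every $T$-avoiding code $C\subset\mathbb{S}^{21}$ with $2816$ points, $$E_h(C)\ \ge\ \mathcal{E}_h(22,2816;T)=2816\left(h(-1)+567\,h\!\left(-\tfrac13\right)+1680\,h(0)+567\,h\!\left(\tfrac13\right)\right).$$ Consequently, the code $C_{2816}$ is universally optimal in the class of such $T$-avoiding spherical codes on $\mathbb{S}^{21}$. If equality $E_h(C)=\mathcal{E}_h(22,2816;T)$ is attained for any other code $C$, then $C$ must be a spherical $5$-design with the same inner products and distance distribution as $C_{2816}$, namely $I(C)=\{-1,-\frac13,0,\frac13\}$ and distance distribution $(1,567,1680,567)$.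
   Context: A spherical code is a finite set $C\subset\mathbb{S}^{n-1}$; $I(C)=\{x\cdot y: x,y\in C,\ x\ne y\}$. For $T\subset[-1,1)$, $C$ is $T$-avoiding if $I(C)\cap T=\varnothing$. A spherical $\tau$-design is a spherical code $C$ such that the average over $C$ of every polynomial in $n$ variables of total degree at most $\tau$ equals its average over $\mathbb{S}^{n-1}$ with respect to normalized surface measure. A potential is a function $h:[-1,1)\to(-\infty,+\infty)$, continuous on $[-1,1)$; it is absolutely monotone if $h^{(j)}\ge0$ for all $j\ge1$ (on $(-1,1)$). The $h$-energy is $E_h(C)=\sum_{x\neq y\in C}h(x\cdot y)$ (sum over ordered pairs). $\mathcal{E}_h(n,N;T)$ is the minimum of $E_h(C)$ over all $T$-avoiding spherical codes $C\subset\mathbb{S}^{n-1}$ with $|C|=N$. For $T$ open, a code $C\subset\mathbb{S}^{n-1}$ is $T$-avoiding universally optimal if it is $T$-avoiding and, for every absolutely monotone $h$, it minimizes $E_h$ among all $T$-avoiding codes on $\mathbb{S}^{n-1}$ of cardinality $|C|$. The distance distribution of a distance-invariant code $C$ (one for which $A_t=|\{y\in C: x\cdot y=t\}|$ is independent of $x\in C$ for each $t\in I(C)$) is the tuple $(A_t)$ listed in increasing order of $t\in I(C)$. The code $C_{2816}$: let $L\subset\mathbb{S}^{23}$ be the set of the $196560$ minimal vectors of the Leech lattice rescaled to unit length. Fix $x\in L$; let $C_{1/2}\subset\mathbb{S}^{22}$ be the set of vectors $(y-\frac12x)/\sqrt{1-\frac14}$ with $y\in L$, $x\cdot y=\frac12$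 (in the unit sphere of $x^\perp\cong\mathbb{R}^{23}$); this is the tight spherical $7$-design with $4600$ points and inner products $-1,\pm\frac13,0$. Fix $z\in C_{1/2}$; $C_{2816}=\{y\in C_{1/2}: y\cdot z=0\}$, regarded as a subset of the unit sphere $\mathbb{S}^{21}$ of the orthogonal complement of $z$ in $\mathbb{R}^{23}$. It is an antipodal spherical $5$-design with $2816$ points, with the inner products and distance distribution listed in the claim. *)

theory Defs
  imports "HOL-Analysis.Analysis"
begin

section \<open>Spherical codes, designs and energy\<close>

text \<open>The sphere \<open>S\<^sup>n\<^sup>-\<^sup>1\<close> is the unit sphere of \<open>real ^ 'n\<close> with \<open>n = CARD('n)\<close>.\<close>

definition spherical_code :: "(real ^ 'n) set \<Rightarrow> bool" where
  "spherical_code C \<longleftrightarrow> finite C \<and> C \<subseteq> sphere 0 1"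

definition inner_products :: "(real ^ 'n) set \<Rightarrow> real set" where
  "inner_products C = {x \<bullet> y | x y. x \<in> C \<and> y \<in> C \<and> x \<noteq> y}"

definition avoiding_code :: "real set \<Rightarrow> (real ^ 'n) set \<Rightarrow> bool" where
  "avoiding_code T C \<longleftrightarrow> spherical_code C \<and> inner_products C \<inter> T = {}"

text \<open>Normalized surface measure, realized as the cone measure: the radial projection
  of the uniform distribution on the unit ball.  The centre of the ball, where the
  projection yields \<open>0\<close>, is a null set.\<close>

definition sphere_measure :: "(real ^ 'n) measure" where
  "sphere_measure = distr (uniform_measure lborel (ball 0 1)) borel (\<lambda>x. x /\<^sub>R norm x)"

text \<open>Polynomial functions in the \<open>CARD('n)\<close> coordinates of total degree at most \<open>d\<close>;
  \<open>A\<close> is a finite set of exponent vectors.\<close>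

definition polynomial_of_degree_le :: "nat \<Rightarrow> (real ^ 'n \<Rightarrow> real) \<Rightarrow> bool" where
  "polynomial_of_degree_le d p \<longleftrightarrow>
     (\<exists>(A :: ('n \<Rightarrow> nat) set) c. finite A \<and> (\<forall>\<alpha>\<in>A. (\<Sum>i\<in>UNIV. \<alpha> i) \<le> d) \<and>
        p = (\<lambda>x. \<Sum>\<alpha>\<in>A. c \<alpha> * (\<Prod>i\<in>UNIV. (x $ i) ^ \<alpha> i)))"

definition spherical_design :: "nat \<Rightarrow> (real ^ 'n) set \<Rightarrow> bool" where
  "spherical_design \<tau> C \<longleftrightarrow> spherical_code C \<and>
     (\<forall>p. polynomial_of_degree_le \<tau> p \<longrightarrow>
        (\<Sum>x\<in>C. p x) / real (card C) = (\<integral>x. p x \<partial>sphere_measure))"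

text \<open>A potential on \<open>[-1,1)\<close> is a total function of which only the values on \<open>[-1,1)\<close>
  matter.  On the open interval \<open>(-1,1)\<close> the iterated \<open>deriv\<close> is the usual \<open>j\<close>-th
  derivative; its existence for all \<open>j\<close> is required explicitly, because \<open>deriv\<close> is
  total.\<close>

definition absolutely_monotone :: "(real \<Rightarrow> real) \<Rightarrow> bool" where
  "absolutely_monotone h \<longleftrightarrow> continuous_on {-1..<1} h \<and>
     (\<forall>j. \<forall>t\<in>{-1<..<1}. (deriv ^^ j) h differentiable (at t)) \<and>
     (\<forall>j\<ge>1. \<forall>t\<in>{-1<..<1}. (deriv ^^ j) h t \<ge> 0)"

definition energy :: "(real \<Rightarrow> real) \<Rightarrow> (real ^ 'n) set \<Rightarrow> real" where
  "energy h C = (\<Sum>x\<in>C. \<Sum>y\<in>C - {x}. h (x \<bullet> y))"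

text \<open>The minimum over all \<open>T\<close>-avoiding codes with \<open>N\<close> points.  The value is meaningful
  only if the minimum is attained, so attainment has to be stated separately.\<close>

definition min_energy :: "'n::finite itself \<Rightarrow> (real \<Rightarrow> real) \<Rightarrow> nat \<Rightarrow> real set \<Rightarrow> real" where
  "min_energy _ h N T =
     (LEAST e. \<exists>C :: (real ^ 'n) set. avoiding_code T C \<and> card C = N \<and> energy h C = e)"

definition avoiding_universally_optimal :: "real set \<Rightarrow> (real ^ 'n) set \<Rightarrow> bool" where
  "avoiding_universally_optimal T C \<longleftrightarrow> avoiding_code T C \<and>
     (\<forall>h. absolutely_monotone h \<longrightarrow>
        (\<forall>D :: (real ^ 'n) set. avoiding_code T D \<and> card D = card C \<longrightarrow>
           energy h C \<le> energy h D))"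

definition distance_invariant :: "(real ^ 'n) set \<Rightarrow> bool" where
  "distance_invariant C \<longleftrightarrow>
     (\<forall>t\<in>inner_products C. \<forall>x\<in>C. \<forall>x'\<in>C.
        card {y\<in>C. x \<bullet> y = t} = card {y\<in>C. x' \<bullet> y = t})"

text \<open>Only meaningful for a distance-invariant code \<open>C\<close>.\<close>

definition distance_distribution :: "(real ^ 'n) set \<Rightarrow> nat list" where
  "distance_distribution C =
     map (\<lambda>t. THE a. \<forall>x\<in>C. card {y\<in>C. x \<bullet> y = t} = a)
       (sorted_list_of_set (inner_products C))"


section \<open>The Leech lattice and the code with 2816 points\<close>

text \<open>Coordinates are indexed by the projective line over \<open>Z/23\<close>, that is by
  \<open>23 option\<close>, where \<open>None\<close> is the point at infinity and \<open>23\<close> is the library's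
  type of residues modulo 23.  The binary Golay code is the extended quadratic residue
  code: the span over \<open>GF(2)\<close> (addition is symmetric difference) of the translates of
  the set of nonzero squares, each extended by the point at infinity so that its
  cardinality 12 is even.\<close>

definition golay_generator :: "23 \<Rightarrow> 23 option set" where
  "golay_generator a = insert None {Some (a + q\<^sup>2) | q. q \<noteq> 0}"

inductive_set golay_code :: "23 option set set" where
  golay_empty: "{} \<in> golay_code"
| golay_add: "S \<in> golay_code \<Longrightarrow> sym_diff S (golay_generator a) \<in> golay_code"

text \<open>The standard coordinates of the Leech lattice (Conway and Sloane): vectors
  \<open>u / sqrt 8\<close> with integral \<open>u\<close>, all coordinates congruent to \<open>m\<close> modulo 2, coordinate
  sum congruent to \<open>4m\<close> modulo 8, such that for each residue class modulo 4 the positions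
  of the coordinates in that class form a Golay codeword.\<close>

definition leech_lattice :: "(real ^ (23 option)) set" where
  "leech_lattice =
     {(1 / sqrt 8) *\<^sub>R (\<chi> i. real_of_int (u i)) | u :: 23 option \<Rightarrow> int.
        \<exists>m. (\<forall>i. u i mod 2 = m mod 2) \<and>
            (\<Sum>i\<in>UNIV. u i) mod 8 = (4 * m) mod 8 \<and>
            (\<forall>k. {i. u i mod 4 = k mod 4} \<in> golay_code)}"

definition minimal_vectors :: "(real ^ 'n) set \<Rightarrow> (real ^ 'n) set" where
  "minimal_vectors \<Lambda> = {v\<in>\<Lambda>. v \<noteq> 0 \<and> (\<forall>w\<in>\<Lambda>. w \<noteq> 0 \<longrightarrow> norm v \<le> norm w)}"

definition leech_code :: "(real ^ (23 option)) set" where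
  "leech_code = (\<lambda>v. v /\<^sub>R norm v) ` minimal_vectors leech_lattice"

definition half_code :: "real ^ (23 option) \<Rightarrow> (real ^ (23 option)) set" where
  "half_code x =
     {(y - (1/2) *\<^sub>R x) /\<^sub>R sqrt (1 - 1/4) | y. y \<in> leech_code \<and> x \<bullet> y = 1/2}"

text \<open>\<open>D\<close> is a copy in \<open>S\<^sup>2\<^sup>1\<close> of the 2816-point code for some choice of \<open>x\<close> and \<open>z\<close>.
  The code lies in the 22-dimensional orthogonal complement of \<open>x\<close> and \<open>z\<close>, which the
  linear map \<open>\<phi>\<close> identifies isometrically with \<open>real ^ 22\<close>.\<close>

definition is_C2816 :: "(real ^ 22) set \<Rightarrow> bool" where
  "is_C2816 D \<longleftrightarrow>
     (\<exists>x\<in>leech_code. \<exists>z\<in>half_code x. \<exists>\<phi> :: real ^ (23 option) \<Rightarrow> real ^ 22.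
        linear \<phi> \<and> (\<forall>v. v \<bullet> x = 0 \<and> v \<bullet> z = 0 \<longrightarrow> norm (\<phi> v) = norm v) \<and>
        D = \<phi> ` {y\<in>half_code x. y \<bullet> z = 0})"

end

theory Submission
  imports Defs "HOL-Computational_Algebra.Polynomial"
begin

text \<open>
  The energy bound is linear programming. Newton interpolation of \<open>h\<close> at \<open>-1, -1/3, 0, 1/3\<close>, with
  double nodes at those interior nodes that do not bound \<open>T\<close>, gives a polynomial \<open>f \<le> h\<close> off \<open>T\<close> whose
  divided-difference coefficients are nonnegative, and the Newton basis for this order of the nodes lies
  in the cone spanned by constants and the kernels \<open>t\<close>, \<open>t\<^sup>2 - 1/22\<close> and \<open>t\<^sup>j (t\<^sup>3 - t/8)\<close>, \<open>j \<le> 2\<close>. These are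
  explicitly Gram kernels, so their double sums over a code are sums of squares; in the case of equality
  the squares vanish, which yields the design property and, with the four possible inner products,
  the distance distribution.

  The same kernels give the distribution of the 2816-point code without any use of the Conway group.
  For a minimal vector \<open>x\<close> of the Leech lattice, the polynomial \<open>t\<^sup>4 - t\<^sup>2/9\<close> in dimension 23 shows that \<open>x\<close> has at
  most 4600 neighbours, whereas \<open>t\<^sup>4 - t\<^sup>2/16\<close> in dimension 24 and the existence of at least 196560 minimal
  vectors show that the average number of neighbours is at least 4600. So equality holds for every \<open>x\<close>, the
  neighbours form a tight frame, and counting gives 2816. In dimension 22 this cardinality again
  attains the bound from \<open>t\<^sup>4 - t\<^sup>2/9\<close>, hence the code is a tight frame with the claimed distribution.
\<close>

section \<open>The binary Golay code\<close>

text \<open>The ends of \<open>T\<close> are adjacent nodes. If only these are simple (-1, the end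
  of the domain, may be simple too), the nodal polynomial is negative at most inside
  \<open>T\<close>, where a \<open>T\<close>-avoiding code has no inner products. For (-1,-1/3) this
  doubles two nodes and needs the sixth derivative; the other intervals double one node and need the
  fifth.

  No Gegenbauer polynomial of degree 4 or 5 is required: a product of Gram kernels is a Gram kernel,
  and \<open>t^j\<close> with j < 3 times the third Gegenbauer polynomial has mean 0 over the
  sphere. So traceless tensors of degree 3, multiplied by coordinates, carry the whole argument, and
  the vanishing of their sums is a recursion that fixes all moments up to degree 5.

  On the side of the Leech lattice, Golay words, octads and minimal vectors are counted only from
  below. This is enough, because these lower bounds and the linear programming bound 4600 fit
  together without slack.\<close>

definition idx :: "23 option \<Rightarrow> nat" where
  "idx i = (case i of None \<Rightarrow> 23 | Some a \<Rightarrow> nat (Rep_bit1 a))"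

lemma Rep23_bounds: "0 \<le> Rep_bit1 (a::23)" "Rep_bit1 (a::23) < 23"
  using Rep_bit1[of a] by simp_all

lemma Rep23_of_int: "Rep_bit1 (of_int z :: 23) = z mod 23"
proof -
  have "Rep_bit1 (Abs_bit1 (z mod int CARD(23)) :: 23) = z mod int CARD(23)"
    by (rule bit1.Rep_Abs_mod)
  moreover have "(of_int z :: 23) = Abs_bit1 (z mod int CARD(23))"
    by (rule bit1.of_int_eq)
  ultimately show ?thesis by simp
qed

lemma of_int_Rep23: "of_int (Rep_bit1 a) = (a::23)"
  by (metis Rep23_of_int Rep_bit1_inject Rep23_bounds mod_pos_pos_trivial)

lemma idx_less: "idx i < 24"
  using Rep23_bounds by (auto simp: idx_def nat_less_iff split: option.splits) (smt (verit))+

lemma inj_idx: "inj idx"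
proof (rule injI)
  fix i j assume ij: "idx i = idx j"
  have *: "nat (Rep_bit1 a) \<noteq> 23" for a :: 23
    using Rep23_bounds[of a] by linarith
  have "a = b" if "nat (Rep_bit1 a) = nat (Rep_bit1 b)" for a b :: 23
    using that Rep23_bounds[of a] Rep23_bounds[of b] by (metis Rep_bit1_inject nat_eq_iff2 int_nat_eq)
  then show "i = j"
    using ij *[symmetric] * by (auto simp: idx_def split: option.splits)
qed

lemma bij_idx: "bij_betw idx UNIV {..<24}"
proof -
  have "idx ` UNIV = {..<24}"
    by (rule card_subset_eq) (auto simp: idx_less card_image inj_idx)
  then show ?thesis using inj_idx by (simp add: bij_betw_def)
qed


section \<open>Codewords as Boolean lists, open to evaluation\<close>

definition qr_word :: "bool list" where
  "qr_word = map (\<lambda>n. n \<in> set [1, 2, 3, 4, 6, 8, 9, 12, 13, 16, 18]) [0..<23]"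

text \<open>\<open>qr_word\<close> is the characteristic vector of the nonzero squares modulo 23.
  Rotating it to the left by \<open>23 - s\<close> translates them by \<open>s\<close>; the appended
  \<open>True\<close> is the point at infinity, which \<open>idx\<close> puts last.\<close>

definition gen_word :: "nat \<Rightarrow> bool list" where
  "gen_word s = rotate (23 - s) qr_word @ [True]"

definition word_set :: "bool list \<Rightarrow> 23 option set" where
  "word_set xs = {i. xs ! idx i}"

definition xor_word :: "bool list \<Rightarrow> bool list \<Rightarrow> bool list" where
  "xor_word = map2 (\<noteq>)"

definition comb_word :: "nat list \<Rightarrow> bool list" where
  "comb_word ss = foldr (\<lambda>s. xor_word (gen_word s)) ss (replicate 24 False)"

text \<open>Generator combinations that are systematic on the first, respectively the last, twelve
  positions; found by Gaussian elimination.\<close>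

definition left_combs :: "nat list list" where
  "left_combs =
   [[1,2,6,9,11],
    [0,1,4],
    [5,6,9,11],
    [0,1,2,3,4,6],
    [1,2,3,4,5,7],
    [1,3,4,5,8,9,11],
    [0,1,3,5,6,7,9],
    [1,2,4,6,7,8,10],
    [1,3,5,6,7,8],
    [1,4,7,8,11],
    [0,2,3,4,5,6,7,8,10,11],
    [0,1,5,8,10]]"

definition right_combs :: "nat list list" where
  "right_combs =
   [[1,3,4,5,7,8,9,11],
    [0,4,6,11],
    [0,2,3,4,5,10],
    [1,3,4,5,6,11],
    [0,1,3,5,6,10],
    [2,3,5,6,8,9],
    [1,5,6,8,10,11],
    [0,5,6,7,8,10],
    [1,6,7,8,9,11],
    [0,5,7,11],
    [0,2,3,4,6,7,8,10],
    [0,1,5,6,7,9,11]]"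

lemma length_gen_word: "length (gen_word s) = 24"
  by (simp add: gen_word_def qr_word_def)

lemma length_xor_word: "length (xor_word xs ys) = min (length xs) (length ys)"
  by (simp add: xor_word_def)

lemma length_comb_word: "length (comb_word ss) = 24"
  unfolding comb_word_def by (induction ss) (simp_all add: length_xor_word length_gen_word)

lemma sym_diff_word_set:
  assumes "length xs = 24" "length ys = 24"
  shows "sym_diff (word_set xs) (word_set ys) = word_set (xor_word xs ys)"
  using assms idx_less by (auto simp: word_set_def xor_word_def)

lemma Int_word_set:
  assumes "length xs = 24" "length ys = 24"
  shows "word_set xs \<inter> word_set ys = word_set (map2 (\<and>) xs ys)"
  using assms idx_less by (auto simp: word_set_def)

lemma card_word_set:
  assumes "length xs = 24"
  shows "card (word_set xs) = length (filter id xs)"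
proof -
  have "idx ` word_set xs = {n. n < length xs \<and> id (xs ! n)}"
    proof (intro equalityI subsetI)
    fix n assume "n \<in> {n. n < length xs \<and> id (xs ! n)}"
    moreover then obtain i where "n = idx i"
      using bij_idx assms by (auto simp: bij_betw_def)
    ultimately show "n \<in> idx ` word_set xs" by (simp add: word_set_def)
  qed (auto simp: word_set_def idx_less assms)
  moreover have "card (idx ` word_set xs) = card (word_set xs)"
    by (rule card_image) (metis inj_idx inj_on_subset subset_UNIV)
  ultimately show ?thesis by (simp add: length_filter_conv_card)
qed

lemma squares_mod_23:
  "(\<exists>q::23. q \<noteq> 0 \<and> d = q\<^sup>2) \<longleftrightarrow> qr_word ! nat (Rep_bit1 d)"
proof -
  have "(\<exists>q::23. q \<noteq> 0 \<and> d = q\<^sup>2) \<longleftrightarrow> (\<exists>z\<in>{1..22}. Rep_bit1 d = z\<^sup>2 mod 23)"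
  proof
    assume "\<exists>q::23. q \<noteq> 0 \<and> d = q\<^sup>2"
    then obtain q :: 23 where q: "q \<noteq> 0" "d = q\<^sup>2" by blast
    have "Rep_bit1 q \<noteq> 0"
      using q(1) of_int_Rep23[of q] by auto
    then have "Rep_bit1 q \<in> {1..22}"
      using Rep23_bounds[of q] by auto
    moreover have "Rep_bit1 d = (Rep_bit1 q)\<^sup>2 mod 23"
      using q(2) by (metis of_int_Rep23 of_int_power Rep23_of_int)
    ultimately show "\<exists>z\<in>{1..22}. Rep_bit1 d = z\<^sup>2 mod 23" by blast
  next
    assume "\<exists>z\<in>{1..22}. Rep_bit1 d = z\<^sup>2 mod 23"
    then obtain z where z: "z \<in> {1..22}" "Rep_bit1 d = z\<^sup>2 mod 23" by blast
    have "(of_int z :: 23) \<noteq> 0"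
    proof
      assume "(of_int z :: 23) = 0"
      moreover have "Rep_bit1 (0::23) = 0" by (rule bit1.Rep_0)
      ultimately show False using z(1) Rep23_of_int[of z] by auto
    qed
    moreover have "d = (of_int z)\<^sup>2"
      by (metis z(2) Rep23_of_int of_int_power of_int_Rep23)
    ultimately show "\<exists>q::23. q \<noteq> 0 \<and> d = q\<^sup>2" by blast
  qed
  also have "\<dots> \<longleftrightarrow> Rep_bit1 d \<in> (\<lambda>z. z\<^sup>2 mod 23) ` set [1..22]"
    by auto
  also have "\<dots> \<longleftrightarrow> qr_word ! nat (Rep_bit1 d)"
    using Rep23_bounds[of d] by (auto simp: qr_word_def nat_eq_iff upto_rec1)
  finally show ?thesis .
qed

lemma golay_generator_word:
  "golay_generator a = word_set (gen_word (nat (Rep_bit1 a)))"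
proof (rule set_eqI)
  fix i
  show "i \<in> golay_generator a \<longleftrightarrow> i \<in> word_set (gen_word (nat (Rep_bit1 a)))"
  proof (cases i)
    case None
    then show ?thesis
      by (simp add: golay_generator_def word_set_def idx_def gen_word_def nth_append qr_word_def)
  next
    case (Some b)
    have "Some b \<in> golay_generator a \<longleftrightarrow> (\<exists>q::23. q \<noteq> 0 \<and> b - a = q\<^sup>2)"
      unfolding golay_generator_def by (auto simp: algebra_simps)
    also have "\<dots> \<longleftrightarrow> qr_word ! nat (Rep_bit1 (b - a))"
      by (rule squares_mod_23)
    \<comment> \<open>The difference is rewritten as a sum modulo 23, the form in which
      \<open>nth_rotate\<close> produces the index.\<close>
    also have "nat (Rep_bit1 (b - a)) = (nat (Rep_bit1 b) + (23 - nat (Rep_bit1 a))) mod 23"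
    proof -
      have "Rep_bit1 (b - a) = (Rep_bit1 b - Rep_bit1 a) mod 23"
        by (metis of_int_Rep23 of_int_diff Rep23_of_int)
      also have "\<dots> = (Rep_bit1 b + (23 - Rep_bit1 a)) mod 23"
        by (metis add_diff_eq mod_add_self2 diff_add_eq)
      also have "\<dots> = int ((nat (Rep_bit1 b) + (23 - nat (Rep_bit1 a))) mod 23)"
        using Rep23_bounds[of a] Rep23_bounds[of b] by (simp add: zmod_int of_nat_diff nat_le_iff algebra_simps)
      finally show ?thesis by simp
    qed
    finally show ?thesis
      using Some Rep23_bounds[of b]
      by (simp add: word_set_def idx_def gen_word_def nth_append nth_rotate qr_word_def nat_less_iff add.commute)
  qed
qed

lemma golay_generators_words: "range golay_generator = (\<lambda>s. word_set (gen_word s)) ` {..<23}"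
proof -
  have "(\<lambda>a::23. nat (Rep_bit1 a)) ` UNIV = {..<23}"
  proof (intro equalityI subsetI)
    fix s assume "s \<in> {..<23::nat}"
    then have "s = nat (Rep_bit1 (of_int (int s) :: 23))"
      unfolding Rep23_of_int by simp
    then show "s \<in> range (\<lambda>a::23. nat (Rep_bit1 a))" by blast
  next
    fix s assume "s \<in> range (\<lambda>a::23. nat (Rep_bit1 a))"
    then show "s \<in> {..<23}" using Rep23_bounds by (auto simp: nat_less_iff)
  qed
  then show ?thesis
    by (simp add: golay_generator_word image_image flip: \<open>_ = {..<23}\<close>)
qed

lemma gen_word_in_golay: "s < 23 \<Longrightarrow> word_set (gen_word s) \<in> golay_code"
proof -
  assume "s < 23"
  then obtain a where "word_set (gen_word s) = golay_generator a"
    using golay_generators_words by (metis imageE imageI lessThan_iff)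
  then show ?thesis
    using golay_add[OF golay_empty, of a] by simp
qed

lemma golay_sym_diff:
  assumes "S \<in> golay_code" "S' \<in> golay_code"
  shows "sym_diff S S' \<in> golay_code"
  using assms(2)
proof induction
  case golay_empty
  then show ?case using assms(1) by simp
next
  case (golay_add S' a)
  have "sym_diff S (sym_diff S' (golay_generator a)) = sym_diff (sym_diff S S') (golay_generator a)"
    by blast
  then show ?case using golay_add.IH golay_code.golay_add by metis
qed

lemma comb_word_in_golay: "\<forall>s\<in>set ss. s < 23 \<Longrightarrow> word_set (comb_word ss) \<in> golay_code"
proof (induction ss)
  case Nil
  have "word_set (replicate 24 False) = {}"
    by (simp add: word_set_def idx_less)
  then show ?case by (simp add: comb_word_def golay_empty)
next
  case (Cons s ss)
  have "word_set (comb_word (s # ss)) = sym_diff (word_set (gen_word s)) (word_set (comb_word ss))"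
    by (simp add: sym_diff_word_set length_gen_word length_comb_word) (simp add: comb_word_def)
  then show ?case
    using Cons gen_word_in_golay golay_sym_diff by simp
qed

text \<open>A finite check on generators only. Parity of intersections is additive under symmetric
  difference, so induction carries it to the whole code.\<close>

lemma gen_words_self_orthogonal:
  "\<forall>s\<in>set [0..<23]. length (filter id (gen_word s)) = 12 \<and>
     (\<forall>t\<in>set [0..<23]. even (length (filter id (map2 (\<and>) (gen_word s) (gen_word t)))))"
  by code_simp

lemma left_words_systematic:
  "\<forall>i\<in>set [0..<12]. (\<forall>s\<in>set (left_combs ! i). s < 23) \<and>
     take 12 (comb_word (left_combs ! i)) = map (\<lambda>j. j = i) [0..<12]"
  by code_simp

lemma right_words_systematic:
  "\<forall>i\<in>set [0..<12]. (\<forall>s\<in>set (right_combs ! i). s < 23) \<and>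
     drop 12 (comb_word (right_combs ! i)) = map (\<lambda>j. j = i) [0..<12]"
  by code_simp

text \<open>Sums of at most two rows are enough: a nonzero codeword of weight below 8 would have
  weight 4, hence at most two ones in one half of the positions.\<close>

lemma left_words_weight:
  "\<forall>i\<in>set [0..<12]. \<forall>j\<in>set [0..<12].
     length (filter id (comb_word (left_combs ! i))) \<ge> 8 \<and>
     (i \<noteq> j \<longrightarrow> length (filter id (xor_word (comb_word (left_combs ! i)) (comb_word (left_combs ! j)))) \<ge> 8)"
  by code_simp

lemma right_words_weight:
  "\<forall>i\<in>set [0..<12]. \<forall>j\<in>set [0..<12].
     length (filter id (comb_word (right_combs ! i))) \<ge> 8 \<and>
     (i \<noteq> j \<longrightarrow> length (filter id (xor_word (comb_word (right_combs ! i)) (comb_word (right_combs ! j)))) \<ge> 8)"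
  by code_simp

section \<open>Self-orthogonality and weights divisible by 4\<close>

lemma card_sym_diff:
  assumes "finite A" "finite B"
  shows "card (sym_diff A B) + 2 * card (A \<inter> B) = card A + card B"
proof -
  have "card (sym_diff A B) = card (A - B) + card (B - A)"
    using assms by (intro card_Un_disjoint) auto
  moreover have "card A = card (A - B) + card (A \<inter> B)" "card B = card (B - A) + card (A \<inter> B)"
    using assms by (metis card_Diff_subset_Int card_mono Int_lower1 finite_Int le_add_diff_inverse2 Int_commute)+
  ultimately show ?thesis by simp
qed

lemma even_card_sym_diff:
  assumes "finite A" "finite B"
  shows "even (card (sym_diff A B)) \<longleftrightarrow> (even (card A) \<longleftrightarrow> even (card B))"
  using arg_cong[OF card_sym_diff[OF assms], of even] by simp

lemma golay_generator_orthogonal: "even (card (golay_generator a \<inter> golay_generator b))"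
proof -
  have "golay_generator a \<in> range golay_generator" "golay_generator b \<in> range golay_generator"
    by simp_all
  then obtain s t where "s < 23" "t < 23" "golay_generator a = word_set (gen_word s)"
      "golay_generator b = word_set (gen_word t)"
    unfolding golay_generators_words by auto
  then show ?thesis
    using gen_words_self_orthogonal
    by (simp add: Int_word_set card_word_set length_gen_word)
qed

lemma card_golay_generator: "card (golay_generator a) = 12"
proof -
  have "golay_generator a \<in> range golay_generator" by simp
  then obtain s where "s < 23" "golay_generator a = word_set (gen_word s)"
    unfolding golay_generators_words by auto
  then show ?thesis
    using gen_words_self_orthogonal by (simp add: card_word_set length_gen_word)
qed

lemma golay_orthogonal_generator:
  assumes "S \<in> golay_code"
  shows "even (card (S \<inter> golay_generator a))"
  using assms
proof induction
  case (golay_add S b)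
  have "sym_diff S (golay_generator b) \<inter> golay_generator a =
      sym_diff (S \<inter> golay_generator a) (golay_generator b \<inter> golay_generator a)" by blast
  then show ?case
    using golay_add.IH golay_generator_orthogonal by (simp add: even_card_sym_diff)
qed simp

lemma golay_orthogonal:
  assumes "S \<in> golay_code" "S' \<in> golay_code"
  shows "even (card (S \<inter> S'))"
  using assms(2)
proof induction
  case (golay_add S' b)
  have "S \<inter> sym_diff S' (golay_generator b) = sym_diff (S \<inter> S') (S \<inter> golay_generator b)" by blast
  then show ?case
    using golay_add.IH golay_orthogonal_generator[OF assms(1)] by (simp add: even_card_sym_diff)
qed simp

text \<open>Adding a generator changes the weight by 12 minus twice the size of the intersection,
  and that size is even.\<close>

lemma golay_doubly_even:
  assumes "S \<in> golay_code"
  shows "4 dvd card S"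
  using assms
proof induction
  case (golay_add S a)
  obtain k where "card (S \<inter> golay_generator a) = 2 * k"
    using golay_orthogonal_generator[OF golay_add.hyps] by blast
  then have "card (sym_diff S (golay_generator a)) + 4 * k = card S + 12"
    using card_sym_diff[of S "golay_generator a"] by (simp add: card_golay_generator)
  then show ?case using golay_add.IH by presburger
qed simp

section \<open>Minimum weight 8 from two systematic bases\<close>

definition left_word :: "23 option \<Rightarrow> 23 option set" where
  "left_word i = word_set (comb_word (left_combs ! idx i))"

definition right_word :: "23 option \<Rightarrow> 23 option set" where
  "right_word i = word_set (comb_word (right_combs ! (idx i - 12)))"

lemma left_word_golay: "idx i < 12 \<Longrightarrow> left_word i \<in> golay_code"
  unfolding left_word_def using left_words_systematic by (intro comb_word_in_golay) auto

lemma right_word_golay: "\<not> idx i < 12 \<Longrightarrow> right_word i \<in> golay_code"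
  unfolding right_word_def using right_words_systematic idx_less[of i] by (intro comb_word_in_golay) auto

lemma mem_left_word:
  assumes "idx i < 12" "idx j < 12"
  shows "j \<in> left_word i \<longleftrightarrow> j = i"
proof -
  have "take 12 (comb_word (left_combs ! idx i)) ! idx j = map (\<lambda>l. l = idx i) [0..<12] ! idx j"
    using assms left_words_systematic by simp
  then show ?thesis using assms by (simp add: left_word_def word_set_def inj_eq[OF inj_idx])
qed

lemma mem_right_word:
  assumes "\<not> idx i < 12" "\<not> idx j < 12"
  shows "j \<in> right_word i \<longleftrightarrow> j = i"
proof -
  have "drop 12 (comb_word (right_combs ! (idx i - 12))) ! (idx j - 12) =
      map (\<lambda>l. l = idx i - 12) [0..<12] ! (idx j - 12)"
    using assms right_words_systematic idx_less[of i] by simp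
  moreover have "idx j - 12 = idx i - 12 \<longleftrightarrow> j = i"
    using assms inj_eq[OF inj_idx, of j i] by linarith
  ultimately show ?thesis
    using assms idx_less[of j] by (auto simp: right_word_def word_set_def length_comb_word)
qed

lemma card_left_word: "idx i < 12 \<Longrightarrow> card (left_word i) \<ge> 8"
  using left_words_weight by (auto simp: left_word_def card_word_set length_comb_word)

lemma card_right_word: "\<not> idx i < 12 \<Longrightarrow> card (right_word i) \<ge> 8"
proof -
  assume "\<not> idx i < 12"
  then have "idx i - 12 \<in> set [0..<12]" using idx_less[of i] by auto
  then show ?thesis
    using right_words_weight by (auto simp: right_word_def card_word_set length_comb_word)
qed

lemma card_left_words:
  "idx i < 12 \<Longrightarrow> idx j < 12 \<Longrightarrow> i \<noteq> j \<Longrightarrow> card (sym_diff (left_word i) (left_word j)) \<ge> 8"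
  using left_words_weight inj_eq[OF inj_idx, of i j]
  by (auto simp: left_word_def sym_diff_word_set card_word_set length_comb_word length_xor_word)

lemma card_right_words:
  assumes "\<not> idx i < 12" "\<not> idx j < 12" "i \<noteq> j"
  shows "card (sym_diff (right_word i) (right_word j)) \<ge> 8"
proof -
  have "idx i - 12 < 12" "idx j - 12 < 12" using idx_less[of i] idx_less[of j] by auto
  moreover have "idx i - 12 \<noteq> idx j - 12" using assms inj_eq[OF inj_idx, of i j] by linarith
  ultimately show ?thesis using right_words_weight
    by (auto simp: right_word_def sym_diff_word_set card_word_set length_comb_word length_xor_word)
qed

text \<open>The positions outside \<open>p\<close> form an information set of the code, which is orthogonal to itself,
  so a codeword is determined by its positions in \<open>p\<close>.\<close>

lemma golay_systematic_zero:
  assumes v: "\<And>i. \<not> p i \<Longrightarrow> v i \<in> golay_code" "\<And>i j. \<not> p i \<Longrightarrow> \<not> p j \<Longrightarrow> j \<in> v i \<longleftrightarrow> j = i"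
    and S: "S \<in> golay_code" "\<And>i. p i \<Longrightarrow> i \<notin> S"
  shows "S = {}"
proof (rule ccontr)
  assume "S \<noteq> {}"
  then obtain i where i: "i \<in> S" "\<not> p i" using S(2) by blast
  then have "S \<inter> v i = {i}" using v(2)[of i] S(2) by blast
  moreover have "even (card (S \<inter> v i))" using golay_orthogonal[OF S(1) v(1)[OF i(2)]] .
  ultimately show False by simp
qed

lemma sym_diff_eq_empty: "sym_diff A B = {} \<longleftrightarrow> A = B"
  by blast

lemma card_le_2_cases:
  assumes "card A \<le> 2" "finite A"
  obtains "A = {}" | a where "A = {a}" | a b where "A = {a, b}" "a \<noteq> b"
proof -
  have "card A = 0 \<or> card A = 1 \<or> card A = 2" using assms(1) by auto
  then show thesis using that assms(2) by (auto simp: card_1_singleton_iff card_2_iff)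
qed

text \<open>By \<open>zero\<close> a codeword is determined by its positions in \<open>p\<close>.
  With at most two of them it must be the sum of the corresponding rows \<open>w\<close>, whose
  weights are known.\<close>

lemma golay_systematic_weight:
  assumes zero: "\<And>S. S \<in> golay_code \<Longrightarrow> (\<And>i. p i \<Longrightarrow> i \<notin> S) \<Longrightarrow> S = {}"
    and w: "\<And>i. p i \<Longrightarrow> w i \<in> golay_code" "\<And>i j. p i \<Longrightarrow> p j \<Longrightarrow> j \<in> w i \<longleftrightarrow> j = i"
    and wt: "\<And>i. p i \<Longrightarrow> card (w i) \<ge> 8" "\<And>i j. p i \<Longrightarrow> p j \<Longrightarrow> i \<noteq> j \<Longrightarrow> card (sym_diff (w i) (w j)) \<ge> 8"
    and S: "S \<in> golay_code" "S \<noteq> {}" and c: "card {i\<in>S. p i} \<le> 2"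
  shows "card S \<ge> 8"
proof (rule card_le_2_cases[OF c])
  assume "{i\<in>S. p i} = {}"
  then show ?thesis using zero[OF S(1)] S(2) by blast
next
  fix a assume a: "{i\<in>S. p i} = {a}"
  then have pa: "p a" by blast
  have "sym_diff S (w a) = {}"
  proof (rule zero)
    show "sym_diff S (w a) \<in> golay_code" by (rule golay_sym_diff[OF S(1) w(1)[OF pa]])
    show "i \<notin> sym_diff S (w a)" if "p i" for i using a w(2)[OF pa that] that by blast
  qed
  then show ?thesis using wt(1)[OF pa] by (simp only: sym_diff_eq_empty)
next
  fix a b assume ab: "{i\<in>S. p i} = {a, b}" "a \<noteq> b"
  then have p: "p a" "p b" by blast+
  have "sym_diff S (sym_diff (w a) (w b)) = {}"
  proof (rule zero)
    show "sym_diff S (sym_diff (w a) (w b)) \<in> golay_code"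
      by (intro golay_sym_diff S(1) w(1) p)
    show "i \<notin> sym_diff S (sym_diff (w a) (w b))" if "p i" for i
      using ab w(2)[OF p(1) that] w(2)[OF p(2) that] that by blast
  qed
  then show ?thesis using wt(2)[OF p ab(2)] unfolding sym_diff_eq_empty by blast
qed simp

text \<open>Divisibility by 4 turns a weight below 8 into one of at most 4; some half of the
  positions then holds at most two ones, and the basis systematic on that half applies.\<close>

lemma golay_min_weight:
  assumes S: "S \<in> golay_code" "S \<noteq> {}"
  shows "card S \<ge> 8"
proof (rule ccontr)
  assume "\<not> card S \<ge> 8"
  moreover obtain k where "card S = 4 * k" using golay_doubly_even[OF S(1)] by (elim dvdE)
  ultimately have "card S \<le> 4" by simp
  moreover have "card S = card {i\<in>S. idx i < 12} + card {i\<in>S. \<not> idx i < 12}"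
    by (subst card_Un_disjoint[symmetric]) (auto intro: arg_cong[where f=card])
  ultimately have "card {i\<in>S. idx i < 12} \<le> 2 \<or> card {i\<in>S. \<not> idx i < 12} \<le> 2" by linarith
  \<comment> \<open>Both bases enter: the rows systematic on one half bound the weight, and
    orthogonality to the rows systematic on the other half shows that a codeword vanishing on the
    first half is empty.\<close>
  moreover have "card S \<ge> 8" if "card {i\<in>S. idx i < 12} \<le> 2"
    by (rule golay_systematic_weight[where p = "\<lambda>i. idx i < 12" and w = left_word,
          OF golay_systematic_zero[where p = "\<lambda>i. idx i < 12", OF right_word_golay mem_right_word]
            left_word_golay mem_left_word card_left_word card_left_words S that])
  moreover have "card S \<ge> 8" if "card {i\<in>S. \<not> idx i < 12} \<le> 2"
    by (rule golay_systematic_weight[where p = "\<lambda>i. \<not> idx i < 12" and w = right_word,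
          OF golay_systematic_zero[where p = "\<lambda>i. \<not> idx i < 12", OF left_word_golay mem_left_word]
            right_word_golay mem_right_word card_right_word card_right_words S that])
       simp_all
  ultimately show False using \<open>\<not> card S \<ge> 8\<close> by blast
qed

lemma UNIV_golay: "UNIV \<in> golay_code"
proof -
  \<comment> \<open>Seven generators that add up to the all-one word. The sum of all 23 generators
    is the same word, since every finite position lies in 11 of them and infinity in 23.\<close>
  have "(\<forall>s\<in>set [0, 2, 4, 5, 6, 10, 11::nat]. s < 23) \<and> comb_word [0, 2, 4, 5, 6, 10, 11] = replicate 24 True"
    by code_simp
  moreover have "word_set (replicate 24 True) = UNIV"
    by (simp add: word_set_def idx_less)
  ultimately show ?thesis using comb_word_in_golay by metis
qed

lemma golay_Compl:
  assumes "S \<in> golay_code"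
  shows "- S \<in> golay_code"
proof -
  have "sym_diff S UNIV = - S" by blast
  then show ?thesis using golay_sym_diff[OF assms UNIV_golay] by simp
qed

section \<open>Size of the code and number of octads\<close>

lemma card_golay_ge: "card golay_code \<ge> 4096"
proof -
  let ?P = "{i. idx i < 12}"
  have *: "\<exists>S\<in>golay_code. \<forall>i\<in>?P. i \<in> S \<longleftrightarrow> i \<in> A" if "A \<subseteq> ?P" for A
    using finite[of A] that
  proof (induction A rule: finite_subset_induct)
    case empty
    then show ?case using golay_empty by blast
  next
    case (insert k A')
    then obtain S where S: "S \<in> golay_code" "\<forall>i\<in>?P. i \<in> S \<longleftrightarrow> i \<in> A'" by blast
    have "sym_diff S (left_word k) \<in> golay_code"
      using S insert left_word_golay by (intro golay_sym_diff) auto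
    moreover have "\<forall>i\<in>?P. i \<in> sym_diff S (left_word k) \<longleftrightarrow> i \<in> insert k A'"
      using S(2) insert mem_left_word[of k] by auto
    ultimately show ?case by blast
  qed
  have "Pow ?P \<subseteq> (\<lambda>S. S \<inter> ?P) ` golay_code"
  proof
    fix A assume A: "A \<in> Pow ?P"
    then obtain S where S: "S \<in> golay_code" "\<forall>i\<in>?P. i \<in> S \<longleftrightarrow> i \<in> A" using *[of A] by blast
    then have "A = S \<inter> ?P" using A by blast
    then show "A \<in> (\<lambda>S. S \<inter> ?P) ` golay_code" using S(1) by blast
  qed
  then have "card (Pow ?P) \<le> card golay_code"
    by (rule surj_card_le[rotated]) simp
  moreover have "card ?P = 12"
  proof -
    have "idx ` ?P = idx ` UNIV \<inter> {..<12}" by auto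
    also have "\<dots> = {..<12}" using bij_idx by (auto simp: bij_betw_def)
    finally have "idx ` ?P = {..<12}" .
    then show ?thesis using card_image[of idx ?P] inj_idx by (simp add: inj_on_def)
  qed
  ultimately show ?thesis by (simp add: card_Pow)
qed

text \<open>Every generator contains infinity, and the one at \<open>a\<close> omits
  \<open>a\<close>. For two finite points, -1 is not a square modulo 23, so one of
  \<open>b - a\<close>, \<open>a - b\<close> is a nonzero square, and the generator at one point
  contains the other.\<close>

lemma golay_separates:
  assumes "i \<noteq> j"
  shows "\<exists>S\<in>golay_code. (i \<in> S) \<noteq> (j \<in> S)"
proof (rule ccontr)
  assume "\<not> ?thesis"
  then have same: "S \<in> golay_code \<Longrightarrow> i \<in> S \<longleftrightarrow> j \<in> S" for S by blast
  have gen: "golay_generator a \<in> golay_code" for a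
    using golay_add[OF golay_empty, of a] by simp
  have none: "None \<in> golay_generator a" for a by (simp add: golay_generator_def)
  have self: "Some a \<notin> golay_generator a" for a
  proof -
    have "Rep_bit1 (0::23) = 0" by (rule bit1.Rep_0)
    then have "\<not> (\<exists>q::23. q \<noteq> 0 \<and> 0 = q\<^sup>2)"
      unfolding squares_mod_23 by (simp add: qr_word_def)
    then show ?thesis by (auto simp: golay_generator_def)
  qed
  obtain a b where ab: "i = Some a" "j = Some b"
    using assms same[OF gen] none self by (cases i; cases j) blast+
  have "\<exists>q::23. q \<noteq> 0 \<and> (b - a = q\<^sup>2 \<or> a - b = q\<^sup>2)"
  proof -
    define d where "d = b - a"
    define z where "z = Rep_bit1 d"
    have "d \<noteq> 0" using assms ab by (simp add: d_def)
    then have "z \<noteq> 0" unfolding z_def using of_int_Rep23[of d] by auto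
    then have "z \<in> set [1..22]" using Rep23_bounds[of d] by (auto simp: z_def)
    moreover have "\<forall>z\<in>set [1..22::int]. qr_word ! nat z \<or> qr_word ! nat (- z mod 23)"
      by code_simp
    moreover have "Rep_bit1 (- d) = - z mod 23"
      unfolding z_def by (metis of_int_Rep23 of_int_minus Rep23_of_int)
    ultimately have "qr_word ! nat (Rep_bit1 d) \<or> qr_word ! nat (Rep_bit1 (- d))"
      by (metis z_def)
    then have "(\<exists>q::23. q \<noteq> 0 \<and> d = q\<^sup>2) \<or> (\<exists>q::23. q \<noteq> 0 \<and> - d = q\<^sup>2)"
      by (simp only: squares_mod_23)
    then show ?thesis unfolding d_def by auto
  qed
  then show False
    using same[OF gen, of a] same[OF gen, of b] self[of a] self[of b] unfolding ab
    by (auto simp: golay_generator_def algebra_simps)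
qed

lemma card_Compl_23_option: "card (- S) = 24 - card S" for S :: "23 option set"
  by (simp add: Compl_eq_Diff_UNIV card_Diff_subset)

text \<open>Second moment of the weights. The sign functions \<open>sg\<close> of distinct
  coordinates are orthogonal over the code, so \<open>(24 - 2 |S|)^2\<close> has mean 24. Weight 12
  contributes 0, weights 8 and 16 contribute 64, the words \<open>{}\<close> and \<open>UNIV\<close>
  contribute 576 each; complementation pairs weights 8 and 16, and (24 * 4096 - 1152) / 128 =
  759.\<close>

lemma golay_octads: "card {S\<in>golay_code. card S = 8} \<ge> 759"
proof -
  define sg where "sg S i = (if i \<in> S then -1 else 1 :: real)" for S :: "23 option set" and i
  have fin: "finite golay_code" by (rule finite_subset[of _ UNIV]) auto
  have orth: "(\<Sum>S\<in>golay_code. sg S i * sg S j) = 0" if "i \<noteq> j" for i j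
  proof -
    obtain T where T: "T \<in> golay_code" "(i \<in> T) \<noteq> (j \<in> T)" using golay_separates[OF \<open>i \<noteq> j\<close>] by blast
    have inv: "sym_diff (sym_diff S T) T = S" for S by blast
    \<comment> \<open>Adding a codeword \<open>T\<close> that contains exactly one of
      \<open>i\<close>, \<open>j\<close> permutes the code and negates every summand.\<close>
    have "(\<Sum>S\<in>golay_code. sg S i * sg S j) = (\<Sum>S\<in>golay_code. sg (sym_diff S T) i * sg (sym_diff S T) j)"
      by (rule sum.reindex_bij_witness[where i="\<lambda>S. sym_diff S T" and j="\<lambda>S. sym_diff S T"])
         (simp_all add: inv golay_sym_diff T)
    also have "\<dots> = (\<Sum>S\<in>golay_code. - (sg S i * sg S j))"
      using T(2) by (intro sum.cong) (auto simp: sg_def)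
    finally show ?thesis by (simp add: sum_negf)
  qed
  have sq: "(\<Sum>i\<in>UNIV. sg S i) = 24 - 2 * real (card S)" for S
  proof -
    have "sg S i = 1 - 2 * indicator S i" for i by (simp add: sg_def)
    moreover have "(\<Sum>i\<in>UNIV. indicator S i) = real (card S)"
      by (simp add: indicator_def sum.If_cases)
    ultimately show ?thesis by (simp add: sum_subtractf flip: sum_distrib_left)
  qed
  have "(\<Sum>S\<in>golay_code. (\<Sum>i\<in>UNIV. sg S i)\<^sup>2) = (\<Sum>S\<in>golay_code. \<Sum>i\<in>UNIV. \<Sum>j\<in>UNIV. sg S i * sg S j)"
    by (simp add: power2_eq_square sum_product)
  also have "\<dots> = (\<Sum>i\<in>UNIV. \<Sum>j\<in>UNIV. \<Sum>S\<in>golay_code. sg S i * sg S j)"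
    by (subst sum.swap) (intro sum.cong refl, rule sum.swap)
  also have "\<dots> = (\<Sum>i\<in>UNIV. \<Sum>j\<in>(UNIV :: 23 option set). if j = i then real (card golay_code) else 0)"
  proof -
    have "(\<Sum>S\<in>golay_code. sg S i * sg S j) = (if j = i then real (card golay_code) else 0)" for i j
    proof (cases "j = i")
      case True
      have "sg S i * sg S i = 1" for S by (simp add: sg_def)
      then show ?thesis using True by simp
    qed (simp add: orth)
    then show ?thesis by simp
  qed
  also have "\<dots> = 24 * real (card golay_code)"
    by simp
  finally have total: "(\<Sum>S\<in>golay_code. (24 - 2 * real (card S))\<^sup>2) = 24 * real (card golay_code)"
    by (simp add: sq)
  let ?O = "{S\<in>golay_code. card S = 8}"
  let ?O' = "{S\<in>golay_code. card S = 16}"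
  have O': "card ?O' = card ?O"
  proof (rule bij_betw_same_card[of uminus])
    show "bij_betw uminus ?O' ?O"
      by (rule bij_betw_byWitness[where f'=uminus]) (auto simp: golay_Compl card_Compl_23_option)
  qed
  have bound: "(24 - 2 * real (card S))\<^sup>2 \<le>
      576 * (of_bool (S = {}) + of_bool (S = UNIV)) + 64 * (of_bool (card S = 8) + of_bool (card S = 16))"
    if S: "S \<in> golay_code" for S
  proof (cases "S = {} \<or> S = UNIV")
    case True
    then show ?thesis by auto
  next
    case False
    obtain k where k: "card S = 4 * k" using golay_doubly_even[OF S] by (elim dvdE)
    have "card S \<ge> 8" using golay_min_weight[OF S] False by blast
    moreover have "card (- S) \<ge> 8" using golay_min_weight[OF golay_Compl[OF S]] False by blast
    then have "card S \<le> 16" using card_mono[of UNIV S] by (simp add: card_Compl_23_option)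
    ultimately have "card S \<in> {8, 12, 16}" using k by (simp, presburger)
    then show ?thesis by auto
  qed
  have "24 * 4096 \<le> 24 * real (card golay_code)"
    using card_golay_ge by simp
  also have "\<dots> \<le> (\<Sum>S\<in>golay_code. 576 * (of_bool (S = {}) + of_bool (S = UNIV)) +
      64 * (of_bool (card S = 8) + of_bool (card S = 16)))"
    unfolding total[symmetric] by (intro sum_mono bound)
  also have "\<dots> = 576 * 2 + 64 * (real (card ?O) + real (card ?O'))"
  proof -
    have "{S \<in> golay_code. S = {}} = {{}}" "{S \<in> golay_code. S = UNIV} = {UNIV}"
      using golay_empty UNIV_golay by auto
    then show ?thesis
      using fin by (simp add: sum.distrib Int_def conj_commute flip: sum_distrib_left)
  qed
  finally have "24 * 4096 \<le> 576 * 2 + 128 * real (card ?O)" by (simp add: O')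
  then show ?thesis by linarith
qed

section \<open>Minimal vectors of the Leech lattice\<close>

definition leech_int :: "(23 option \<Rightarrow> int) set" where
  "leech_int = {u. \<exists>m. (\<forall>i. u i mod 2 = m mod 2) \<and>
     (\<Sum>i\<in>UNIV. u i) mod 8 = (4 * m) mod 8 \<and> (\<forall>k. {i. u i mod 4 = k mod 4} \<in> golay_code)}"

definition leech_vec :: "(23 option \<Rightarrow> int) \<Rightarrow> real ^ 23 option" where
  "leech_vec u = (1 / sqrt 8) *\<^sub>R (\<chi> i. real_of_int (u i))"

definition even_type :: "(23 option \<Rightarrow> int) \<Rightarrow> bool" where
  "even_type u \<longleftrightarrow> (\<forall>i. even (u i)) \<and> (\<Sum>i\<in>UNIV. u i) mod 8 = 0 \<and> {i. u i mod 4 = 2} \<in> golay_code"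

definition odd_type :: "(23 option \<Rightarrow> int) \<Rightarrow> bool" where
  "odd_type u \<longleftrightarrow> (\<forall>i. odd (u i)) \<and> (\<Sum>i\<in>UNIV. u i) mod 8 = 4 \<and> {i. u i mod 4 = 1} \<in> golay_code"

text \<open>Only the parity of \<open>m\<close> matters. For a given parity two of the four classes
  modulo 4 are empty and the other two are complementary, so a single Golay condition
  remains.\<close>

lemma leech_int_iff: "u \<in> leech_int \<longleftrightarrow> even_type u \<or> odd_type u"
proof
  assume "u \<in> leech_int"
  then obtain m where m: "\<And>i. u i mod 2 = m mod 2" "(\<Sum>i\<in>UNIV. u i) mod 8 = (4 * m) mod 8"
      "\<And>k. {i. u i mod 4 = k mod 4} \<in> golay_code"
    unfolding leech_int_def by blast
  show "even_type u \<or> odd_type u"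
  proof (cases "even m")
    case True
    then have "(4 * m) mod 8 = 0" by presburger
    moreover have "\<forall>i. even (u i)" using m(1) True by (simp add: even_iff_mod_2_eq_zero)
    ultimately show ?thesis using m(2) m(3)[of 2] by (simp add: even_type_def)
  next
    case False
    then have "(4 * m) mod 8 = 4" by presburger
    moreover have "\<forall>i. odd (u i)" using m(1) False by (simp add: even_iff_mod_2_eq_zero)
    ultimately show ?thesis using m(2) m(3)[of 1] by (simp add: odd_type_def)
  qed
next
  assume "even_type u \<or> odd_type u"
  then show "u \<in> leech_int"
  proof
    assume u: "even_type u"
    have "{i. u i mod 4 = k mod 4} \<in> golay_code" for k
    proof -
      have ev: "even (u i)" for i using u by (simp add: even_type_def)
      have "k mod 4 = 0 \<or> k mod 4 = 2 \<or> odd k" by presburger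
      then consider "k mod 4 = 0" | "k mod 4 = 2" | "odd k" by blast
      then show ?thesis
      proof cases
        case 1
        have "{i. u i mod 4 = k mod 4} = - {i. u i mod 4 = 2}"
        proof -
          have "(u i mod 4 = 0) = (u i mod 4 \<noteq> 2)" for i using ev[of i] by presburger
          then show ?thesis unfolding 1 by auto
        qed
        then show ?thesis using u golay_Compl by (simp add: even_type_def)
      next
        case 2
        then show ?thesis using u by (simp add: even_type_def)
      next
        case 3
        have "u i mod 4 \<noteq> k mod 4" for i using ev[of i] 3 by presburger
        then show ?thesis using golay_empty by simp
      qed
    qed
    then show ?thesis using u unfolding leech_int_def even_type_def
      by (intro CollectI exI[of _ 0]) (auto simp: even_iff_mod_2_eq_zero)
  next
    assume u: "odd_type u"
    have "{i. u i mod 4 = k mod 4} \<in> golay_code" for k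
    proof -
      have ev: "odd (u i)" for i using u by (simp add: odd_type_def)
      have "k mod 4 = 1 \<or> k mod 4 = 3 \<or> even k" by presburger
      then consider "k mod 4 = 3" | "k mod 4 = 1" | "even k" by blast
      then show ?thesis
      proof cases
        case 1
        have "(u i mod 4 = 3) = (u i mod 4 \<noteq> 1)" for i using ev[of i] by presburger
        then have "{i. u i mod 4 = k mod 4} = - {i. u i mod 4 = 1}"
          unfolding 1 by auto
        then show ?thesis using u golay_Compl by (simp add: odd_type_def)
      next
        case 2
        then show ?thesis using u by (simp add: odd_type_def)
      next
        case 3
        have "u i mod 4 \<noteq> k mod 4" for i using ev[of i] 3 by presburger
        then show ?thesis using golay_empty by simp
      qed
    qed
    then show ?thesis using u unfolding leech_int_def odd_type_def
      by (intro CollectI exI[of _ 1]) (auto simp: odd_iff_mod_2_eq_one)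
  qed
qed

lemma leech_lattice_eq: "leech_lattice = leech_vec ` leech_int"
  unfolding leech_lattice_def leech_int_def leech_vec_def by auto

section \<open>Group structure, integrality and minimal norm\<close>

lemma even_type_add:
  assumes "even_type u" "even_type v"
  shows "even_type (\<lambda>i. u i + v i)"
proof -
  have pw: "((a + b) mod 4 = 2) = ((a mod 4 = 2) \<noteq> (b mod 4 = 2))" if "even a" "even b" for a b :: int
    using that by presburger
  have "{i. (u i + v i) mod 4 = 2} = sym_diff {i. u i mod 4 = 2} {i. v i mod 4 = 2}"
    using pw[of "u _" "v _"] assms unfolding even_type_def by blast
  moreover have "(a + b) mod 8 = 0" if "a mod 8 = 0" "b mod 8 = 0" for a b :: int
    using that by presburger
  ultimately show ?thesis
    using assms golay_sym_diff by (simp add: even_type_def sum.distrib)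
qed

text \<open>Two odd residues modulo 4 add up to 2 exactly when they agree, hence the complement of
  the symmetric difference.\<close>

lemma odd_type_add:
  assumes "odd_type u" "odd_type v"
  shows "even_type (\<lambda>i. u i + v i)"
proof -
  have pw: "((a + b) mod 4 = 2) = (\<not> ((a mod 4 = 1) \<noteq> (b mod 4 = 1)))" if "odd a" "odd b" for a b :: int
    using that by presburger
  have "{i. (u i + v i) mod 4 = 2} = - sym_diff {i. u i mod 4 = 1} {i. v i mod 4 = 1}"
    using pw[of "u _" "v _"] assms unfolding odd_type_def by blast
  moreover have "(a + b) mod 8 = 0" if "a mod 8 = 4" "b mod 8 = 4" for a b :: int
    using that by presburger
  moreover have "- sym_diff {i. u i mod 4 = 1} {i. v i mod 4 = 1} \<in> golay_code"
    using assms by (intro golay_Compl golay_sym_diff) (auto simp: odd_type_def)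
  ultimately show ?thesis
    using assms by (simp add: even_type_def odd_type_def sum.distrib del: Compl_Un)
qed

lemma odd_even_type_add:
  assumes "odd_type u" "even_type v"
  shows "odd_type (\<lambda>i. u i + v i)"
proof -
  have pw: "((a + b) mod 4 = 1) = ((a mod 4 = 1) \<noteq> (b mod 4 = 2))" if "odd a" "even b" for a b :: int
    using that by presburger
  have "{i. (u i + v i) mod 4 = 1} = sym_diff {i. u i mod 4 = 1} {i. v i mod 4 = 2}"
    using pw[of "u _" "v _"] assms unfolding odd_type_def even_type_def by blast
  moreover have "(a + b) mod 8 = 4" if "a mod 8 = 4" "b mod 8 = 0" for a b :: int
    using that by presburger
  ultimately show ?thesis
    using assms golay_sym_diff by (simp add: even_type_def odd_type_def sum.distrib)
qed

lemma leech_int_add: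
  assumes "u \<in> leech_int" "v \<in> leech_int"
  shows "(\<lambda>i. u i + v i) \<in> leech_int"
proof -
  have "odd_type (\<lambda>i. u i + v i)" if "even_type u" "odd_type v"
    using odd_even_type_add[OF that(2,1)] by (simp add: add.commute)
  then show ?thesis
    using assms even_type_add odd_type_add odd_even_type_add unfolding leech_int_iff by blast
qed

lemma leech_int_uminus:
  assumes "u \<in> leech_int"
  shows "(\<lambda>i. - u i) \<in> leech_int"
proof -
  consider "even_type u" | "odd_type u" using assms leech_int_iff by blast
  then show ?thesis
  proof cases
    case 1
    have "(- a mod 4 = 2) = (a mod 4 = 2)" "a mod 8 = 0 \<Longrightarrow> - a mod 8 = 0" for a :: int
      by presburger+
    then have "even_type (\<lambda>i. - u i)" using 1 by (simp add: even_type_def sum_negf)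
    then show ?thesis by (simp add: leech_int_iff)
  next
    case 2
    have "(- a mod 4 = 1) = (\<not> a mod 4 = 1)" if "odd a" for a :: int using that by presburger
    then have "{i. - u i mod 4 = 1} = - {i. u i mod 4 = 1}" using 2 by (auto simp: odd_type_def)
    moreover have "a mod 8 = 4 \<Longrightarrow> - a mod 8 = 4" for a :: int
      by presburger
    ultimately have "odd_type (\<lambda>i. - u i)" using 2 golay_Compl by (simp add: odd_type_def sum_negf)
    then show ?thesis by (simp add: leech_int_iff)
  qed
qed

lemma sum_mod_cong:
  fixes f g :: "'a \<Rightarrow> int"
  assumes "\<And>i. i \<in> A \<Longrightarrow> f i mod m = g i mod m"
  shows "sum f A mod m = sum g A mod m"
proof -
  have "sum f A mod m = (\<Sum>i\<in>A. f i mod m) mod m" by (simp add: mod_sum_eq)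
  also have "\<dots> = (\<Sum>i\<in>A. g i mod m) mod m" by (simp add: assms)
  finally show ?thesis by (simp add: mod_sum_eq)
qed

lemma sum_of_bool_card: "(\<Sum>i\<in>UNIV. of_bool (P i)) = int (card {i. P i})" for P :: "'a::finite \<Rightarrow> bool"
  by (simp add: of_bool_def sum.If_cases)

text \<open>Squares modulo 16. In the even case each entry that is 2 modulo 4 gives 4, and codeword
  weights are multiples of 4. In the odd case \<open>a^2\<close> is \<open>2 a + 3\<close>, less 4
  if \<open>a\<close> is 1 modulo 4; over 24 coordinates with sum 4 modulo 8 this adds up to
  0.\<close>

lemma leech_int_norm_dvd:
  assumes "u \<in> leech_int"
  shows "16 dvd (\<Sum>i\<in>UNIV. (u i)\<^sup>2)"
proof -
  consider "even_type u" | "odd_type u" using assms leech_int_iff by blast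
  then show ?thesis
  proof cases
    case 1
    have pw: "a\<^sup>2 mod 16 = (4 * of_bool (a mod 4 = 2)) mod 16" if "even a" for a :: int
    proof -
      have "a mod 4 = 0 \<or> a mod 4 = 2" using that by presburger
      then obtain b where b: "(a = 4 * b \<and> a mod 4 = 0) \<or> (a = 4 * b + 2 \<and> a mod 4 = 2)"
        by (metis mult_div_mod_eq add.right_neutral)
      then show ?thesis
      proof
        assume "a = 4 * b \<and> a mod 4 = 0"
        then have "a\<^sup>2 = 16 * b\<^sup>2" "a mod 4 = 0" by (auto simp: power_mult_distrib)
        then show ?thesis by simp
      next
        assume "a = 4 * b + 2 \<and> a mod 4 = 2"
        then have "a\<^sup>2 = 4 + 16 * (b\<^sup>2 + b)" "a mod 4 = 2" by (auto simp: power2_eq_square algebra_simps)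
        then show ?thesis by (simp only: mod_mult_self2) simp
      qed
    qed
    have "(\<Sum>i\<in>UNIV. (u i)\<^sup>2) mod 16 = (\<Sum>i\<in>UNIV. 4 * of_bool (u i mod 4 = 2)) mod 16"
      by (rule sum_mod_cong) (use 1 pw in \<open>auto simp: even_type_def\<close>)
    also have "\<dots> = (4 * int (card {i. u i mod 4 = 2})) mod 16"
      by (simp only: sum_distrib_left[symmetric] sum_of_bool_card)
    also have "\<dots> = 0"
      using golay_doubly_even[of "{i. u i mod 4 = 2}"] 1 by (auto simp: even_type_def)
    finally show ?thesis by presburger
  next
    case 2
    have pw: "a\<^sup>2 mod 16 = (2 * a + 3 - 4 * of_bool (a mod 4 = 1)) mod 16" if "odd a" for a :: int
    proof -
      have "a mod 4 = 1 \<or> a mod 4 = 3" using that by presburger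
      then obtain b where b: "(a = 4 * b + 1 \<and> a mod 4 = 1) \<or> (a = 4 * b + 3 \<and> a mod 4 = 3)"
        by (metis mult_div_mod_eq)
      then show ?thesis
      proof
        assume "a = 4 * b + 1 \<and> a mod 4 = 1"
        then have "a\<^sup>2 = (2 * a + 3 - 4) + 16 * b\<^sup>2" "a mod 4 = 1" by (auto simp: power2_eq_square algebra_simps)
        then show ?thesis by (simp only: mod_mult_self2) simp
      next
        assume "a = 4 * b + 3 \<and> a mod 4 = 3"
        then have "a\<^sup>2 = (2 * a + 3) + 16 * (b\<^sup>2 + b)" "a mod 4 = 3" by (auto simp: power2_eq_square algebra_simps)
        then show ?thesis by (simp only: mod_mult_self2) simp
      qed
    qed
    have "(\<Sum>i\<in>UNIV. (u i)\<^sup>2) mod 16 = (\<Sum>i\<in>UNIV. 2 * u i + 3 - 4 * of_bool (u i mod 4 = 1)) mod 16"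
      by (rule sum_mod_cong) (use 2 pw in \<open>auto simp: odd_type_def\<close>)
    also have "(\<Sum>i\<in>UNIV. 2 * u i + 3 - 4 * of_bool (u i mod 4 = 1)) =
        2 * (\<Sum>i\<in>UNIV. u i) + 72 - 4 * int (card {i. u i mod 4 = 1})"
      by (simp add: sum_subtractf sum.distrib sum_of_bool_card flip: sum_distrib_left)
    also have "\<dots> mod 16 = 0"
    proof -
      obtain k where "card {i. u i mod 4 = 1} = 4 * k"
        using golay_doubly_even[of "{i. u i mod 4 = 1}"] 2 by (auto simp: odd_type_def)
      moreover have "(\<Sum>i\<in>UNIV. u i) mod 8 = 4" using 2 by (simp add: odd_type_def)
      moreover have "(2 * a + 72 - 4 * (4 * b)) mod 16 = 0" if "a mod 8 = 4" for a b :: int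
        using that by presburger
      ultimately show ?thesis by (metis of_nat_mult of_nat_numeral)
    qed
    finally show ?thesis by presburger
  qed
qed

lemma leech_int_inner_dvd:
  assumes "u \<in> leech_int" "v \<in> leech_int"
  shows "8 dvd (\<Sum>i\<in>UNIV. u i * v i)"
proof -
  have "(\<Sum>i\<in>UNIV. (u i + v i)\<^sup>2) = (\<Sum>i\<in>UNIV. (u i)\<^sup>2) + (\<Sum>i\<in>UNIV. (v i)\<^sup>2) + 2 * (\<Sum>i\<in>UNIV. u i * v i)"
    by (simp add: power2_sum sum.distrib sum_distrib_left mult.assoc)
  then show ?thesis
    using leech_int_norm_dvd[OF leech_int_add[OF assms]] leech_int_norm_dvd[OF assms(1)]
      leech_int_norm_dvd[OF assms(2)] by presburger
qed

text \<open>The value is a positive multiple of 16, so only 16 has to be excluded. If all entries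
  are multiples of 4, the condition on the coordinate sum gives divisibility by 32; otherwise an
  even vector has at least 8 entries of absolute value 2 or more, and an odd vector has 24 nonzero
  entries.\<close>

lemma leech_int_min_norm:
  assumes "u \<in> leech_int" "u \<noteq> (\<lambda>i. 0)"
  shows "(\<Sum>i\<in>UNIV. (u i)\<^sup>2) \<ge> 32"
proof -
  let ?Q = "\<Sum>i\<in>UNIV. (u i)\<^sup>2"
  have dvd: "16 dvd ?Q" using leech_int_norm_dvd[OF assms(1)] .
  obtain j where "u j \<noteq> 0" using assms(2) by blast
  then have "0 < (u j)\<^sup>2" by simp
  then have pos: "?Q > 0" by (intro sum_pos2[of UNIV j]) simp_all
  consider "even_type u" | "odd_type u" using assms leech_int_iff by blast
  then show ?thesis
  proof cases
    case 1
    show ?thesis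
    proof (cases "{i. u i mod 4 = 2} = {}")
      case True
      have pw: "a\<^sup>2 mod 32 = (4 * a) mod 32" if "a mod 4 = 0" for a :: int
      proof -
        have "4 dvd a" using that by presburger
        then obtain b where b: "a = 4 * b" by blast
        have "even (b\<^sup>2 - b)" by simp
        then obtain c where "b\<^sup>2 - b = 2 * c" by blast
        then have "a\<^sup>2 = 4 * a + 32 * c" by (simp add: b power_mult_distrib)
        then show ?thesis by (simp only: mod_mult_self2)
      qed
      have "u i mod 4 = 0" for i
      proof -
        have "even (u i)" "u i mod 4 \<noteq> 2" using 1 True by (auto simp: even_type_def)
        then show ?thesis by presburger
      qed
      then have "?Q mod 32 = (\<Sum>i\<in>UNIV. 4 * u i) mod 32"
        by (intro sum_mod_cong pw)
      also have "\<dots> = (4 * (\<Sum>i\<in>UNIV. u i)) mod 32" by (simp add: sum_distrib_left)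
      also have "\<dots> = 0" using 1 by (auto simp: even_type_def)
      finally show ?thesis using pos by presburger
    next
      case False
      then have "card {i. u i mod 4 = 2} \<ge> 8"
        using golay_min_weight 1 by (auto simp: even_type_def)
      moreover have pw: "4 * of_bool (a mod 4 = 2) \<le> a\<^sup>2" for a :: int
      proof (cases "a mod 4 = 2")
        case True
        then have "a \<ge> 2 \<or> a \<le> -2" by presburger
        then have "\<bar>a\<bar> \<ge> 2" by linarith
        then have "\<bar>a\<bar> ^ 2 \<ge> 2 ^ 2" by (intro power_mono) auto
        then show ?thesis using True by simp
      qed simp
      have "(\<Sum>i\<in>UNIV. 4 * of_bool (u i mod 4 = 2)) \<le> ?Q"
        by (intro sum_mono pw)
      then have "4 * int (card {i. u i mod 4 = 2}) \<le> ?Q"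
        by (simp only: sum_distrib_left[symmetric] sum_of_bool_card)
      ultimately show ?thesis by linarith
    qed
  next
    case 2
    have "1 \<le> (u i)\<^sup>2" for i
    proof -
      have "odd (u i)" using 2 by (simp add: odd_type_def)
      then have "(u i)\<^sup>2 \<noteq> 0" by auto
      then show ?thesis by (smt (verit) zero_le_power2)
    qed
    then have "(\<Sum>i\<in>(UNIV :: 23 option set). 1) \<le> ?Q" by (intro sum_mono) simp
    then have "24 \<le> ?Q" by simp
    then show ?thesis using dvd by presburger
  qed
qed

section \<open>The three shapes of minimal vectors\<close>

definition leech_min :: "(23 option \<Rightarrow> int) set" where
  "leech_min = {u\<in>leech_int. (\<Sum>i\<in>UNIV. (u i)\<^sup>2) = 32}"

text \<open>Support \<open>P\<close> and negative entries \<open>E\<close>: with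
  \<open>c = 4\<close> on pairs and \<open>c = 2\<close> on octads these are the shapes (4,4,0,...)
  and (2,...,2,0,...) up to signs.\<close>

definition signed_vec :: "int \<Rightarrow> 'a set \<Rightarrow> 'a set \<Rightarrow> 'a \<Rightarrow> int" where
  "signed_vec c P E i = (if i \<in> E then - c else if i \<in> P then c else 0)"

lemma signed_vec_alt:
  "E \<subseteq> P \<Longrightarrow> signed_vec c P E i = c * of_bool (i \<in> P) - 2 * c * of_bool (i \<in> E)"
  by (auto simp: signed_vec_def)

lemma sum_signed_vec:
  fixes P :: "'a::finite set"
  assumes "E \<subseteq> P"
  shows "(\<Sum>i\<in>UNIV. signed_vec c P E i) = c * (int (card P) - 2 * int (card E))"
  using sum_of_bool_card[of "\<lambda>i. i \<in> P"] sum_of_bool_card[of "\<lambda>i. i \<in> E"]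
  by (simp add: signed_vec_alt[OF assms] sum_subtractf algebra_simps flip: sum_distrib_left)

lemma sum_signed_vec_squared:
  fixes P :: "'a::finite set"
  assumes "E \<subseteq> P"
  shows "(\<Sum>i\<in>UNIV. (signed_vec c P E i)\<^sup>2) = c\<^sup>2 * int (card P)"
proof -
  have "(signed_vec c P E i)\<^sup>2 = c\<^sup>2 * of_bool (i \<in> P)" for i
    using assms by (auto simp: signed_vec_def)
  then show ?thesis
    using sum_of_bool_card[of "\<lambda>i. i \<in> P"] by (simp flip: sum_distrib_left)
qed

lemma inj_signed_vec:
  assumes "c > 0"
  shows "inj_on (\<lambda>(P, E). signed_vec c P E) {(P, E). E \<subseteq> P}"
proof (rule inj_onI, clarify)
  fix P E P' E' :: "'a set"
  assume *: "E \<subseteq> P" "E' \<subseteq> P'" "signed_vec c P E = signed_vec c P' E'"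
  have "P = {i. signed_vec c P E i \<noteq> 0}" "E = {i. signed_vec c P E i < 0}"
    "P' = {i. signed_vec c P' E' i \<noteq> 0}" "E' = {i. signed_vec c P' E' i < 0}"
    using *(1,2) assms by (auto simp: signed_vec_def split: if_splits)
  then show "P = P' \<and> E = E'" using *(3) by metis
qed

definition pair_index :: "(23 option set \<times> 23 option set) set" where
  "pair_index = (SIGMA P:{P. card P = 2}. Pow P)"

definition octad_index :: "(23 option set \<times> 23 option set) set" where
  "octad_index = (SIGMA P:{P\<in>golay_code. card P = 8}. {E. E \<subseteq> P \<and> even (card E)})"

text \<open>The shape (3,1,...,1) up to signs. Since -3 is 1 modulo 4, the exceptional entry at
  \<open>p\<close> leaves the class of entries congruent to 1 equal to \<open>S\<close>.\<close>

definition odd_vec :: "'a set \<Rightarrow> 'a \<Rightarrow> 'a \<Rightarrow> int" where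
  "odd_vec S p i = (if i \<in> S then 1 else -1) * (if i = p then -3 else 1)"

lemma pair_vec_min:
  assumes "(P, E) \<in> pair_index"
  shows "signed_vec 4 P E \<in> leech_min"
proof -
  have PE: "E \<subseteq> P" "card P = 2" using assms by (auto simp: pair_index_def)
  have "even_type (signed_vec 4 P E)"
    unfolding even_type_def
  proof (intro conjI allI)
    have "signed_vec 4 P E i mod 4 \<noteq> 2" for i by (simp add: signed_vec_def)
    then show "{i. signed_vec 4 P E i mod 4 = 2} \<in> golay_code" using golay_empty by simp
    show "(\<Sum>i\<in>UNIV. signed_vec 4 P E i) mod 8 = 0"
      unfolding sum_signed_vec[OF PE(1)] PE(2) by presburger
  qed (simp add: signed_vec_def)
  then show ?thesis
    by (simp add: leech_min_def leech_int_iff sum_signed_vec_squared PE)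
qed

lemma octad_vec_min:
  assumes "(P, E) \<in> octad_index"
  shows "signed_vec 2 P E \<in> leech_min"
proof -
  have PE: "E \<subseteq> P" "P \<in> golay_code" "card P = 8" "even (card E)"
    using assms by (auto simp: octad_index_def)
  have "even_type (signed_vec 2 P E)"
    unfolding even_type_def
  proof (intro conjI allI)
    have "{i. signed_vec 2 P E i mod 4 = 2} = P" using PE(1) by (auto simp: signed_vec_def)
    then show "{i. signed_vec 2 P E i mod 4 = 2} \<in> golay_code" using PE by simp
    show "(\<Sum>i\<in>UNIV. signed_vec 2 P E i) mod 8 = 0"
      unfolding sum_signed_vec[OF PE(1)] PE(3) using PE(4) by (auto elim!: evenE)
  qed (simp add: signed_vec_def)
  then show ?thesis
    by (simp add: leech_min_def leech_int_iff sum_signed_vec_squared PE)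
qed

lemma odd_vec_min:
  assumes "S \<in> golay_code"
  shows "odd_vec S p \<in> leech_min"
proof -
  let ?s = "\<lambda>i. if i \<in> S then 1 else - 1 :: int"
  have alt: "odd_vec S p i = (2 * of_bool (i \<in> S) - 1) - (if i = p then 4 * ?s p else 0)" for i
    by (simp add: odd_vec_def)
  have sq: "(odd_vec S p i)\<^sup>2 = 1 + (if i = p then 8 else 0)" for i
    by (simp add: odd_vec_def)
  have "odd_type (odd_vec S p)"
    unfolding odd_type_def
  proof (intro conjI allI)
    have "{i. odd_vec S p i mod 4 = 1} = S" by (auto simp: odd_vec_def split: if_splits)
    then show "{i. odd_vec S p i mod 4 = 1} \<in> golay_code" using assms by simp
    obtain k where k: "card S = 4 * k" using golay_doubly_even[OF assms] by blast
    have "(\<Sum>i\<in>UNIV. odd_vec S p i) = 2 * int (card S) - 24 - 4 * ?s p"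
      unfolding alt using sum_of_bool_card[of "\<lambda>i. i \<in> S"]
      by (simp add: sum_subtractf flip: sum_distrib_left)
    also have "\<dots> mod 8 = 4" unfolding k by (cases "p \<in> S") (simp_all, presburger+)
    finally show "(\<Sum>i\<in>UNIV. odd_vec S p i) mod 8 = 4" .
  qed (simp add: odd_vec_def)
  then show ?thesis
    by (simp add: leech_min_def leech_int_iff sq sum.distrib)
qed

lemma inj_odd_vec: "inj_on (\<lambda>(S, p). odd_vec S p) UNIV"
proof (rule inj_onI, clarify)
  fix S S' :: "'a set" and p p'
  assume *: "odd_vec S p = odd_vec S' p'"
  have "S = {i. odd_vec S p i mod 4 = 1}" "{p} = {i. \<bar>odd_vec S p i\<bar> = 3}"
    "S' = {i. odd_vec S' p' i mod 4 = 1}" "{p'} = {i. \<bar>odd_vec S' p' i\<bar> = 3}"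
    by (auto simp: odd_vec_def split: if_splits)
  then show "S = S' \<and> p = p'" using * by (metis singleton_inject)
qed

lemma card_even_subsets:
  assumes "finite P" "P \<noteq> {}"
  shows "card {E. E \<subseteq> P \<and> even (card E)} \<ge> 2 ^ (card P - 1)"
proof -
  obtain a where a: "a \<in> P" using assms by blast
  define f where "f F = (if even (card F) then F else insert a F)" for F
  have "inj_on f (Pow (P - {a}))"
  proof (rule inj_onI)
    fix F F' assume F: "F \<in> Pow (P - {a})" "F' \<in> Pow (P - {a})" "f F = f F'"
    have "F = f F - {a}" "F' = f F' - {a}" using F(1,2) by (auto simp: f_def)
    then show "F = F'" using F(3) by simp
  qed
  moreover have "f ` Pow (P - {a}) \<subseteq> {E. E \<subseteq> P \<and> even (card E)}"
  proof (clarify, intro conjI)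
    fix F assume F: "F \<subseteq> P - {a}"
    then show "f F \<subseteq> P" using a by (auto simp: f_def)
    have "finite F" "a \<notin> F" using F assms finite_subset by blast+
    then show "even (card (f F))" by (simp add: f_def)
  qed
  ultimately have "card (Pow (P - {a})) \<le> card {E. E \<subseteq> P \<and> even (card E)}"
    using assms by (intro card_inj_on_le) auto
  then show ?thesis using assms a by (simp add: card_Pow)
qed

lemma finite_leech_min: "finite leech_min"
proof -
  have "u i \<in> {-5..5}" if "u \<in> leech_min" for u i
  proof (rule ccontr)
    assume "u i \<notin> {-5..5}"
    then have "6 \<le> \<bar>u i\<bar>" by auto
    then have "6 ^ 2 \<le> \<bar>u i\<bar> ^ 2" by (intro power_mono) auto
    moreover have "(u i)\<^sup>2 \<le> (\<Sum>i\<in>UNIV. (u i)\<^sup>2)" by (rule member_le_sum) auto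
    ultimately show False using that by (simp add: leech_min_def)
  qed
  then have "leech_min \<subseteq> PiE UNIV (\<lambda>_. {-5..5})" by (auto simp: PiE_UNIV_domain)
  then show ?thesis by (rule finite_subset) (simp add: finite_PiE)
qed

text \<open>276 * 4 = 1104 vectors from pairs, 759 * 128 = 97152 from octads and 4096 * 24 = 98304
  odd ones. Residues modulo 4 keep the three families disjoint.\<close>

lemma card_leech_min: "card leech_min \<ge> 196560"
proof -
  let ?A = "(\<lambda>(P, E). signed_vec 4 P E) ` pair_index"
  let ?B = "(\<lambda>(P, E). signed_vec 2 P E) ` octad_index"
  let ?C = "(\<lambda>(S, p). odd_vec S p) ` (golay_code \<times> UNIV)"
  have A: "card ?A = 1104"
  proof -
    have "card {P :: 23 option set. card P = 2} = 276"
      using n_subsets[of "UNIV :: 23 option set" 2] by (simp add: choose_two)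
    moreover have "card pair_index = (\<Sum>P\<in>{P :: 23 option set. card P = 2}. card (Pow P))"
      unfolding pair_index_def by (rule card_SigmaI) auto
    ultimately have "card pair_index = 1104"
      by (simp add: card_Pow)
    moreover have "inj_on (\<lambda>(P, E). signed_vec 4 P E) pair_index"
      by (rule inj_on_subset[OF inj_signed_vec]) (auto simp: pair_index_def)
    ultimately show ?thesis by (simp add: card_image)
  qed
  have B: "card ?B \<ge> 759 * 128"
  proof -
    have "759 * 128 \<le> card {P\<in>golay_code. card P = 8} * 128" using golay_octads by simp
    also have "\<dots> = (\<Sum>P\<in>{P\<in>golay_code. card P = 8}. 128)" by simp
    also have "\<dots> \<le> (\<Sum>P\<in>{P\<in>golay_code. card P = 8}. card {E. E \<subseteq> P \<and> even (card E)})"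
    proof (rule sum_mono)
      fix P assume "P \<in> {P\<in>golay_code. card P = 8}"
      then show "128 \<le> card {E. E \<subseteq> P \<and> even (card E)}"
        using card_even_subsets[of P] by force
    qed
    also have "\<dots> = card octad_index"
      unfolding octad_index_def by (rule card_SigmaI[symmetric]) auto
    also have "\<dots> = card ?B"
      by (rule card_image[symmetric], rule inj_on_subset[OF inj_signed_vec]) (auto simp: octad_index_def)
    finally show ?thesis .
  qed
  have C: "card ?C \<ge> 4096 * 24"
  proof -
    have "card ?C = card golay_code * 24"
      by (subst card_image) (auto intro: inj_on_subset[OF inj_odd_vec] simp: card_cartesian_product)
    then show ?thesis using card_golay_ge by simp
  qed
  have valA: "\<And>i. u i mod 4 = 0" if "u \<in> ?A" for u using that by (auto simp: signed_vec_def)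
  have valB: "(\<forall>i. even (u i)) \<and> (\<exists>i. u i mod 4 = 2)" if u: "u \<in> ?B" for u
  proof -
    obtain P E where PE: "(P, E) \<in> octad_index" "u = signed_vec 2 P E" using u by auto
    then have "P \<noteq> {}" by (auto simp: octad_index_def)
    then show ?thesis using PE by (auto simp: signed_vec_def)
  qed
  have valC: "\<And>i. odd (u i)" if "u \<in> ?C" for u
    using that by (auto simp: odd_vec_def split: if_splits)
  have AB: "?A \<inter> ?B = {}"
  proof (rule equals0I)
    fix u assume "u \<in> ?A \<inter> ?B"
    then show False using valA[of u] valB[of u] by (metis IntD1 IntD2 zero_neq_numeral)
  qed
  have ABC: "(?A \<union> ?B) \<inter> ?C = {}"
  proof (rule equals0I)
    fix u assume u: "u \<in> (?A \<union> ?B) \<inter> ?C"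
    have "even (u None)"
    proof (cases "u \<in> ?A")
      case True
      have "u None mod 4 = 0" by (rule valA[OF True])
      then show ?thesis by presburger
    qed (use u valB[of u] in blast)
    then show False using valC[of u None] u by blast
  qed
  have fin: "finite ?A" "finite ?B" "finite ?C" by (rule finite_imageI, rule finite_subset[of _ UNIV], auto)+
  have "card (?A \<union> ?B \<union> ?C) = card ?A + card ?B + card ?C"
    using card_Un_disjoint[OF _ fin(3) ABC] card_Un_disjoint[OF fin(1,2) AB] fin by simp
  moreover have "?A \<union> ?B \<union> ?C \<subseteq> leech_min"
    using pair_vec_min octad_vec_min odd_vec_min by auto
  then have "card (?A \<union> ?B \<union> ?C) \<le> card leech_min"
    by (rule card_mono[OF finite_leech_min])
  ultimately show ?thesis using A B C by linarith
qed

section \<open>Inner products of minimal vectors\<close>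

lemma inner_leech_vec: "leech_vec u \<bullet> leech_vec v = real_of_int (\<Sum>i\<in>UNIV. u i * v i) / 8"
  by (simp add: leech_vec_def inner_vec_def flip: sum_divide_distrib)

lemma leech_vec_add: "leech_vec (\<lambda>i. u i + v i) = leech_vec u + leech_vec v"
  by (simp add: leech_vec_def vec_eq_iff algebra_simps add_divide_distrib)

lemma leech_vec_uminus: "leech_vec (\<lambda>i. - u i) = - leech_vec u"
  by (simp add: leech_vec_def vec_eq_iff)

lemma leech_vec_inj: "leech_vec u = leech_vec v \<Longrightarrow> u = v"
  by (auto simp: leech_vec_def vec_eq_iff)

lemma norm_leech_vec: "(norm (leech_vec u))\<^sup>2 = real_of_int (\<Sum>i\<in>UNIV. (u i)\<^sup>2) / 8"
  unfolding power2_norm_eq_inner inner_leech_vec by (simp add: power2_eq_square)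

lemma norm_leech_min: "u \<in> leech_min \<Longrightarrow> norm (leech_vec u) = 2"
  using norm_leech_vec[of u] by (simp add: leech_min_def power2_eq_iff_nonneg[of _ 2, simplified])

lemma leech_min_nonempty: "leech_min \<noteq> {}"
  using card_leech_min by auto

lemma minimal_vectors_leech: "minimal_vectors leech_lattice = leech_vec ` leech_min"
proof -
  have zero: "leech_vec (\<lambda>i. 0) = 0" by (simp add: leech_vec_def vec_eq_iff)
  have ge: "2 \<le> norm (leech_vec u)" if "u \<in> leech_int" "leech_vec u \<noteq> 0" for u
  proof -
    have "u \<noteq> (\<lambda>i. 0)" using that(2) zero by auto
    then have "32 \<le> (\<Sum>i\<in>UNIV. (u i)\<^sup>2)" using leech_int_min_norm that(1) by blast
    then have "2\<^sup>2 \<le> (norm (leech_vec u))\<^sup>2" unfolding norm_leech_vec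
      using of_int_le_iff[where 'a = real, of 32 "\<Sum>i\<in>UNIV. (u i)\<^sup>2"] by (simp del: of_int_sum)
    then show ?thesis by (rule power2_le_imp_le) simp
  qed
  obtain u0 where u0: "u0 \<in> leech_min" using leech_min_nonempty by blast
  show ?thesis
  proof (intro equalityI subsetI)
    fix v assume v: "v \<in> minimal_vectors leech_lattice"
    then obtain u where u: "u \<in> leech_int" "v = leech_vec u" "v \<noteq> 0"
      by (auto simp: minimal_vectors_def leech_lattice_eq)
    have "norm v \<le> norm (leech_vec u0)"
      using v u0 norm_leech_min[OF u0] by (auto simp: minimal_vectors_def leech_lattice_eq leech_min_def)
    then have "norm (leech_vec u) = 2" using ge[of u] u norm_leech_min[OF u0] by simp
    then have "(\<Sum>i\<in>UNIV. (u i)\<^sup>2) = 32"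
      using norm_leech_vec[of u] of_int_eq_iff[where 'a = real, of "\<Sum>i\<in>UNIV. (u i)\<^sup>2" 32]
      by (simp del: of_int_sum)
    then show "v \<in> leech_vec ` leech_min" using u by (auto simp: leech_min_def)
  next
    fix v assume "v \<in> leech_vec ` leech_min"
    then obtain u where u: "u \<in> leech_min" "v = leech_vec u" by blast
    then have "v \<noteq> 0" "v \<in> leech_lattice" "norm v = 2"
      using norm_leech_min[OF u(1)] by (auto simp: leech_lattice_eq leech_min_def)
    then show "v \<in> minimal_vectors leech_lattice"
      using ge by (auto simp: minimal_vectors_def leech_lattice_eq)
  qed
qed

lemma leech_code_eq: "leech_code = (\<lambda>u. (1/2) *\<^sub>R leech_vec u) ` leech_min"
  unfolding leech_code_def minimal_vectors_leech image_image
  by (intro image_cong refl) (simp add: norm_leech_min)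

lemma finite_leech_code: "finite leech_code"
  by (simp add: leech_code_eq finite_leech_min)

lemma card_leech_code: "card leech_code \<ge> 196560"
proof -
  have "inj_on (\<lambda>u. (1/2) *\<^sub>R leech_vec u) leech_min"
    by (rule inj_onI) (simp add: leech_vec_inj)
  then show ?thesis using card_leech_min by (simp add: leech_code_eq card_image)
qed

lemma norm_leech_code: "x \<in> leech_code \<Longrightarrow> norm x = 1"
  by (auto simp: leech_code_eq norm_leech_min)

lemma uminus_leech_code: "x \<in> leech_code \<Longrightarrow> - x \<in> leech_code"
proof -
  assume "x \<in> leech_code"
  then obtain u where u: "u \<in> leech_min" "x = (1/2) *\<^sub>R leech_vec u" by (auto simp: leech_code_eq)
  then have "(\<lambda>i. - u i) \<in> leech_min" using leech_int_uminus by (auto simp: leech_min_def)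
  moreover have "- x = (1/2) *\<^sub>R leech_vec (\<lambda>i. - u i)" by (simp add: u leech_vec_uminus)
  ultimately show ?thesis by (auto simp: leech_code_eq)
qed

text \<open>\<open>64 - 16 * k\<close> is the scaled squared length of a difference, so it is 0 or
  at least 32. This excludes \<open>k = 3\<close>, that is, the inner product 3/4 after
  normalization.\<close>

lemma leech_min_diff:
  assumes "u \<in> leech_min" "v \<in> leech_min"
  obtains k where "(\<Sum>i\<in>UNIV. u i * v i) = 8 * k" "(\<lambda>i. u i - v i) \<in> leech_int"
    "(\<Sum>i\<in>UNIV. (u i - v i)\<^sup>2) = 64 - 16 * k" "k = 4 \<or> k \<le> 2"
proof -
  obtain k where k: "(\<Sum>i\<in>UNIV. u i * v i) = 8 * k"
    using leech_int_inner_dvd[of u v] assms by (auto simp: leech_min_def)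
  have "(\<Sum>i\<in>UNIV. (u i - v i)\<^sup>2) = (\<Sum>i\<in>UNIV. (u i)\<^sup>2) + (\<Sum>i\<in>UNIV. (v i)\<^sup>2) - 2 * (\<Sum>i\<in>UNIV. u i * v i)"
    by (simp add: power2_diff sum.distrib sum_subtractf sum_distrib_left mult.assoc)
  then have diff: "(\<Sum>i\<in>UNIV. (u i - v i)\<^sup>2) = 64 - 16 * k"
    using assms k by (simp add: leech_min_def)
  have mem: "(\<lambda>i. u i - v i) \<in> leech_int"
    using leech_int_add[OF _ leech_int_uminus, of u v] assms by (simp add: leech_min_def)
  have "k = 4 \<or> k \<le> 2"
  proof (cases "(\<lambda>i. u i - v i) = (\<lambda>i. 0)")
    case True
    then have "u i - v i = 0" for i by meson
    then show ?thesis using diff by simp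
  next
    case False
    then show ?thesis using leech_int_min_norm[OF mem] diff by linarith
  qed
  then show thesis using that k mem diff by blast
qed

text \<open>The dichotomy of \<open>leech_min_diff\<close>, applied to \<open>v\<close> and to
  \<open>- v\<close>, restricts \<open>k\<close> from both sides.\<close>

lemma inner_leech_code:
  assumes "x \<in> leech_code" "y \<in> leech_code"
  shows "x \<bullet> y \<in> {-1, -1/2, -1/4, 0, 1/4, 1/2, 1}"
proof -
  obtain u v where u: "u \<in> leech_min" "x = (1/2) *\<^sub>R leech_vec u" "v \<in> leech_min" "y = (1/2) *\<^sub>R leech_vec v"
    using assms by (auto simp: leech_code_eq)
  obtain k where k: "(\<Sum>i\<in>UNIV. u i * v i) = 8 * k" "k = 4 \<or> k \<le> 2"
    using leech_min_diff[OF u(1,3)] by blast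
  have "(\<lambda>i. - v i) \<in> leech_min" using u(3) leech_int_uminus by (auto simp: leech_min_def)
  then obtain l where l: "(\<Sum>i\<in>UNIV. u i * - v i) = 8 * l" "l = 4 \<or> l \<le> 2"
    using leech_min_diff[OF u(1)] by metis
  have "l = - k" using l(1) k(1) by (simp add: sum_negf)
  then have "k \<in> {-4, -2, -1, 0, 1, 2, 4}" using k(2) l(2) by auto
  moreover have "x \<bullet> y = real_of_int k / 4" by (simp add: u inner_leech_vec k(1))
  ultimately show ?thesis by auto
qed

text \<open>Neighbours of \<open>x\<close> come in pairs \<open>y\<close>, \<open>x - y\<close>,
  which project to antipodal points of the half code.\<close>

lemma leech_code_diff:
  assumes "x \<in> leech_code" "y \<in> leech_code" "x \<bullet> y = 1/2"
  shows "x - y \<in> leech_code"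
proof -
  obtain u v where u: "u \<in> leech_min" "x = (1/2) *\<^sub>R leech_vec u" "v \<in> leech_min" "y = (1/2) *\<^sub>R leech_vec v"
    using assms by (auto simp: leech_code_eq)
  obtain k where k: "(\<Sum>i\<in>UNIV. u i * v i) = 8 * k" "(\<lambda>i. u i - v i) \<in> leech_int"
    "(\<Sum>i\<in>UNIV. (u i - v i)\<^sup>2) = 64 - 16 * k"
    using leech_min_diff[OF u(1,3)] by blast
  have "x \<bullet> y = real_of_int k / 4" by (simp add: u inner_leech_vec k(1))
  then have "k = 2" using assms(3) by simp
  then have "(\<lambda>i. u i - v i) \<in> leech_min" using k by (simp add: leech_min_def)
  moreover have "x - y = (1/2) *\<^sub>R leech_vec (\<lambda>i. u i - v i)"
    using leech_vec_add[of "\<lambda>i. u i - v i" v] by (simp add: u algebra_simps)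
  ultimately show ?thesis by (auto simp: leech_code_eq)
qed

section \<open>Positive definite kernels on the sphere\<close>

definition kron :: "'a \<Rightarrow> 'a \<Rightarrow> real" where
  "kron i j = (if i = j then 1 else 0)"

lemma sum_kron:
  fixes f :: "'a::finite \<Rightarrow> real"
  shows "(\<Sum>j\<in>UNIV. kron i j * f j) = f i" "(\<Sum>j\<in>UNIV. kron j i * f j) = f i"
    "(\<Sum>j\<in>UNIV. f j * kron i j) = f i" "(\<Sum>j\<in>UNIV. f j * kron j i) = f i"
    "(\<Sum>j\<in>UNIV. kron i j) = 1"  "(\<Sum>j\<in>UNIV. kron j i) = 1"
  by (simp_all add: kron_def if_distrib if_distribR cong: if_cong)

lemma kron_refl: "kron i i = 1" by (simp add: kron_def)

text \<open>On unit vectors, the components of the traceless part of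
  \<open>x \<otimes> x\<close>.\<close>

definition harm2 :: "'n \<Rightarrow> 'n \<Rightarrow> real ^ 'n::finite \<Rightarrow> real" where
  "harm2 i j x = x $ i * x $ j - kron i j / CARD('n)"

text \<open>The components of the traceless part of the symmetric tensor \<open>x \<otimes> x \<otimes> x\<close>.\<close>

definition harm3 :: "'n \<Rightarrow> 'n \<Rightarrow> 'n \<Rightarrow> real ^ 'n::finite \<Rightarrow> real" where
  "harm3 i j k x = x $ i * x $ j * x $ k -
     (kron i j * x $ k + kron i k * x $ j + kron j k * x $ i) / (CARD('n) + 2)"

text \<open>The monic multiple of the third Gegenbauer polynomial in dimension
  \<open>CARD('n)\<close>.\<close>

definition gegen3 :: "'n::finite itself \<Rightarrow> real \<Rightarrow> real" where
  "gegen3 _ t = t ^ 3 - 3 / (CARD('n) + 2) * t"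

lemma harm2_kernel:
  fixes x y :: "real ^ 'n"
  assumes "norm x = 1" "norm y = 1"
  shows "(\<Sum>i\<in>UNIV. \<Sum>j\<in>UNIV. harm2 i j x * harm2 i j y) = (x \<bullet> y)\<^sup>2 - 1 / CARD('n)"
proof -
  have n: "(\<Sum>i\<in>UNIV. x $ i * x $ i) = 1" "(\<Sum>i\<in>UNIV. y $ i * y $ i) = 1"
    using assms by (simp_all add: norm_eq_1 inner_vec_def)
  let ?c = "1 / real CARD('n)"
  have "(\<Sum>i\<in>UNIV. \<Sum>j\<in>UNIV. harm2 i j x * harm2 i j y) =
     (\<Sum>i\<in>UNIV. \<Sum>j\<in>UNIV. (x $ i * y $ i) * (x $ j * y $ j) - kron i j * (?c * (x $ i * x $ j))
        - kron i j * (?c * (y $ i * y $ j)) + kron i j * ?c\<^sup>2)"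
    by (intro sum.cong refl) (simp add: harm2_def kron_def algebra_simps power2_eq_square)
  also have "\<dots> = (x \<bullet> y)\<^sup>2 - ?c - ?c + CARD('n) * ?c\<^sup>2"
    by (simp add: sum.distrib sum_subtractf sum_kron n inner_vec_def power2_eq_square sum_product
        flip: sum_divide_distrib)
  also have "\<dots> = (x \<bullet> y)\<^sup>2 - ?c"
    by (simp add: power2_eq_square)
  finally show ?thesis .
qed

text \<open>The addition formula in degree 3. With n the dimension and
  \<open>c = 1 / (n + 2)\<close>, each cross term contributes \<open>3 t\<close>; in the product of
  the two trace parts three of the nine Kronecker terms give \<open>n t\<close> and the other six
  give \<open>t\<close>, so the total is \<open>t^3 - 6 c t + c^2 * 3 (n + 2) t\<close>.\<close>

lemma harm3_kernel:
  fixes x y :: "real ^ 'n"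
  assumes "norm x = 1" "norm y = 1"
  shows "(\<Sum>i\<in>UNIV. \<Sum>j\<in>UNIV. \<Sum>k\<in>UNIV. harm3 i j k x * harm3 i j k y) = gegen3 TYPE('n) (x \<bullet> y)"
proof -
  define c where "c = 1 / (real CARD('n) + 2)"
  define t where "t = x \<bullet> y"
  define D where "D i j k z = kron i j * z $ k + kron i k * z $ j + kron j k * z $ i" for i j k and z :: "real ^ 'n"
  have n: "(\<Sum>i\<in>UNIV. x $ i * x $ i) = 1" "(\<Sum>i\<in>UNIV. y $ i * y $ i) = 1"
    using assms by (simp_all add: norm_eq_1 inner_vec_def)
  have t: "(\<Sum>i\<in>UNIV. x $ i * y $ i) = t" "(\<Sum>i\<in>UNIV. y $ i * x $ i) = t"
    by (simp_all add: t_def inner_vec_def mult.commute)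
  have XX: "(\<Sum>i\<in>UNIV. \<Sum>j\<in>UNIV. \<Sum>k\<in>UNIV. (x $ i * x $ j * x $ k) * (y $ i * y $ j * y $ k)) = t ^ 3"
  proof -
    have "(\<Sum>i\<in>UNIV. \<Sum>j\<in>UNIV. \<Sum>k\<in>UNIV. (x $ i * x $ j * x $ k) * (y $ i * y $ j * y $ k)) =
       (\<Sum>i\<in>UNIV. x $ i * y $ i * (\<Sum>j\<in>UNIV. x $ j * y $ j * (\<Sum>k\<in>UNIV. x $ k * y $ k)))"
      by (simp add: sum_distrib_left mult_ac)
    then show ?thesis by (simp add: t power3_eq_cube flip: sum_distrib_right)
  qed
  have XD: "(\<Sum>i\<in>UNIV. \<Sum>j\<in>UNIV. \<Sum>k\<in>UNIV. (a $ i * a $ j * a $ k) * D i j k b) = 3 * s"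
    if a: "(\<Sum>i\<in>UNIV. a $ i * a $ i) = 1" and s: "(\<Sum>i\<in>UNIV. a $ i * b $ i) = s" for a b :: "real ^ 'n" and s
  proof -
    have 1: "(\<Sum>i\<in>UNIV. \<Sum>j\<in>UNIV. \<Sum>k\<in>UNIV. kron i j * (a $ i * a $ j * (a $ k * b $ k))) = s"
    proof -
      have "(\<Sum>k\<in>UNIV. kron i j * (a $ i * a $ j * (a $ k * b $ k))) = kron i j * (a $ i * a $ j * s)" for i j
        by (simp add: s flip: sum_distrib_left)
      then show ?thesis by (simp add: sum_kron a flip: sum_distrib_right)
    qed
    have 2: "(\<Sum>i\<in>UNIV. \<Sum>j\<in>UNIV. \<Sum>k\<in>UNIV. kron i k * (a $ i * a $ k * (a $ j * b $ j))) = s"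
      by (simp add: sum_kron a flip: sum_distrib_left) (simp add: s a flip: sum_distrib_right)
    have 3: "(\<Sum>i\<in>UNIV. \<Sum>j\<in>UNIV. \<Sum>k\<in>UNIV. kron j k * (a $ j * a $ k * (a $ i * b $ i))) = s"
      by (simp add: sum_kron a s flip: sum_distrib_right)
    have "(\<Sum>i\<in>UNIV. \<Sum>j\<in>UNIV. \<Sum>k\<in>UNIV. (a $ i * a $ j * a $ k) * D i j k b) =
      (\<Sum>i\<in>UNIV. \<Sum>j\<in>UNIV. \<Sum>k\<in>UNIV. kron i j * (a $ i * a $ j * (a $ k * b $ k)) +
         kron i k * (a $ i * a $ k * (a $ j * b $ j)) + kron j k * (a $ j * a $ k * (a $ i * b $ i)))"
      by (intro sum.cong refl) (simp add: D_def algebra_simps)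
    then show ?thesis using 1 2 3 by (simp add: sum.distrib)
  qed
  have DD: "(\<Sum>i\<in>UNIV. \<Sum>j\<in>UNIV. \<Sum>k\<in>UNIV. D i j k x * D i j k y) = 3 * (CARD('n) + 2) * t"
  proof -
    have "(\<Sum>i\<in>UNIV. \<Sum>j\<in>UNIV. \<Sum>k\<in>UNIV. D i j k x * D i j k y) =
      (\<Sum>i\<in>UNIV. \<Sum>j\<in>UNIV. \<Sum>k\<in>UNIV. kron i j * (kron i j * (x $ k * y $ k))
        + kron i k * (kron i k * (x $ j * y $ j)) + kron j k * (kron j k * (x $ i * y $ i))
        + kron i j * (kron i k * (x $ k * y $ j)) + kron i j * (kron j k * (x $ k * y $ i))
        + kron i k * (kron i j * (x $ j * y $ k)) + kron i k * (kron j k * (x $ j * y $ i))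
        + kron j k * (kron i j * (x $ i * y $ k)) + kron j k * (kron i k * (x $ i * y $ j)))"
      by (intro sum.cong refl) (simp add: D_def algebra_simps)
    also have "\<dots> = 3 * (CARD('n) * t) + 6 * t"
      by (simp add: sum.distrib sum_kron kron_refl t flip: sum_distrib_left)
         (simp add: sum_kron t mult.assoc[symmetric])
    finally show ?thesis by (simp add: algebra_simps)
  qed
  have "(\<Sum>i\<in>UNIV. \<Sum>j\<in>UNIV. \<Sum>k\<in>UNIV. harm3 i j k x * harm3 i j k y) =
     (\<Sum>i\<in>UNIV. \<Sum>j\<in>UNIV. \<Sum>k\<in>UNIV. (x $ i * x $ j * x $ k) * (y $ i * y $ j * y $ k)
        - c * ((x $ i * x $ j * x $ k) * D i j k y) - c * ((y $ i * y $ j * y $ k) * D i j k x)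
        + c\<^sup>2 * (D i j k x * D i j k y))"
  proof -
    have hh: "harm3 i j k z = z $ i * z $ j * z $ k - c * D i j k z" for i j k and z :: "real ^ 'n"
      by (simp add: harm3_def D_def c_def)
    show ?thesis
      by (intro sum.cong refl) (simp only: hh, simp add: algebra_simps power2_eq_square)
  qed
  also have "\<dots> = t ^ 3 - c * (3 * t) - c * (3 * t) + c\<^sup>2 * (3 * (CARD('n) + 2) * t)"
    by (simp only: sum.distrib sum_subtractf XX DD XD[OF n(1) t(1)] XD[OF n(2) t(2)] sum_distrib_left[symmetric])
  also have "\<dots> = t ^ 3 - 3 * c * t"
  proof -
    have "c * (CARD('n) + 2) = 1" by (simp add: c_def)
    moreover have "c\<^sup>2 * (3 * (CARD('n) + 2) * t) = 3 * c * t * (c * (CARD('n) + 2))"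
      by (simp add: power2_eq_square)
    ultimately show ?thesis by simp
  qed
  finally show ?thesis by (simp add: gegen3_def t_def c_def)
qed

section \<open>Double sums over a code as sums of squares\<close>

lemma sum_gram:
  fixes F :: "'a::finite \<Rightarrow> 'b \<Rightarrow> real"
  shows "(\<Sum>x\<in>C. \<Sum>y\<in>C. \<Sum>a\<in>UNIV. F a x * F a y) = (\<Sum>a\<in>UNIV. (\<Sum>x\<in>C. F a x)\<^sup>2)"
proof -
  have "(\<Sum>x\<in>C. \<Sum>y\<in>C. \<Sum>a\<in>UNIV. F a x * F a y) = (\<Sum>x\<in>C. \<Sum>a\<in>UNIV. \<Sum>y\<in>C. F a x * F a y)"
    by (intro sum.cong refl sum.swap)
  also have "\<dots> = (\<Sum>a\<in>UNIV. \<Sum>x\<in>C. \<Sum>y\<in>C. F a x * F a y)"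
    by (rule sum.swap)
  finally show ?thesis by (simp add: power2_eq_square sum_product)
qed

lemma sum_inner_kernel:
  fixes C :: "(real ^ 'n) set"
  shows "(\<Sum>x\<in>C. \<Sum>y\<in>C. x \<bullet> y) = (\<Sum>i\<in>UNIV. (\<Sum>x\<in>C. x $ i)\<^sup>2)"
  by (simp add: inner_vec_def sum_gram)

lemma sum_harm2_kernel:
  fixes C :: "(real ^ 'n) set"
  assumes "C \<subseteq> sphere 0 1"
  shows "(\<Sum>x\<in>C. \<Sum>y\<in>C. (x \<bullet> y)\<^sup>2 - 1 / CARD('n)) = (\<Sum>(i, j)\<in>UNIV. (\<Sum>x\<in>C. harm2 i j x)\<^sup>2)"
proof -
  have "(\<Sum>x\<in>C. \<Sum>y\<in>C. (x \<bullet> y)\<^sup>2 - 1 / CARD('n)) =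
      (\<Sum>x\<in>C. \<Sum>y\<in>C. \<Sum>p\<in>UNIV. harm2 (fst p) (snd p) x * harm2 (fst p) (snd p) y)"
    using assms
    by (intro sum.cong refl, subst harm2_kernel[symmetric])
       (auto simp: sum.cartesian_product UNIV_Times_UNIV case_prod_unfold)
  then show ?thesis by (simp add: sum_gram case_prod_unfold)
qed

text \<open>The weight \<open>c\<close> is later a product of coordinates. Summing over these
  coordinates produces a factor \<open>x \<bullet> y\<close> for each, so the kernels
  \<open>t^j * gegen3\<close> are again Gram kernels.\<close>

lemma sum_weighted_harm3_kernel:
  fixes C :: "(real ^ 'n) set"
  assumes "C \<subseteq> sphere 0 1"
  shows "(\<Sum>x\<in>C. \<Sum>y\<in>C. c x * c y * gegen3 TYPE('n) (x \<bullet> y)) =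
     (\<Sum>(i, j, k)\<in>UNIV. (\<Sum>x\<in>C. c x * harm3 i j k x)\<^sup>2)"
proof -
  let ?F = "\<lambda>p x. c x * harm3 (fst p) (fst (snd p)) (snd (snd p)) x"
  have "(\<Sum>x\<in>C. \<Sum>y\<in>C. c x * c y * gegen3 TYPE('n) (x \<bullet> y)) = (\<Sum>x\<in>C. \<Sum>y\<in>C. \<Sum>p\<in>UNIV. ?F p x * ?F p y)"
  proof (intro sum.cong refl)
    fix x y assume "x \<in> C" "y \<in> C"
    then have *: "norm x = 1" "norm y = 1" using assms by auto
    have "(\<Sum>p\<in>UNIV. ?F p x * ?F p y) = c x * c y * (\<Sum>(i, j, k)\<in>UNIV. harm3 i j k x * harm3 i j k y)"
      unfolding sum_distrib_left by (intro sum.cong refl) (auto simp: mult_ac)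
    also have "\<dots> = c x * c y * (\<Sum>i\<in>UNIV. \<Sum>j\<in>UNIV. \<Sum>k\<in>UNIV. harm3 i j k x * harm3 i j k y)"
      by (simp add: sum.cartesian_product UNIV_Times_UNIV)
    finally show "c x * c y * gegen3 TYPE('n) (x \<bullet> y) = (\<Sum>p\<in>UNIV. ?F p x * ?F p y)"
      by (simp add: harm3_kernel[OF *])
  qed
  then show ?thesis by (simp add: sum_gram case_prod_unfold)
qed

lemma sum_inner_weighted:
  fixes C :: "(real ^ 'n) set"
  shows "(\<Sum>x\<in>C. \<Sum>y\<in>C. (x \<bullet> y) * K x y) = (\<Sum>i\<in>UNIV. \<Sum>x\<in>C. \<Sum>y\<in>C. x $ i * y $ i * K x y)"
proof -
  have "(\<Sum>x\<in>C. \<Sum>y\<in>C. (x \<bullet> y) * K x y) = (\<Sum>x\<in>C. \<Sum>i\<in>UNIV. \<Sum>y\<in>C. x $ i * y $ i * K x y)"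
    by (intro sum.cong refl, subst sum.swap) (simp add: inner_vec_def sum_distrib_right)
  also have "\<dots> = (\<Sum>i\<in>UNIV. \<Sum>x\<in>C. \<Sum>y\<in>C. x $ i * y $ i * K x y)"
    by (rule sum.swap)
  finally show ?thesis .
qed

lemma sum_harm3_kernel_0:
  fixes C :: "(real ^ 'n) set"
  assumes "C \<subseteq> sphere 0 1"
  shows "(\<Sum>x\<in>C. \<Sum>y\<in>C. gegen3 TYPE('n) (x \<bullet> y)) = (\<Sum>(i, j, k)\<in>UNIV. (\<Sum>x\<in>C. harm3 i j k x)\<^sup>2)"
  using sum_weighted_harm3_kernel[OF assms, of "\<lambda>_. 1"] by simp

lemma sum_harm3_kernel_1:
  fixes C :: "(real ^ 'n) set"
  assumes "C \<subseteq> sphere 0 1"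
  shows "(\<Sum>x\<in>C. \<Sum>y\<in>C. (x \<bullet> y) * gegen3 TYPE('n) (x \<bullet> y)) =
     (\<Sum>l\<in>UNIV. \<Sum>(i, j, k)\<in>UNIV. (\<Sum>x\<in>C. x $ l * harm3 i j k x)\<^sup>2)"
  unfolding sum_inner_weighted sum_weighted_harm3_kernel[OF assms] by (rule refl)

lemma sum_harm3_kernel_2:
  fixes C :: "(real ^ 'n) set"
  assumes "C \<subseteq> sphere 0 1"
  shows "(\<Sum>x\<in>C. \<Sum>y\<in>C. (x \<bullet> y)\<^sup>2 * gegen3 TYPE('n) (x \<bullet> y)) =
     (\<Sum>l\<in>UNIV. \<Sum>m\<in>UNIV. \<Sum>(i, j, k)\<in>UNIV. (\<Sum>x\<in>C. x $ l * x $ m * harm3 i j k x)\<^sup>2)"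
proof -
  have "(\<Sum>x\<in>C. \<Sum>y\<in>C. (x \<bullet> y)\<^sup>2 * gegen3 TYPE('n) (x \<bullet> y)) =
      (\<Sum>l\<in>UNIV. \<Sum>x\<in>C. \<Sum>y\<in>C. (x \<bullet> y) * (x $ l * y $ l * gegen3 TYPE('n) (x \<bullet> y)))"
    using sum_inner_weighted[where C = C and K = "\<lambda>x y. (x \<bullet> y) * gegen3 TYPE('n) (x \<bullet> y)"]
    by (simp add: power2_eq_square mult_ac)
  also have "\<dots> = (\<Sum>l\<in>UNIV. \<Sum>m\<in>UNIV. \<Sum>x\<in>C. \<Sum>y\<in>C. (x $ l * x $ m) * (y $ l * y $ m) * gegen3 TYPE('n) (x \<bullet> y))"
  proof (intro sum.cong refl)
    fix l
    show "(\<Sum>x\<in>C. \<Sum>y\<in>C. (x \<bullet> y) * (x $ l * y $ l * gegen3 TYPE('n) (x \<bullet> y))) =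
        (\<Sum>m\<in>UNIV. \<Sum>x\<in>C. \<Sum>y\<in>C. (x $ l * x $ m) * (y $ l * y $ m) * gegen3 TYPE('n) (x \<bullet> y))"
      using sum_inner_weighted[where C = C and K = "\<lambda>x y. x $ l * y $ l * gegen3 TYPE('n) (x \<bullet> y)"] by (simp add: mult_ac)
  qed
  finally show ?thesis unfolding sum_weighted_harm3_kernel[OF assms] .
qed

section \<open>Moment inequalities and tight frames\<close>

lemma second_moment_ge:
  fixes C :: "(real ^ 'n) set"
  assumes "C \<subseteq> sphere 0 1"
  shows "(real (card C))\<^sup>2 / CARD('n) \<le> (\<Sum>x\<in>C. \<Sum>y\<in>C. (x \<bullet> y)\<^sup>2)"
proof -
  have "0 \<le> (\<Sum>x\<in>C. \<Sum>y\<in>C. (x \<bullet> y)\<^sup>2 - 1 / CARD('n))"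
    unfolding sum_harm2_kernel[OF assms] by (intro sum_nonneg) auto
  then show ?thesis by (simp add: sum_subtractf power2_eq_square)
qed

text \<open>Equality in \<open>second_moment_ge\<close> makes all sums of \<open>harm2\<close>
  vanish, so the sum of \<open>x \<otimes> x\<close> is a multiple of the identity; the second claim
  is its quadratic form.\<close>

lemma tight_frame:
  fixes C :: "(real ^ 'n) set"
  assumes C: "C \<subseteq> sphere 0 1"
    and eq: "(\<Sum>x\<in>C. \<Sum>y\<in>C. (x \<bullet> y)\<^sup>2) = (real (card C))\<^sup>2 / CARD('n)"
  shows "(\<Sum>x\<in>C. x $ i * x $ j) = real (card C) / CARD('n) * kron i j"
    and "(\<Sum>x\<in>C. (x \<bullet> w)\<^sup>2) = real (card C) / CARD('n) * (norm w)\<^sup>2"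
proof -
  have "(\<Sum>(i, j)\<in>UNIV. (\<Sum>x\<in>C. harm2 i j x)\<^sup>2) = 0"
    unfolding sum_harm2_kernel[OF C, symmetric] using eq by (simp add: sum_subtractf power2_eq_square)
  then have "(\<Sum>x\<in>C. harm2 i j x) = 0" for i j
    by (subst (asm) sum_nonneg_eq_0_iff) auto
  then show coord: "(\<Sum>x\<in>C. x $ i * x $ j) = real (card C) / CARD('n) * kron i j" for i j
    by (simp add: harm2_def sum_subtractf)
  have "(\<Sum>x\<in>C. (x \<bullet> w)\<^sup>2) = (\<Sum>x\<in>C. \<Sum>i\<in>UNIV. \<Sum>j\<in>UNIV. w $ i * w $ j * (x $ i * x $ j))"
    by (simp add: power2_eq_square inner_vec_def sum_product mult_ac)
  also have "\<dots> = (\<Sum>i\<in>UNIV. \<Sum>j\<in>UNIV. w $ i * w $ j * (\<Sum>x\<in>C. x $ i * x $ j))"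
    by (subst sum.swap, intro sum.cong refl, subst sum.swap) (simp add: sum_distrib_left)
  also have "\<dots> = (\<Sum>i\<in>UNIV. w $ i * (real (card C) / CARD('n)) * (\<Sum>j\<in>UNIV. w $ j * kron i j))"
    by (simp add: coord sum_distrib_left mult_ac flip: sum_divide_distrib)
  also have "\<dots> = real (card C) / CARD('n) * (norm w)\<^sup>2"
    unfolding sum_kron power2_norm_eq_inner inner_vec_def by (simp add: sum_distrib_left mult_ac)
  finally show "(\<Sum>x\<in>C. (x \<bullet> w)\<^sup>2) = real (card C) / CARD('n) * (norm w)\<^sup>2" .
qed

lemma kernel_1_nonneg:
  fixes C :: "(real ^ 'n) set"
  assumes "C \<subseteq> sphere 0 1"
  shows "0 \<le> (\<Sum>x\<in>C. \<Sum>y\<in>C. (x \<bullet> y) * gegen3 TYPE('n) (x \<bullet> y))"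
  unfolding sum_harm3_kernel_1[OF assms] by (intro sum_nonneg) auto

text \<open>Up to the positive definite kernel \<open>t * gegen3\<close>, \<open>t^4\<close> is a
  multiple of \<open>t^2\<close>. The free parameter \<open>a\<close> allows a polynomial that
  vanishes at most of the inner products of the code at hand.\<close>

lemma fourth_moment_ge:
  fixes C :: "(real ^ 'n) set"
  assumes "C \<subseteq> sphere 0 1"
  shows "(3 / (CARD('n) + 2) - a) * (\<Sum>x\<in>C. \<Sum>y\<in>C. (x \<bullet> y)\<^sup>2)
     \<le> (\<Sum>x\<in>C. \<Sum>y\<in>C. (x \<bullet> y) ^ 4 - a * (x \<bullet> y)\<^sup>2)"
proof -
  have "t ^ 4 - a * t\<^sup>2 = t * gegen3 TYPE('n) t + (3 / (CARD('n) + 2) - a) * t\<^sup>2" for t :: real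
    by (simp add: gegen3_def algebra_simps power2_eq_square power3_eq_cube power4_eq_xxxx)
  then show ?thesis
    using kernel_1_nonneg[OF assms] by (simp only: sum.distrib sum_distrib_left[symmetric])
qed

lemma inner_unit_eq_1: "norm x = 1 \<Longrightarrow> norm y = 1 \<Longrightarrow> x \<bullet> y = 1 \<longleftrightarrow> x = y"
  for x y :: "'a::real_inner"
proof
  assume "norm x = 1" "norm y = 1" "x \<bullet> y = 1"
  then have "(x - y) \<bullet> (x - y) = 0"
    by (simp add: inner_diff_left inner_diff_right inner_commute norm_eq_1)
  then show "x = y" by simp
qed (simp add: norm_eq_1)

lemma inner_unit_eq_minus_1: "norm x = 1 \<Longrightarrow> norm y = 1 \<Longrightarrow> x \<bullet> y = -1 \<longleftrightarrow> y = - x"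
  for x y :: "'a::real_inner"
  using inner_unit_eq_1[of "- x" y] by (auto simp: minus_equation_iff)

lemma card_inner_1:
  fixes C :: "'a::real_inner set"
  assumes "C \<subseteq> sphere 0 1" "x \<in> C"
  shows "card {y\<in>C. x \<bullet> y = 1} = 1"
proof -
  have "{y\<in>C. x \<bullet> y = 1} = {x}"
    using assms inner_unit_eq_1[of x] by (auto simp: subset_iff)
  then show ?thesis by simp
qed

lemma card_inner_minus_1:
  fixes C :: "'a::real_inner set"
  assumes "C \<subseteq> sphere 0 1" "x \<in> C"
  shows "card {y\<in>C. x \<bullet> y = -1} = (if - x \<in> C then 1 else 0)"
proof -
  have "{y\<in>C. x \<bullet> y = -1} = (if - x \<in> C then {- x} else {})"
    using assms inner_unit_eq_minus_1[of x] by (auto simp: subset_iff norm_eq_1)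
  then show ?thesis by simp
qed

lemma sum_by_inner:
  fixes x :: "'a::real_inner" and f :: "real \<Rightarrow> 'b::comm_semiring_1"
  assumes "finite C" "finite A" "\<And>y. y \<in> C \<Longrightarrow> x \<bullet> y \<in> A"
  shows "(\<Sum>y\<in>C. f (x \<bullet> y)) = (\<Sum>t\<in>A. of_nat (card {y\<in>C. x \<bullet> y = t}) * f t)"
proof -
  have "(\<Sum>y\<in>C. f (x \<bullet> y)) = (\<Sum>t\<in>A. \<Sum>y\<in>{y\<in>C. x \<bullet> y = t}. f (x \<bullet> y))"
    using assms by (intro sum.group[symmetric]) auto
  then show ?thesis by simp
qed

text \<open>Linear programming with \<open>t\<^sup>4 - t\<^sup>2/9\<close>, which vanishes at \<open>\<plusminus>1/3\<close> and \<open>0\<close>.\<close>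

lemma three_distance_bound:
  fixes C :: "(real ^ 'n) set"
  assumes C: "C \<subseteq> sphere 0 1" "finite C"
    and ip: "\<And>x y. x \<in> C \<Longrightarrow> y \<in> C \<Longrightarrow> x \<bullet> y \<in> {-1, -1/3, 0, 1/3, 1}"
  shows "(3 / (CARD('n) + 2) - 1/9) * (\<Sum>x\<in>C. \<Sum>y\<in>C. (x \<bullet> y)\<^sup>2) \<le> 16/9 * card C"
proof -
  have "(\<Sum>y\<in>C. (x \<bullet> y) ^ 4 - 1/9 * (x \<bullet> y)\<^sup>2) \<le> 16/9" if x: "x \<in> C" for x
  proof -
    have "(\<Sum>y\<in>C. (x \<bullet> y) ^ 4 - 1/9 * (x \<bullet> y)\<^sup>2) =
        (\<Sum>t\<in>{-1, -1/3, 0, 1/3, 1}. of_nat (card {y\<in>C. x \<bullet> y = t}) * (t ^ 4 - 1/9 * t\<^sup>2))"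
      using C ip x by (intro sum_by_inner[of _ _ _ "\<lambda>t. t ^ 4 - 1/9 * t\<^sup>2"]) auto
    also have "\<dots> = 8/9 * (real (card {y\<in>C. x \<bullet> y = -1}) + real (card {y\<in>C. x \<bullet> y = 1}))"
      by (simp add: power4_eq_xxxx power2_eq_square)
    also have "\<dots> \<le> 16/9"
      by (simp add: card_inner_1[OF C(1) x] card_inner_minus_1[OF C(1) x])
    finally show ?thesis .
  qed
  then have "(\<Sum>x\<in>C. \<Sum>y\<in>C. (x \<bullet> y) ^ 4 - 1/9 * (x \<bullet> y)\<^sup>2) \<le> (\<Sum>x\<in>C. 16/9)"
    by (rule sum_mono)
  then show ?thesis using fourth_moment_ge[OF C(1), of "1/9"] by simp
qed

text \<open>Here 3/25 - 1/9 = 2/225, and 16/9 * 225/2 * 23 = 4600. At 4600 points both estimates of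
  \<open>?M\<close> coincide, whence a tight frame with constant 4600/23 = 200.\<close>

lemma three_distance_23:
  fixes C :: "(real ^ 23) set"
  assumes C: "C \<subseteq> sphere 0 1" "finite C"
    and ip: "\<And>x y. x \<in> C \<Longrightarrow> y \<in> C \<Longrightarrow> x \<bullet> y \<in> {-1, -1/3, 0, 1/3, 1}"
  shows "card C \<le> 4600" and "card C = 4600 \<Longrightarrow> (\<Sum>x\<in>C. (x \<bullet> w)\<^sup>2) = 200 * (norm w)\<^sup>2"
proof -
  let ?M = "\<Sum>x\<in>C. \<Sum>y\<in>C. (x \<bullet> y)\<^sup>2"
  have up: "2/225 * ?M \<le> 16/9 * card C" using three_distance_bound[OF C ip] by simp
  have lo: "(real (card C))\<^sup>2 / 23 \<le> ?M" using second_moment_ge[OF C(1)] by simp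
  have "(real (card C))\<^sup>2 \<le> 4600 * real (card C)" using up lo by linarith
  then have "real (card C) \<le> 4600" by (cases "card C = 0") (simp_all add: power2_eq_square)
  then show "card C \<le> 4600" by simp
  assume K: "card C = 4600"
  then have "?M = (real (card C))\<^sup>2 / 23" using up lo by (simp add: power2_eq_square)
  then show "(\<Sum>x\<in>C. (x \<bullet> w)\<^sup>2) = 200 * (norm w)\<^sup>2"
    using tight_frame(2)[OF C(1)] K by simp
qed

text \<open>Here 3/24 - 1/9 = 1/72, and 16/9 * 72 * 22 = 2816; the frame constant is 2816/22 =
  128.\<close>

lemma three_distance_22:
  fixes C :: "(real ^ 22) set"
  assumes C: "C \<subseteq> sphere 0 1" "finite C"
    and ip: "\<And>x y. x \<in> C \<Longrightarrow> y \<in> C \<Longrightarrow> x \<bullet> y \<in> {-1, -1/3, 0, 1/3, 1}"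
    and K: "card C = 2816"
  shows "(\<Sum>x\<in>C. (x \<bullet> w)\<^sup>2) = 128 * (norm w)\<^sup>2"
proof -
  let ?M = "\<Sum>x\<in>C. \<Sum>y\<in>C. (x \<bullet> y)\<^sup>2"
  have up: "1/72 * ?M \<le> 16/9 * card C" using three_distance_bound[OF C ip] by simp
  have lo: "(real (card C))\<^sup>2 / 22 \<le> ?M" using second_moment_ge[OF C(1)] by simp
  have "?M = (real (card C))\<^sup>2 / 22" using up lo K by (simp add: power2_eq_square)
  then show ?thesis using tight_frame(2)[OF C(1)] K by simp
qed

section \<open>The 2816-point code\<close>

lemma isometry_inner:
  fixes f :: "'a::real_inner \<Rightarrow> 'b::real_inner"
  assumes "linear f" "subspace S" "\<And>v. v \<in> S \<Longrightarrow> norm (f v) = norm v" "x \<in> S" "y \<in> S"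
  shows "f x \<bullet> f y = x \<bullet> y"
proof -
  have "norm (f (x + y)) = norm (x + y)" using assms by (simp add: subspace_add)
  then have "(norm (f x + f y))\<^sup>2 = (norm (x + y))\<^sup>2" using assms by (simp add: linear_add)
  then show ?thesis
    using assms by (simp add: power2_norm_eq_inner inner_add_left inner_add_right inner_commute norm_eq_square)
qed

lemma subspace_orthogonal_complement: "subspace {v :: 'a::real_inner. \<forall>x\<in>A. v \<bullet> x = 0}"
  by (auto simp: subspace_def inner_add_left)

lemma isometry_inj_on:
  fixes f :: "'a::real_inner \<Rightarrow> 'b::real_inner"
  assumes "linear f" "subspace S" "\<And>v. v \<in> S \<Longrightarrow> norm (f v) = norm v" "H \<subseteq> S"
  shows "inj_on f H"
proof (rule inj_onI)
  fix x y assume "x \<in> H" "y \<in> H" "f x = f y"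
  then have "norm (f (x - y)) = 0" "x - y \<in> S"
    using assms by (auto simp: linear_diff subset_iff subspace_diff)
  then show "x = y" using assms(3)[of "x - y"] by simp
qed

lemma isometry_orthogonal_complement:
  fixes A :: "'a::euclidean_space set"
  assumes "dim A + DIM('b) = DIM('a)"
  obtains f :: "'a \<Rightarrow> 'b::euclidean_space" where "linear f"
    "\<And>v. (\<forall>x\<in>A. v \<bullet> x = 0) \<Longrightarrow> norm (f v) = norm v"
proof -
  have eq: "{y \<in> UNIV. \<forall>x \<in> span A. orthogonal x y} = {v. \<forall>x\<in>A. v \<bullet> x = 0}"
  proof (rule set_eqI, rule iffI)
    fix v assume "v \<in> {y \<in> UNIV. \<forall>x \<in> span A. orthogonal x y}"
    then show "v \<in> {v. \<forall>x\<in>A. v \<bullet> x = 0}"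
      by (auto simp: orthogonal_def inner_commute dest: span_base)
  next
    fix v assume "v \<in> {v. \<forall>x\<in>A. v \<bullet> x = 0}"
    then have "orthogonal v y" if "y \<in> A" for y using that by (simp add: orthogonal_def)
    then have "\<forall>x \<in> span A. orthogonal v x"
      using orthogonal_to_span[of _ A v] by blast
    then show "v \<in> {y \<in> UNIV. \<forall>x \<in> span A. orthogonal x y}"
      unfolding orthogonal_commute[of v] by blast
  qed
  have "dim {v. \<forall>x\<in>A. v \<bullet> x = 0} + dim (span A) = dim (UNIV :: 'a set)"
    using dim_subspace_orthogonal_to_vectors[of "span A" UNIV] unfolding eq by simp
  then have dim: "dim {v. \<forall>x\<in>A. v \<bullet> x = 0} = dim (UNIV :: 'b set)"
    using assms by (simp add: dim_span)
  show thesis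
    by (rule isometry_subspaces[OF subspace_orthogonal_complement subspace_UNIV dim]) (rule that, simp_all)
qed

section \<open>Neighbours of a minimal vector\<close>

definition leech_nbrs :: "real ^ 23 option \<Rightarrow> (real ^ 23 option) set" where
  "leech_nbrs x = {y\<in>leech_code. x \<bullet> y = 1/2}"

definition half_proj :: "real ^ 23 option \<Rightarrow> real ^ 23 option \<Rightarrow> real ^ 23 option" where
  "half_proj x y = (y - (1/2) *\<^sub>R x) /\<^sub>R sqrt (3/4)"

lemma half_code_eq: "half_code x = half_proj x ` leech_nbrs x"
  by (auto simp: half_code_def half_proj_def leech_nbrs_def)

lemma finite_half_code: "finite (half_code x)"
  by (simp add: half_code_eq leech_nbrs_def finite_leech_code)

lemma card_half_code: "card (half_code x) = card (leech_nbrs x)"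
  unfolding half_code_eq by (rule card_image) (auto simp: inj_on_def half_proj_def)

lemma half_proj_inner:
  assumes "x \<in> leech_code" "y \<in> leech_nbrs x" "z \<in> leech_nbrs x"
  shows "half_proj x y \<bullet> half_proj x z = (4 * (y \<bullet> z) - 1) / 3"
proof -
  have ip: "x \<bullet> x = 1" "x \<bullet> y = 1/2" "y \<bullet> x = 1/2" "x \<bullet> z = 1/2" "z \<bullet> x = 1/2"
    using assms norm_leech_code by (auto simp: leech_nbrs_def norm_eq_1 inner_commute)
  have "(y - (1/2) *\<^sub>R x) \<bullet> (z - (1/2) *\<^sub>R x) = y \<bullet> z - 1/4"
    by (simp add: inner_diff_left inner_diff_right ip)
  moreover have "inverse (sqrt (3/4)) * inverse (sqrt (3/4)) = (4/3 :: real)"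
    by (simp add: inverse_eq_divide real_sqrt_divide)
  moreover have "half_proj x y \<bullet> half_proj x z =
      inverse (sqrt (3/4)) * inverse (sqrt (3/4)) * ((y - (1/2) *\<^sub>R x) \<bullet> (z - (1/2) *\<^sub>R x))"
    unfolding half_proj_def by (simp only: inner_scaleR_left inner_scaleR_right mult.assoc)
  ultimately have "half_proj x y \<bullet> half_proj x z = 4/3 * (y \<bullet> z - 1/4)"
    by (simp only:)
  then show ?thesis by simp
qed

lemma half_code_orthogonal:
  assumes "x \<in> leech_code" "v \<in> half_code x"
  shows "v \<bullet> x = 0"
proof -
  obtain y where "v = half_proj x y" "y \<bullet> x = 1/2"
    using assms by (auto simp: half_code_eq leech_nbrs_def inner_commute)
  then show ?thesis
    using norm_leech_code[OF assms(1)]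
    by (simp add: half_proj_def norm_eq_1 inner_diff_left)
qed

lemma half_code_sphere:
  assumes "x \<in> leech_code"
  shows "half_code x \<subseteq> sphere 0 1"
proof
  fix v assume "v \<in> half_code x"
  then obtain y where y: "y \<in> leech_nbrs x" "v = half_proj x y" by (auto simp: half_code_eq)
  then have "y \<bullet> y = 1" using norm_leech_code[of y] by (simp add: leech_nbrs_def norm_eq_1)
  then have "v \<bullet> v = 1" using half_proj_inner[OF assms y(1) y(1)] y by simp
  then show "v \<in> sphere 0 1" by (simp add: norm_eq_1)
qed

lemma half_code_uminus:
  assumes "x \<in> leech_code" "v \<in> half_code x"
  shows "- v \<in> half_code x"
proof -
  obtain y where y: "y \<in> leech_nbrs x" "v = half_proj x y" using assms by (auto simp: half_code_eq)
  then have "x - y \<in> leech_nbrs x"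
    using leech_code_diff[of x y] assms(1) norm_leech_code[OF assms(1)]
    by (auto simp: leech_nbrs_def inner_diff_right norm_eq_1)
  moreover have "- v = half_proj x (x - y)"
  proof -
    have "x - y - (1/2) *\<^sub>R x = - (y - (1/2) *\<^sub>R x)" by (simp add: algebra_simps flip: scaleR_add_left)
    then show ?thesis unfolding y half_proj_def by (metis scaleR_minus_right)
  qed
  ultimately show ?thesis by (auto simp: half_code_eq)
qed

text \<open>The map \<open>(4 t - 1) / 3\<close> sends -1/2, 0, 1/4, 1/2, 1 to the five listed
  values. The value -1/4 is impossible since \<open>x - y\<close> would have inner product 3/4 with
  \<open>z\<close>, and -1 is impossible by Cauchy-Schwarz for the projections.\<close>

lemma half_code_inner:
  assumes "x \<in> leech_code" "v \<in> half_code x" "w \<in> half_code x"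
  shows "v \<bullet> w \<in> {-1, -1/3, 0, 1/3, 1}"
proof -
  obtain y z where yz: "y \<in> leech_nbrs x" "v = half_proj x y" "z \<in> leech_nbrs x" "w = half_proj x z"
    using assms by (auto simp: half_code_eq)
  have ip: "v \<bullet> w = (4 * (y \<bullet> z) - 1) / 3" using half_proj_inner[OF assms(1) yz(1,3)] yz by simp
  have L: "y \<in> leech_code" "z \<in> leech_code" "x \<bullet> y = 1/2" "x \<bullet> z = 1/2"
    using yz by (auto simp: leech_nbrs_def)
  have "y \<bullet> z \<in> {-1, -1/2, -1/4, 0, 1/4, 1/2, 1}" using inner_leech_code L by blast
  moreover have "y \<bullet> z \<noteq> -1/4"
  proof
    assume "y \<bullet> z = -1/4"
    then have "(x - y) \<bullet> z = 3/4" using L by (simp add: inner_diff_left)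
    then show False using inner_leech_code[OF leech_code_diff[OF assms(1) L(1,3)] L(2)] by auto
  qed
  moreover have "y \<bullet> z \<noteq> -1"
  proof
    assume "y \<bullet> z = -1"
    then have "v \<bullet> w = -5/3" using ip by simp
    moreover have "\<bar>v \<bullet> w\<bar> \<le> norm v * norm w" by (rule Cauchy_Schwarz_ineq2)
    moreover have "norm v = 1" "norm w = 1" using half_code_sphere[OF assms(1)] assms by auto
    ultimately show False by simp
  qed
  ultimately show ?thesis using ip by auto
qed

text \<open>The bounds depend on the dimension of the ambient type, so the code is moved from the
  orthogonal complement of \<open>x\<close> into \<open>real ^ 23\<close>.\<close>

lemma half_code_image:
  assumes x: "x \<in> leech_code"
  obtains f :: "real ^ 23 option \<Rightarrow> real ^ 23" where
    "inj_on f (half_code x)" "f ` half_code x \<subseteq> sphere 0 1"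
    "\<And>v w. v \<in> half_code x \<Longrightarrow> w \<in> half_code x \<Longrightarrow> f v \<bullet> f w = v \<bullet> w"
    "\<And>p q. p \<in> f ` half_code x \<Longrightarrow> q \<in> f ` half_code x \<Longrightarrow> p \<bullet> q \<in> {-1, -1/3, 0, 1/3, 1}"
proof -
  have "x \<noteq> 0" using norm_leech_code[OF x] by auto
  then have "dim {x} = 1" by (simp add: dim_insert dim_singleton)
  then obtain f :: "real ^ 23 option \<Rightarrow> real ^ 23" where f: "linear f"
      "\<And>v. (\<forall>y\<in>{x}. v \<bullet> y = 0) \<Longrightarrow> norm (f v) = norm v"
    using isometry_orthogonal_complement[of "{x}", where 'b = "real ^ 23"] by auto
  let ?S = "{v. \<forall>y\<in>{x}. v \<bullet> y = 0}"
  have S: "subspace ?S" by (rule subspace_orthogonal_complement)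
  have H: "half_code x \<subseteq> ?S" using half_code_orthogonal[OF x] by auto
  show thesis
  proof
    show "inj_on f (half_code x)" by (rule isometry_inj_on[OF f(1) S _ H]) (use f(2) in simp)
    show ip: "f v \<bullet> f w = v \<bullet> w" if "v \<in> half_code x" "w \<in> half_code x" for v w
      using isometry_inner[OF f(1) S, of v w] f(2) H that by auto
    show "f ` half_code x \<subseteq> sphere 0 1"
      using half_code_sphere[OF x] ip by (auto simp: norm_eq_1)
    fix p q assume "p \<in> f ` half_code x" "q \<in> f ` half_code x"
    then obtain v w where "v \<in> half_code x" "w \<in> half_code x" "p = f v" "q = f w" by blast
    then show "p \<bullet> q \<in> {-1, -1/3, 0, 1/3, 1}" using half_code_inner[OF x, of v w] ip[of v w] by (simp only:)
  qed
qed

lemma card_leech_nbrs_le: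
  assumes x: "x \<in> leech_code"
  shows "card (leech_nbrs x) \<le> 4600"
proof -
  obtain f :: "real ^ 23 option \<Rightarrow> real ^ 23" where f: "inj_on f (half_code x)" "f ` half_code x \<subseteq> sphere 0 1"
    "\<And>v w. v \<in> half_code x \<Longrightarrow> w \<in> half_code x \<Longrightarrow> f v \<bullet> f w = v \<bullet> w"
    "\<And>p q. p \<in> f ` half_code x \<Longrightarrow> q \<in> f ` half_code x \<Longrightarrow> p \<bullet> q \<in> {-1, -1/3, 0, 1/3, 1}"
    using half_code_image[OF x] by blast
  have "card (f ` half_code x) \<le> 4600"
    by (rule three_distance_23(1)[OF f(2) _ f(4)]) (simp_all add: finite_half_code)
  then show ?thesis by (simp add: card_image f card_half_code)
qed

lemma card_leech_antipodal:
  "card {y\<in>leech_code. x \<bullet> y = - t} = card {y\<in>leech_code. x \<bullet> y = t}"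
  by (rule bij_betw_same_card[of uminus], rule bij_betw_byWitness[where f' = uminus])
     (auto simp: uminus_leech_code)

text \<open>\<open>t^4 - t^2/16\<close> vanishes at 0 and \<plusminus>1/4, so a row sum sees only
  \<plusminus>\<open>x\<close> (15/16 each) and the points at \<plusminus>1/2 (3/64 each). With 3/26
  - 1/16 = 11/208, the bound for 196560 points is tight at 4600: 11/208 * 196560/24 = 15/8 + 3/32 *
  4600.\<close>

lemma sum_card_leech_nbrs: "4600 * card leech_code \<le> (\<Sum>x\<in>leech_code. card (leech_nbrs x))"
proof -
  let ?N = "real (card leech_code)"
  let ?M = "\<Sum>x\<in>leech_code. \<Sum>y\<in>leech_code. (x \<bullet> y)\<^sup>2"
  have S: "leech_code \<subseteq> sphere 0 1" using norm_leech_code by auto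
  have "(\<Sum>y\<in>leech_code. (x \<bullet> y) ^ 4 - 1/16 * (x \<bullet> y)\<^sup>2) = 15/8 + 3/32 * card (leech_nbrs x)"
    if x: "x \<in> leech_code" for x
  proof -
    have "(\<Sum>y\<in>leech_code. (x \<bullet> y) ^ 4 - 1/16 * (x \<bullet> y)\<^sup>2) =
       (\<Sum>t\<in>{-1, -1/2, -1/4, 0, 1/4, 1/2, 1}. of_nat (card {y\<in>leech_code. x \<bullet> y = t}) * (t ^ 4 - 1/16 * t\<^sup>2))"
      using inner_leech_code[OF x]
      by (intro sum_by_inner[of _ _ _ "\<lambda>t. t ^ 4 - 1/16 * t\<^sup>2"] finite_leech_code) auto
    moreover have "card {y\<in>leech_code. x \<bullet> y = -1} = 1"
      using card_leech_antipodal[of x 1] card_inner_1[OF S x] by simp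
    moreover have "card {y\<in>leech_code. x \<bullet> y = -1/2} = card (leech_nbrs x)"
      using card_leech_antipodal[of x "1/2"] by (simp add: leech_nbrs_def)
    ultimately show ?thesis
      by (simp add: card_inner_1[OF S x] leech_nbrs_def power4_eq_xxxx power2_eq_square)
  qed
  then have "(\<Sum>x\<in>leech_code. \<Sum>y\<in>leech_code. (x \<bullet> y) ^ 4 - 1/16 * (x \<bullet> y)\<^sup>2) =
      15/8 * ?N + 3/32 * (\<Sum>x\<in>leech_code. real (card (leech_nbrs x)))"
    by (simp add: sum.distrib sum_distrib_left)
  moreover have "11/208 * ?M \<le> (\<Sum>x\<in>leech_code. \<Sum>y\<in>leech_code. (x \<bullet> y) ^ 4 - 1/16 * (x \<bullet> y)\<^sup>2)"
    using fourth_moment_ge[OF S, of "1/16"] by simp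
  moreover have "?N\<^sup>2 / 24 \<le> ?M" using second_moment_ge[OF S] by simp
  moreover have "196560 * ?N \<le> ?N\<^sup>2" using card_leech_code by (simp add: power2_eq_square mult_right_mono)
  ultimately have "4600 * ?N \<le> (\<Sum>x\<in>leech_code. real (card (leech_nbrs x)))" by linarith
  then have "real (4600 * card leech_code) \<le> real (\<Sum>x\<in>leech_code. card (leech_nbrs x))" by simp
  then show ?thesis by (simp only: of_nat_le_iff)
qed

lemma card_leech_nbrs:
  assumes x: "x \<in> leech_code"
  shows "card (leech_nbrs x) = 4600"
proof (rule ccontr)
  assume "card (leech_nbrs x) \<noteq> 4600"
  then have "(\<Sum>x\<in>leech_code. card (leech_nbrs x)) < (\<Sum>x\<in>leech_code. 4600)"
    using card_leech_nbrs_le x finite_leech_code by (intro sum_strict_mono_ex1) (auto simp: nat_less_le)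
  then show False using sum_card_leech_nbrs by simp
qed

text \<open>The frame identity at \<open>z\<close>, less the contributions of
  \<plusminus>\<open>z\<close>, leaves 198, so 9 * 198 = 1782 points have inner product
  \<plusminus>1/3 with \<open>z\<close>, and 4598 - 1782 = 2816 are orthogonal to it.\<close>

lemma half_code_zero_count:
  assumes x: "x \<in> leech_code" and z: "z \<in> half_code x"
  shows "card {y\<in>half_code x. y \<bullet> z = 0} = 2816"
proof -
  obtain f :: "real ^ 23 option \<Rightarrow> real ^ 23" where f: "inj_on f (half_code x)" "f ` half_code x \<subseteq> sphere 0 1"
    "\<And>v w. v \<in> half_code x \<Longrightarrow> w \<in> half_code x \<Longrightarrow> f v \<bullet> f w = v \<bullet> w"
    "\<And>p q. p \<in> f ` half_code x \<Longrightarrow> q \<in> f ` half_code x \<Longrightarrow> p \<bullet> q \<in> {-1, -1/3, 0, 1/3, 1}"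
    using half_code_image[OF x] by blast
  have card: "card (half_code x) = 4600" by (simp add: card_half_code card_leech_nbrs x)
  have "(\<Sum>v\<in>f ` half_code x. (v \<bullet> f z)\<^sup>2) = 200 * (norm (f z))\<^sup>2"
    by (rule three_distance_23(2)[OF f(2) _ f(4)]) (simp_all add: finite_half_code card_image f(1) card)
  moreover have "(norm (f z))\<^sup>2 = 1" using f(2) z by auto
  ultimately have two: "(\<Sum>v\<in>half_code x. (z \<bullet> v)\<^sup>2) = 200"
    using f z by (simp add: sum.reindex inner_commute)
  let ?A = "\<lambda>t. real (card {y\<in>half_code x. z \<bullet> y = t})"
  note by_inner = sum_by_inner[of "half_code x" "{-1, -1/3, 0, 1/3, 1}" z, OF finite_half_code _ half_code_inner[OF x z]]
  have S: "half_code x \<subseteq> sphere 0 1" by (rule half_code_sphere[OF x])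
  have ends: "?A 1 = 1" "?A (-1) = 1"
    using card_inner_1[OF S z] card_inner_minus_1[OF S z] half_code_uminus[OF x z] by simp_all
  have "?A (-1/3) / 9 + ?A (1/3) / 9 = 198"
    using by_inner[of "\<lambda>t. t\<^sup>2"] two ends by (simp add: power2_eq_square)
  moreover have "?A (-1/3) + ?A 0 + ?A (1/3) = 4598"
    using by_inner[of "\<lambda>t. 1::real"] card ends by simp
  ultimately have "?A 0 = 2816" by linarith
  then show ?thesis by (simp add: inner_commute)
qed

text \<open>The same count one dimension lower: 9 * 126 = 1134 points at \<plusminus>1/3, split
  evenly into 567 and 567 because the code is antipodal.\<close>

lemma C2816_properties:
  assumes "is_C2816 D"
  shows "finite D" "D \<subseteq> sphere 0 1" "card D = 2816"
    and "\<And>x y. x \<in> D \<Longrightarrow> y \<in> D \<Longrightarrow> x \<bullet> y \<in> {-1, -1/3, 0, 1/3, 1}"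
    and "\<And>x. x \<in> D \<Longrightarrow> card {y\<in>D. x \<bullet> y = -1} = 1"
    and "\<And>x. x \<in> D \<Longrightarrow> card {y\<in>D. x \<bullet> y = -1/3} = 567"
    and "\<And>x. x \<in> D \<Longrightarrow> card {y\<in>D. x \<bullet> y = 0} = 1680"
    and "\<And>x. x \<in> D \<Longrightarrow> card {y\<in>D. x \<bullet> y = 1/3} = 567"
proof -
  obtain x z and \<phi> :: "real ^ 23 option \<Rightarrow> real ^ 22" where x: "x \<in> leech_code" and z: "z \<in> half_code x"
    and \<phi>: "linear \<phi>" "\<And>v. v \<bullet> x = 0 \<and> v \<bullet> z = 0 \<Longrightarrow> norm (\<phi> v) = norm v"
    and D: "D = \<phi> ` {y\<in>half_code x. y \<bullet> z = 0}"
    using assms unfolding is_C2816_def by blast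
  let ?D0 = "{y\<in>half_code x. y \<bullet> z = 0}"
  let ?S = "{v. \<forall>y\<in>{x, z}. v \<bullet> y = 0}"
  have S: "subspace ?S" by (rule subspace_orthogonal_complement)
  have iso: "v \<in> ?S \<Longrightarrow> norm (\<phi> v) = norm v" for v using \<phi>(2) by simp
  have sub: "?D0 \<subseteq> ?S" using half_code_orthogonal[OF x] by auto
  have ip: "\<phi> v \<bullet> \<phi> w = v \<bullet> w" if "v \<in> ?D0" "w \<in> ?D0" for v w
    by (rule isometry_inner[OF \<phi>(1) S iso]) (use that sub in blast)+
  show fin: "finite D" by (simp add: D finite_half_code)
  show sph: "D \<subseteq> sphere 0 1"
    using half_code_sphere[OF x] ip by (auto simp: D norm_eq_1)
  show card: "card D = 2816"
    using card_image[OF isometry_inj_on[OF \<phi>(1) S iso sub]] half_code_zero_count[OF x z] by (simp add: D)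
  show inner: "v \<bullet> w \<in> {-1, -1/3, 0, 1/3, 1}" if vw: "v \<in> D" "w \<in> D" for v w
  proof -
    obtain p q where "p \<in> ?D0" "q \<in> ?D0" "v = \<phi> p" "w = \<phi> q" using vw unfolding D by blast
    then show ?thesis using half_code_inner[OF x, of p q] ip[of p q] by simp
  qed
  have neg: "- v \<in> D" if v: "v \<in> D" for v
  proof -
    obtain w where w: "w \<in> ?D0" "v = \<phi> w" using v D by blast
    then have "- w \<in> ?D0" using half_code_uminus[OF x] by simp
    moreover have "- v = \<phi> (- w)" using w(2) \<phi>(1) by (simp add: linear_neg)
    ultimately show ?thesis using D by blast
  qed
  fix v assume v: "v \<in> D"
  let ?A = "\<lambda>t. card {y\<in>D. v \<bullet> y = t}"
  note by_inner = sum_by_inner[of D "{-1, -1/3, 0, 1/3, 1}" v, OF fin _ inner[OF v]]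
  have "(\<Sum>y\<in>D. (v \<bullet> y)\<^sup>2) = 128"
    using three_distance_22[OF sph fin inner card, of v] sph v by (auto simp: inner_commute)
  moreover have ends: "?A 1 = 1" "?A (-1) = 1"
    using card_inner_1[OF sph v] card_inner_minus_1[OF sph v] neg[OF v] by simp_all
  ultimately have "real (?A (-1/3)) / 9 + real (?A (1/3)) / 9 = 126"
    using by_inner[of "\<lambda>t. t\<^sup>2"] by (simp add: power2_eq_square)
  moreover have "real (?A (-1/3)) + real (?A 0) + real (?A (1/3)) = 2814"
    using by_inner[of "\<lambda>t. 1::real"] card ends by simp
  moreover have "?A (-1/3) = ?A (1/3)"
    by (rule bij_betw_same_card[of uminus], rule bij_betw_byWitness[where f' = uminus]) (auto simp: neg)
  ultimately have "real (?A (1/3)) = 567" "real (?A 0) = 1680" "?A (-1/3) = ?A (1/3)" by linarith+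
  then show "?A (-1) = 1" "?A (-1/3) = 567" "?A 0 = 1680" "?A (1/3) = 567"
    using ends by simp_all
qed

lemma C2816_exists: "\<exists>D. is_C2816 D"
proof -
  obtain x where x: "x \<in> leech_code" using card_leech_code by fastforce
  have "card (half_code x) = 4600" by (simp add: card_half_code card_leech_nbrs x)
  then obtain z where z: "z \<in> half_code x" by fastforce
  have nz: "x \<noteq> 0" "z \<noteq> 0" "z \<bullet> x = 0"
    using norm_leech_code[OF x] half_code_sphere[OF x] z half_code_orthogonal[OF x z] by auto
  then have "x \<noteq> z" by auto
  have "independent {x, z}"
    using nz by (intro pairwise_orthogonal_independent) (auto simp: pairwise_def orthogonal_def inner_commute)
  then have "dim {x, z} = 2" using \<open>x \<noteq> z\<close> by (simp add: dim_eq_card_independent)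
  then obtain \<phi> :: "real ^ 23 option \<Rightarrow> real ^ 22" where "linear \<phi>"
      "\<And>v. (\<forall>y\<in>{x, z}. v \<bullet> y = 0) \<Longrightarrow> norm (\<phi> v) = norm v"
    using isometry_orthogonal_complement[of "{x, z}", where 'b = "real ^ 22"] by auto
  then have "is_C2816 (\<phi> ` {y\<in>half_code x. y \<bullet> z = 0})"
    unfolding is_C2816_def using x z by (intro bexI[of _ x] bexI[of _ z] exI[of _ \<phi>]) auto
  then show ?thesis by blast
qed

section \<open>Interpolation of absolutely monotone functions\<close>

text \<open>At the left end only continuity is assumed, since a potential need not be differentiable
  at -1. \<open>Z'\<close> avoids \<open>Z\<close> so that double zeros can be added to it later;
  the clause \<open>t < Max Z\<close> keeps the next zero distinct from the earlier ones in the
  induction.\<close>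

lemma rolle_zeros:
  fixes g g' :: "real \<Rightarrow> real"
  assumes cont: "continuous_on {a..<1} g"
    and der: "\<And>t. t \<in> {a<..<1} \<Longrightarrow> (g has_real_derivative g' t) (at t)"
    and Z: "finite Z" "Z \<noteq> {}" "Z \<subseteq> {a..<1}" "\<And>t. t \<in> Z \<Longrightarrow> g t = 0"
  shows "\<exists>Z'. finite Z' \<and> Suc (card Z') = card Z \<and> Z' \<inter> Z = {} \<and> Z' \<subseteq> {a<..<1} \<and>
     (\<forall>t\<in>Z'. g' t = 0 \<and> t < Max Z)"
  using Z
proof (induction Z rule: finite_linorder_max_induct)
  case (insert b A)
  show ?case
  proof (cases "A = {}")
    case True
    then show ?thesis by (intro exI[of _ "{}"]) simp
  next
    case False
    obtain Z' where Z': "finite Z'" "Suc (card Z') = card A" "Z' \<inter> A = {}" "Z' \<subseteq> {a<..<1}"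
        "\<forall>t\<in>Z'. g' t = 0 \<and> t < Max A"
      using insert.IH[OF False] insert.prems by auto
    let ?a = "Max A"
    have maxA: "?a \<in> A" "?a < b" using insert.hyps False by auto
    have ab: "a \<le> ?a" "b < 1" "g ?a = 0" "g b = 0" using maxA insert.prems by auto
    have "\<exists>\<xi>>?a. \<xi> < b \<and> g' \<xi> = 0"
    proof -
      have "continuous_on {?a..b} g"
        by (rule continuous_on_subset[OF cont]) (use ab in auto)
      moreover have "(g has_derivative (*) (g' t)) (at t)" if "?a < t" "t < b" for t
        using der[of t] that ab by (simp add: has_field_derivative_def)
      ultimately obtain \<xi> where "?a < \<xi>" "\<xi> < b" "(*) (g' \<xi>) = (\<lambda>v. 0)"
        using Rolle_deriv[of ?a b g "\<lambda>t. (*) (g' t)"] maxA ab by auto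
      then have "g' \<xi> * 1 = 0" by metis
      then show ?thesis using \<open>?a < \<xi>\<close> \<open>\<xi> < b\<close> by auto
    qed
    then obtain \<xi> where \<xi>: "?a < \<xi>" "\<xi> < b" "g' \<xi> = 0" by blast
    have Max: "Max (insert b A) = b"
      using insert.hyps by (intro Max_eqI) (auto intro: less_imp_le)
    have "\<xi> \<notin> A" "\<xi> \<notin> Z'" using \<xi>(1) Max_ge[OF insert.hyps(1), of \<xi>] Z'(5) by auto
    moreover have "b \<notin> Z'" using Z'(5) maxA by auto
    moreover have "b \<notin> A" using insert.hyps by auto
    moreover have "\<forall>t\<in>insert \<xi> Z'. g' t = 0 \<and> t < b" using Z'(5) \<xi> maxA by auto
    ultimately show ?thesis
      unfolding Max using Z' \<xi> ab insert.hyps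
      by (intro exI[of _ "insert \<xi> Z'"]) auto
  qed
qed simp

lemma iterated_rolle:
  fixes H :: "nat \<Rightarrow> real \<Rightarrow> real"
  assumes der: "\<And>j t. t \<in> {-1<..<1} \<Longrightarrow> (H j has_real_derivative H (Suc j) t) (at t)"
    and Z: "finite Z" "card Z = Suc m" "Z \<subseteq> {-1<..<1}" "\<And>t. t \<in> Z \<Longrightarrow> H j t = 0"
  shows "\<exists>\<xi>\<in>{-1<..<1}. H (j + m) \<xi> = 0"
  using Z
proof (induction m arbitrary: j Z)
  case 0
  then show ?case by (auto simp: card_1_singleton_iff)
next
  case (Suc m)
  \<comment> \<open>Derivatives need not extend continuously to -1, so the left end moves to an
    interior point below all zeros.\<close>
  obtain a where a: "a \<in> {-1<..<1}" "\<And>t. t \<in> Z \<Longrightarrow> a < t"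
  proof -
    have "Z \<noteq> {}" using Suc.prems by auto
    then have "Min Z \<in> {-1<..<1}" using Suc.prems by (meson Min_in subsetD)
    then have "(Min Z - 1) / 2 \<in> {-1<..<1}" "(Min Z - 1) / 2 < Min Z" by auto
    then show thesis using that Suc.prems by (metis Min_le less_le_trans)
  qed
  have cont: "continuous_on {a..<1} (H j)"
  proof (intro continuous_at_imp_continuous_on ballI)
    fix t assume "t \<in> {a..<1}"
    then show "isCont (H j) t" using a(1) der[of t j] by (intro DERIV_isCont) auto
  qed
  have ne: "Z \<noteq> {}" using Suc.prems by auto
  have sub: "Z \<subseteq> {a..<1}"
    using Suc.prems(3) a(2) by (force intro: less_imp_le)
  have "(H j has_real_derivative H (Suc j) t) (at t)" if "t \<in> {a<..<1}" for t
    using der that a(1) by auto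
  then obtain Z' where Z': "finite Z'" "Suc (card Z') = card Z" "Z' \<subseteq> {a<..<1}"
      "\<forall>t\<in>Z'. H (Suc j) t = 0"
    using rolle_zeros[OF cont _ Suc.prems(1) ne sub Suc.prems(4)] by metis
  have "Z' \<subseteq> {-1<..<1}" using Z'(3) a(1) by auto
  then show ?case using Suc.IH[of Z' "Suc j"] Z' Suc.prems(2) by auto
qed

text \<open>The zeros in \<open>Z\<^sub>2\<close> are double zeros of \<open>H 0\<close>.\<close>

lemma rolle_multiple_zeros:
  fixes H :: "nat \<Rightarrow> real \<Rightarrow> real"
  assumes der: "\<And>j t. t \<in> {-1<..<1} \<Longrightarrow> (H j has_real_derivative H (Suc j) t) (at t)"
    and cont: "continuous_on {-1..<1} (H 0)"
    and Z: "finite Z" "Z \<subseteq> {-1..<1}" "\<And>t. t \<in> Z \<Longrightarrow> H 0 t = 0"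
    and Z2: "Z\<^sub>2 \<subseteq> Z" "Z\<^sub>2 \<subseteq> {-1<..<1}" "\<And>t. t \<in> Z\<^sub>2 \<Longrightarrow> H 1 t = 0"
    and card: "card Z + card Z\<^sub>2 = Suc k" and k: "k > 0"
  shows "\<exists>\<xi>\<in>{-1<..<1}. H k \<xi> = 0"
proof -
  have fin2: "finite Z\<^sub>2" using Z(1) Z2(1) finite_subset by blast
  have "Z \<noteq> {}" using card Z2(1) by auto
  then obtain Z' where Z': "finite Z'" "Suc (card Z') = card Z" "Z' \<inter> Z = {}" "Z' \<subseteq> {-1<..<1}"
      "\<forall>t\<in>Z'. H 1 t = 0"
    using rolle_zeros[of "-1" "H 0" "H 1" Z] der[of _ 0] cont Z by (metis One_nat_def)
  \<comment> \<open>Rolle loses one zero and the double zeros restore \<open>card Z\<^sub>2\<close>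
    of them: the derivative has \<open>k\<close> distinct zeros, all interior.\<close>
  have "card (Z' \<union> Z\<^sub>2) = card Z' + card Z\<^sub>2"
    using Z' Z2 fin2 by (intro card_Un_disjoint) auto
  then have "card (Z' \<union> Z\<^sub>2) = Suc (k - 1)" using Z'(2) card k by simp
  moreover have "Z' \<union> Z\<^sub>2 \<subseteq> {-1<..<1}" "\<And>t. t \<in> Z' \<union> Z\<^sub>2 \<Longrightarrow> H 1 t = 0"
    using Z' Z2 by auto
  ultimately show ?thesis
    using iterated_rolle[of H "Z' \<union> Z\<^sub>2" "k - 1" 1] der Z'(1) fin2 k by simp
qed

section \<open>Mean value form of divided differences and of the interpolation error\<close>

lemma absolutely_monotone_deriv:
  assumes "absolutely_monotone h" "t \<in> {-1<..<1}"
  shows "((deriv ^^ j) h has_real_derivative (deriv ^^ Suc j) h t) (at t)"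
  using assms by (simp add: absolutely_monotone_def DERIV_deriv_iff_real_differentiable)

lemma pderiv_iter_degree:
  fixes p :: "real poly"
  assumes "degree p \<le> k"
  shows "poly ((pderiv ^^ k) p) t = fact k * coeff p k"
proof -
  have coeff: "coeff ((pderiv ^^ k) p) j = pochhammer (of_nat (Suc j)) k * coeff p (j + k)" for k j
  proof (induction k arbitrary: j)
    case (Suc k)
    have "coeff ((pderiv ^^ Suc k) p) j = of_nat (Suc j) * (pochhammer (of_nat (Suc (Suc j))) k * coeff p (Suc j + k))"
      by (simp add: coeff_pderiv Suc.IH)
    moreover have "of_nat (Suc j) * pochhammer (of_nat (Suc (Suc j))) k = pochhammer (of_nat (Suc j) :: real) (Suc k)"
      by (simp add: pochhammer_rec add.commute)
    ultimately show ?case by simp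
  qed simp
  have "(pderiv ^^ k) p = [:fact k * coeff p k:]"
  proof (rule poly_eqI)
    fix j
    show "coeff ((pderiv ^^ k) p) j = coeff [:fact k * coeff p k:] j"
      using assms by (cases j) (simp_all add: coeff coeff_eq_0 pochhammer_fact)
  qed
  then show ?thesis by simp
qed

text \<open>\<open>h - p\<close> has \<open>k + 1\<close> zeros with multiplicity, so its
  \<open>k\<close>-th derivative vanishes somewhere, where the derivative of \<open>h\<close> equals
  the constant one of \<open>p\<close>.\<close>

lemma interpolation_leading_coeff:
  fixes h :: "real \<Rightarrow> real" and p :: "real poly"
  assumes h: "absolutely_monotone h" and deg: "degree p \<le> k" and k: "k > 0"
    and Z: "finite Z" "Z \<subseteq> {-1..<1}" "\<And>t. t \<in> Z \<Longrightarrow> h t = poly p t"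
    and Z2: "Z\<^sub>2 \<subseteq> Z" "Z\<^sub>2 \<subseteq> {-1<..<1}" "\<And>t. t \<in> Z\<^sub>2 \<Longrightarrow> deriv h t = poly (pderiv p) t"
    and card: "card Z + card Z\<^sub>2 = Suc k"
  shows "\<exists>\<xi>\<in>{-1<..<1}. (deriv ^^ k) h \<xi> = fact k * coeff p k"
proof -
  define H where "H j t = (deriv ^^ j) h t - poly ((pderiv ^^ j) p) t" for j t
  have "(H j has_real_derivative H (Suc j) t) (at t)" if "t \<in> {-1<..<1}" for j t
    unfolding H_def using absolutely_monotone_deriv[OF h that, of j]
    by (auto intro!: derivative_eq_intros)
  moreover have "continuous_on {-1..<1} (H 0)"
    unfolding H_def using h by (auto simp: absolutely_monotone_def intro!: continuous_intros)
  ultimately have "\<exists>\<xi>\<in>{-1<..<1}. H k \<xi> = 0"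
    by (rule rolle_multiple_zeros[OF _ _ Z(1,2) _ Z2(1,2) _ card k])
       (use Z(3) Z2(3) in \<open>auto simp: H_def\<close>)
  then show ?thesis by (auto simp: H_def pderiv_iter_degree[OF deg])
qed

text \<open>The leading coefficient formula for \<open>q = p + K w\<close>, which interpolates also
  at the additional node \<open>t\<close>: its coefficient of degree \<open>Suc k\<close> is
  \<open>K\<close>.\<close>

lemma interpolation_remainder:
  fixes h :: "real \<Rightarrow> real" and p w :: "real poly"
  assumes h: "absolutely_monotone h" and deg: "degree p \<le> k"
    and Z: "finite Z" "Z \<subseteq> {-1..<1}" "\<And>t. t \<in> Z \<Longrightarrow> h t = poly p t"
    and Z2: "Z\<^sub>2 \<subseteq> Z" "Z\<^sub>2 \<subseteq> {-1<..<1}" "\<And>t. t \<in> Z\<^sub>2 \<Longrightarrow> deriv h t = poly (pderiv p) t"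
    and card: "card Z + card Z\<^sub>2 = Suc k"
    and w: "degree w = Suc k" "lead_coeff w = 1" "\<And>t. t \<in> Z \<Longrightarrow> poly w t = 0"
      "\<And>t. t \<in> Z\<^sub>2 \<Longrightarrow> poly (pderiv w) t = 0"
    and t: "t \<in> {-1..<1}" "t \<notin> Z" "poly w t \<noteq> 0"
  shows "\<exists>\<xi>\<in>{-1<..<1}. h t - poly p t = (deriv ^^ Suc k) h \<xi> / fact (Suc k) * poly w t"
proof -
  define K where "K = (h t - poly p t) / poly w t"
  define q where "q = p + smult K w"
  have "degree q \<le> Suc k"
    unfolding q_def using deg w(1) degree_smult_le[of K w] by (intro degree_add_le) auto
  moreover have "h s = poly q s" if "s \<in> insert t Z" for s
    using that Z(3) w(3) t(3) by (auto simp: q_def K_def)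
  moreover have "deriv h s = poly (pderiv q) s" if "s \<in> Z\<^sub>2" for s
    using that Z2(3) w(4) by (auto simp: q_def pderiv_add pderiv_smult)
  moreover have "card (insert t Z) + card Z\<^sub>2 = Suc (Suc k)"
    using t(2) Z(1) card by simp
  ultimately have "\<exists>\<xi>\<in>{-1<..<1}. (deriv ^^ Suc k) h \<xi> = fact (Suc k) * coeff q (Suc k)"
    using Z(1,2) Z2(1,2) t(1) by (intro interpolation_leading_coeff[OF h, where Z = "insert t Z" and Z\<^sub>2 = Z\<^sub>2]) auto
  moreover have "coeff q (Suc k) = K"
    using w(1,2) deg by (simp add: q_def coeff_eq_0)
  ultimately show ?thesis using t(3) by (auto simp: K_def intro!: bexI)
qed

section \<open>Interpolants for the three intervals\<close>

text \<open>The Newton basis for the nodes \<open>-1, -1/3, 0, 1/3, 0\<close>, in this order.\<close>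

definition newton_poly :: "real \<Rightarrow> real \<Rightarrow> real \<Rightarrow> real \<Rightarrow> real \<Rightarrow> real \<Rightarrow> real poly" where
  "newton_poly c0 c1 c2 c3 c4 c5 = [:c0:] + smult c1 [:1, 1:] + smult c2 [:1/3, 4/3, 1:] +
     smult c3 [:0, 1/3, 4/3, 1:] + smult c4 [:0, -1/9, -1/9, 1, 1:] + smult c5 [:0, 0, -1/9, -1/9, 1, 1:]"

text \<open>Records only the mean value form of a divided difference, which is what determines its
  sign.\<close>

definition divided_difference :: "(real \<Rightarrow> real) \<Rightarrow> nat \<Rightarrow> real \<Rightarrow> bool" where
  "divided_difference h k c \<longleftrightarrow> (\<exists>\<xi>\<in>{-1<..<1}. (deriv ^^ k) h \<xi> = fact k * c)"

text \<open>The coefficient of each degree up to 3 is the leading one of the interpolant at an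
  initial segment of the nodes. The double node \<open>e\<close> affects only \<open>c4\<close>, so
  it can be chosen according to \<open>T\<close>.\<close>

lemma newton_interpolation:
  assumes h: "absolutely_monotone h" and e: "e \<in> {-1/3, 0, 1/3}"
  obtains c0 c1 c2 c3 c4 where
    "\<And>t. t \<in> {-1, -1/3, 0, 1/3} \<Longrightarrow> h t = poly (newton_poly c0 c1 c2 c3 c4 0) t"
    "deriv h e = poly (pderiv (newton_poly c0 c1 c2 c3 c4 0)) e"
    "divided_difference h 1 c1" "divided_difference h 2 c2"
    "divided_difference h 3 c3" "divided_difference h 4 c4"
proof -
  define c0 where "c0 = h (-1)"
  \<comment> \<open>Triangular solution of the interpolation conditions; the numbers are values of
    the Newton basis at the nodes, such as 8/9 = 4/3 * 2/3 and 8/27 = 4/3 * 2/3 * 1/3 at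
    1/3.\<close>
  define c1 where "c1 = (h (-1/3) - c0) / (2/3)"
  define c2 where "c2 = (h 0 - c0 - c1) / (1/3)"
  define c3 where "c3 = (h (1/3) - c0 - c1 * (4/3) - c2 * (8/9)) / (8/27)"
  \<comment> \<open>Adding a multiple of the quartic nodal polynomial keeps the four values and
    shifts the derivative at \<open>e\<close> by a multiple of \<open>D\<close>, nonzero because
    \<open>e\<close> is a simple root.\<close>
  define d where "d = poly (pderiv (newton_poly c0 c1 c2 c3 0 0)) e"
  define D where "D = poly (pderiv [:0, -1/9, -1/9, 1, 1:]) e"
  define c4 where "c4 = (deriv h e - d) / D"
  have D: "D \<noteq> 0" 
  proof -
    consider "e = -1/3" | "e = 0" | "e = 1/3" using e by blast
    then show ?thesis unfolding D_def by cases (simp_all only:, simp_all add: pderiv_pCons)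
  qed
  have nodes: "h (-1) = poly (newton_poly c0 c1 c2 c3 c4 0) (-1)"
    "h (-1/3) = poly (newton_poly c0 c1 c2 c3 c4 0) (-1/3)"
    "h 0 = poly (newton_poly c0 c1 c2 c3 c4 0) 0"
    "h (1/3) = poly (newton_poly c0 c1 c2 c3 c4 0) (1/3)" for c4
    by (simp_all add: newton_poly_def c0_def c1_def c2_def c3_def field_simps)
  have "newton_poly c0 c1 c2 c3 c4 0 = newton_poly c0 c1 c2 c3 0 0 + smult c4 [:0, -1/9, -1/9, 1, 1:]"
    by (simp add: newton_poly_def)
  then have "poly (pderiv (newton_poly c0 c1 c2 c3 c4 0)) e = d + c4 * D"
    by (simp only: pderiv_add pderiv_smult poly_add poly_smult d_def D_def)
  then have der: "deriv h e = poly (pderiv (newton_poly c0 c1 c2 c3 c4 0)) e"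
    using D by (simp add: c4_def)
  note coeff = interpolation_leading_coeff[OF h]
  show thesis
  proof
    show "h t = poly (newton_poly c0 c1 c2 c3 c4 0) t" if "t \<in> {-1, -1/3, 0, 1/3}" for t
      using that nodes[of c4] by (metis empty_iff insert_iff)
    show "deriv h e = poly (pderiv (newton_poly c0 c1 c2 c3 c4 0)) e" by (rule der)
    show "divided_difference h 1 c1"
    proof -
      let ?p = "newton_poly c0 c1 0 0 0 0"
      have p: "degree ?p \<le> 1" "coeff ?p 1 = c1" by (simp_all add: newton_poly_def eval_nat_numeral)
      have "h (-1) = poly ?p (-1)" "h (-1/3) = poly ?p (-1/3)"
        by (simp_all add: newton_poly_def c0_def c1_def field_simps)
      then have nodes: "h t = poly ?p t" if "t \<in> {-1, -1/3}" for t
        using that by (metis empty_iff insert_iff)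
      have "\<exists>\<xi>\<in>{-1<..<1}. (deriv ^^ 1) h \<xi> = fact 1 * coeff ?p 1"
        by (rule coeff[OF p(1), where Z = "{-1, -1/3}" and Z\<^sub>2 = "{}"];
            (erule nodes | simp))
      then show ?thesis unfolding p(2) divided_difference_def .
    qed
    show "divided_difference h 2 c2"
    proof -
      let ?p = "newton_poly c0 c1 c2 0 0 0"
      have p: "degree ?p \<le> 2" "coeff ?p 2 = c2" by (simp_all add: newton_poly_def eval_nat_numeral)
      have "h (-1) = poly ?p (-1)" "h (-1/3) = poly ?p (-1/3)" "h 0 = poly ?p 0"
        by (simp_all add: newton_poly_def c0_def c1_def c2_def field_simps)
      then have nodes: "h t = poly ?p t" if "t \<in> {-1, -1/3, 0}" for t
        using that by (metis empty_iff insert_iff)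
      have "\<exists>\<xi>\<in>{-1<..<1}. (deriv ^^ 2) h \<xi> = fact 2 * coeff ?p 2"
        by (rule coeff[OF p(1), where Z = "{-1, -1/3, 0}" and Z\<^sub>2 = "{}"];
            (erule nodes | simp))
      then show ?thesis unfolding p(2) divided_difference_def .
    qed
    show "divided_difference h 3 c3"
    proof -
      let ?p = "newton_poly c0 c1 c2 c3 0 0"
      have p: "degree ?p \<le> 3" "coeff ?p 3 = c3" by (simp_all add: newton_poly_def eval_nat_numeral)
      note nodes[of 0]
      then have nodes: "h t = poly ?p t" if "t \<in> {-1, -1/3, 0, 1/3}" for t
        using that by (metis empty_iff insert_iff)
      have "\<exists>\<xi>\<in>{-1<..<1}. (deriv ^^ 3) h \<xi> = fact 3 * coeff ?p 3"
        by (rule coeff[OF p(1), where Z = "{-1, -1/3, 0, 1/3}" and Z\<^sub>2 = "{}"];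
            (erule nodes | simp))
      then show ?thesis unfolding p(2) divided_difference_def .
    qed
    show "divided_difference h 4 c4"
    proof -
      let ?p = "newton_poly c0 c1 c2 c3 c4 0"
      have p: "degree ?p \<le> 4" "coeff ?p 4 = c4" by (simp_all add: newton_poly_def eval_nat_numeral)
      have e_sub: "{e} \<subseteq> {-1, -1/3, 0, 1/3}" "{e} \<subseteq> {-1<..<1}" using e by auto
      have ders: "deriv h s = poly (pderiv ?p) s" if "s \<in> {e}" for s using that der by simp
      note nodes[of c4]
      then have nodes: "h t = poly ?p t" if "t \<in> {-1, -1/3, 0, 1/3}" for t
        using that by (metis empty_iff insert_iff)
      have "\<exists>\<xi>\<in>{-1<..<1}. (deriv ^^ 4) h \<xi> = fact 4 * coeff ?p 4"
        by (rule coeff[OF p(1), where Z = "{-1, -1/3, 0, 1/3}" and Z\<^sub>2 = "{e}"];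
            (rule e_sub | erule nodes | erule ders | simp))
      then show ?thesis unfolding p(2) divided_difference_def .
    qed
  qed
qed

text \<open>The \<open>j\<close>-th derivative is strictly increasing, and it is nonnegative at a
  point further to the left.\<close>

lemma absolutely_monotone_strict:
  assumes h: "absolutely_monotone h" and "\<forall>t\<in>{-1<..<1}. (deriv ^^ Suc j) h t > 0" and "j \<ge> 1"
  shows "\<forall>t\<in>{-1<..<1}. (deriv ^^ j) h t > 0"
proof
  fix t :: real assume t: "t \<in> {-1<..<1}"
  let ?s = "(t - 1) / 2"
  have s: "?s \<in> {-1<..<1}" "?s < t" using t by auto
  have "(deriv ^^ j) h ?s < (deriv ^^ j) h t"
  proof (rule DERIV_pos_imp_increasing[OF s(2)])
    fix x assume "?s \<le> x" "x \<le> t"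
    then have "x \<in> {-1<..<1}" using s t by auto
    then show "\<exists>y. ((deriv ^^ j) h has_real_derivative y) (at x) \<and> 0 < y"
      using absolutely_monotone_deriv[OF h] assms(2) by blast
  qed
  moreover have "(deriv ^^ j) h ?s \<ge> 0" using h s assms(3) by (simp add: absolutely_monotone_def)
  ultimately show "(deriv ^^ j) h t > 0" by linarith
qed

lemma absolutely_monotone_strict_6:
  assumes h: "absolutely_monotone h" and "\<forall>t\<in>{-1<..<1}. (deriv ^^ 6) h t > 0" and "j \<in> {1..6}"
  shows "\<forall>t\<in>{-1<..<1}. (deriv ^^ j) h t > 0"
proof -
  have "\<forall>t\<in>{-1<..<1}. (deriv ^^ j) h t > 0" if "j \<le> 6" "j \<ge> 1" for j
    using that
  proof (induction j rule: inc_induct)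
    case base
    then show ?case using assms(2) by simp
  next
    case (step j)
    then show ?case using absolutely_monotone_strict[OF h] by simp
  qed
  then show ?thesis using assms(3) by simp
qed

text \<open>Up to normalization, the kernels following \<open>a\<^sub>0\<close> are positive definite on \<open>S\<^sup>2\<^sup>1\<close>
  and have mean value \<open>0\<close>; note \<open>t\<^sup>4 - t\<^sup>2/8 = t \<cdot> (t\<^sup>3 - t/8)\<close> etc., where \<open>t\<^sup>3 - t/8\<close> is a
  multiple of the third Gegenbauer polynomial in dimension 22.\<close>

definition lp_fun :: "real \<Rightarrow> real \<Rightarrow> real \<Rightarrow> real \<Rightarrow> real \<Rightarrow> real \<Rightarrow> real \<Rightarrow> real" where
  "lp_fun a0 a1 a2 a3 a4 a5 t = a0 + a1 * t + a2 * (t\<^sup>2 - 1/22) + a3 * (t ^ 3 - t / 8) +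
     a4 * (t ^ 4 - t\<^sup>2 / 8) + a5 * (t ^ 5 - t ^ 3 / 8)"

text \<open>The change of basis has nonnegative coefficients because the nodal polynomials contain
  \<open>- t^2/9\<close>, the kernels \<open>- t^2/8\<close>, and 1/8 - 1/9 = 1/72 is positive. The
  order of the nodes matters: with 1/3 instead of 0 as the fifth node, \<open>t^3 - t/8\<close>
  would receive the coefficient 1/8 - 4/9 from the last basis element.\<close>

lemma newton_poly_lp_fun:
  "poly (newton_poly c0 c1 c2 c3 c4 c5) t =
   lp_fun (c0 + c1 + c2 / 3 + (c2 + 4/3 * c3 + (c4 + c5) / 72) / 22)
     (c1 + 4/3 * c2 + 11/24 * c3 + c4 / 72 + c5 / 576)
     (c2 + 4/3 * c3 + (c4 + c5) / 72) (c3 + c4 + c5 / 72) (c4 + c5) c5 t"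
  by (simp add: newton_poly_def lp_fun_def field_simps eval_nat_numeral)

definition lp_nodes :: "real set" where
  "lp_nodes = {-1, -1/3, 0, 1/3}"

lemma newton_remainder:
  assumes h: "absolutely_monotone h" and e: "e \<in> {-1/3, 1/3}"
    and nodes: "\<And>t. t \<in> {-1, -1/3, 0, 1/3} \<Longrightarrow> h t = poly (newton_poly c0 c1 c2 c3 c4 0) t"
    and der: "deriv h e = poly (pderiv (newton_poly c0 c1 c2 c3 c4 0)) e"
    and t: "t \<in> {-1..<1}" "t \<notin> {-1, -1/3, 0, 1/3}"
    and pos: "0 < t * (t + 1) * (t\<^sup>2 - 1/9) * (t - e)"
  shows "\<exists>\<xi>\<in>{-1<..<1}. \<exists>r>0. h t - poly (newton_poly c0 c1 c2 c3 c4 0) t = (deriv ^^ 5) h \<xi> * r"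
proof -
  let ?p = "newton_poly c0 c1 c2 c3 c4 0"
  let ?W = "[:0, -1/9, -1/9, 1, 1:] :: real poly"
  let ?w = "?W * [:- e, 1:]"
  have W: "poly ?W t = 0" if "t \<in> {-1, -1/3, 0, 1/3}" for t
  proof -
    have "poly ?W (-1) = 0" "poly ?W (-1/3) = 0" "poly ?W 0 = 0" "poly ?W (1/3) = 0" by simp_all
    then show ?thesis using that by (metis empty_iff insert_iff)
  qed
  have e': "poly ?W e = 0" by (rule W) (use e in blast)
  have deg: "degree ?p \<le> 4" by (simp add: newton_poly_def)
  have wt: "poly ?w t = t * (t + 1) * (t\<^sup>2 - 1/9) * (t - e)"
    by (simp add: algebra_simps eval_nat_numeral add_divide_distrib diff_divide_distrib)
  have "\<exists>\<xi>\<in>{-1<..<1}. h t - poly ?p t = (deriv ^^ Suc 4) h \<xi> / fact (Suc 4) * poly ?w t"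
  proof -
    have W0: "poly ?w s = 0" if "s \<in> {-1, -1/3, 0, 1/3}" for s
      using W[OF that] by (simp only: poly_mult mult_zero_left)
    have W1: "poly (pderiv ?w) s = 0" if "s \<in> {e}" for s
    proof -
      have "poly [:- e, 1:] e = 0" by simp
      then show ?thesis
        using that e' by (simp only: singleton_iff pderiv_mult poly_add poly_mult mult_zero_left add_0_left)
    qed
    have nz: "poly ?w t \<noteq> 0" unfolding wt using pos by linarith
    have ders: "deriv h s = poly (pderiv ?p) s" if "s \<in> {e}" for s using that der by simp
    have e_sub: "{e} \<subseteq> {-1, -1/3, 0, 1/3}" "{e} \<subseteq> {-1<..<1}" using e by auto
    show ?thesis
      by (rule interpolation_remainder[OF h deg, where Z = "{-1, -1/3, 0, 1/3}" and Z\<^sub>2 = "{e}"];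
          (rule t nz e_sub | erule nodes | erule ders | erule W0 | erule W1 | simp))
  qed
  then obtain \<xi> where "\<xi> \<in> {-1<..<1}" "h t - poly ?p t = (deriv ^^ 5) h \<xi> * (poly ?w t / fact (Suc 4))"
    by (auto simp: numeral_eq_Suc)
  then show ?thesis using pos wt by (metis divide_pos_pos fact_gt_zero)
qed

text \<open>For (-1,-1/3) both 0 and 1/3 are double, and \<open>k = 6\<close>. For (-1/3,0) the
  double node is 1/3, for (0,1/3) it is -1/3; then \<open>c5 = 0\<close> and
  \<open>k = 5\<close>.\<close>

lemma newton_interpolant:
  assumes T: "T \<in> {{-1<..<-1/3}, {-1/3<..<0}, {0<..<1/3}}" and h: "absolutely_monotone h"
  obtains c0 c1 c2 c3 c4 c5 k where
    "\<And>t. t \<in> lp_nodes \<Longrightarrow> h t = poly (newton_poly c0 c1 c2 c3 c4 c5) t"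
    "divided_difference h 1 c1" "divided_difference h 2 c2"
    "divided_difference h 3 c3" "divided_difference h 4 c4"
    "c5 \<ge> 0" "k \<in> {1..6}"
    "\<And>t. t \<in> {-1..<1} \<Longrightarrow> t \<notin> T \<Longrightarrow> t \<notin> lp_nodes \<Longrightarrow>
       \<exists>\<xi>\<in>{-1<..<1}. \<exists>r>0. h t - poly (newton_poly c0 c1 c2 c3 c4 c5) t = (deriv ^^ k) h \<xi> * r"
proof -
  \<comment> \<open>The nodal polynomial is \<open>(t + 1) (t - e)^2 * t (t + e)\<close>, so its
    sign is that of \<open>t (t + e)\<close>, negative exactly between the nodes 0 and
    \<open>- e\<close> that bound \<open>T\<close>.\<close>
  have sign: "0 < t * (t + 1) * (t\<^sup>2 - 1/9) * (t - e)"
    if "t + 1 > 0" "t \<noteq> e" "e\<^sup>2 = 1/9" "t * (t + e) > 0" for t e :: real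
  proof -
    have "(t - e)\<^sup>2 > 0" using that(2) by simp
    then have "(t + 1) * (t - e)\<^sup>2 * (t * (t + e)) > 0" using that by simp
    moreover have "(t + 1) * (t - e)\<^sup>2 * (t * (t + e)) = t * (t + 1) * (t\<^sup>2 - e\<^sup>2) * (t - e)"
      by (simp add: algebra_simps power2_eq_square)
    ultimately show ?thesis using that(3) by simp
  qed
  have "0 < t * (t + 1) * (t\<^sup>2 - 1/9) * (t - 1/3)"
    if "t \<in> {-1..<1}" "t \<notin> {-1/3<..<0}" "t \<notin> lp_nodes" for t
    using that by (intro sign) (auto simp: lp_nodes_def zero_less_mult_iff power_divide)
  moreover have "0 < t * (t + 1) * (t\<^sup>2 - 1/9) * (t - -1/3)"
    if "t \<in> {-1..<1}" "t \<notin> {0<..<1/3}" "t \<notin> lp_nodes" for t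
    using that by (intro sign) (auto simp: lp_nodes_def zero_less_mult_iff power_divide)
  ultimately consider (left) "T = {-1<..<-1/3}"
    | (other) e where "e \<in> {-1/3, 1/3}"
      "\<And>t. t \<in> {-1..<1} \<Longrightarrow> t \<notin> T \<Longrightarrow> t \<notin> lp_nodes \<Longrightarrow> 0 < t * (t + 1) * (t\<^sup>2 - 1/9) * (t - e)"
    using T by blast
  then show thesis
  proof cases
    case left
    obtain c0 c1 c2 c3 c4 where c:
      "\<And>t. t \<in> {-1, -1/3, 0, 1/3} \<Longrightarrow> h t = poly (newton_poly c0 c1 c2 c3 c4 0) t"
      "deriv h 0 = poly (pderiv (newton_poly c0 c1 c2 c3 c4 0)) 0"
      "divided_difference h 1 c1" "divided_difference h 2 c2"
    "divided_difference h 3 c3" "divided_difference h 4 c4"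
      using newton_interpolation[OF h, of 0] by blast
    \<comment> \<open>8/81 = 1/9 * 4/3 * 2/3 is the derivative at 1/3 of the nodal polynomial
      \<open>?W\<close>; its double root at 0 leaves the derivative there unchanged.\<close>
    define c5 where "c5 = (deriv h (1/3) - poly (pderiv (newton_poly c0 c1 c2 c3 c4 0)) (1/3)) / (8/81)"
    let ?p = "newton_poly c0 c1 c2 c3 c4 c5"
    let ?W = "[:0, 0, -1/9, -1/9, 1, 1:] :: real poly"
    let ?w = "?W * [:-1/3, 1:]"
    have p: "?p = newton_poly c0 c1 c2 c3 c4 0 + smult c5 ?W" by (simp add: newton_poly_def)
    have W: "poly ?W t = 0" if "t \<in> {-1, -1/3, 0, 1/3}" for t
    proof -
      have "poly ?W (-1) = 0" "poly ?W (-1/3) = 0" "poly ?W 0 = 0" "poly ?W (1/3) = 0" by simp_all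
      then show ?thesis using that by (metis empty_iff insert_iff)
    qed
    have dW: "poly (pderiv ?W) 0 = 0" "poly (pderiv ?W) (1/3) = 8/81" by (simp_all add: pderiv_pCons)
    have nodes: "h t = poly ?p t" if "t \<in> {-1, -1/3, 0, 1/3}" for t
      unfolding p using c(1)[OF that] W[OF that] by (simp only: poly_add poly_smult mult_zero_right add_0_right)
    have ders: "deriv h t = poly (pderiv ?p) t" if "t \<in> {0, 1/3}" for t
    proof -
      have pd: "poly (pderiv ?p) t = poly (pderiv (newton_poly c0 c1 c2 c3 c4 0)) t + c5 * poly (pderiv ?W) t" for t
        by (simp only: p pderiv_add pderiv_smult poly_add poly_smult)
      have "deriv h 0 = poly (pderiv ?p) 0" unfolding pd c(2) dW(1) by simp
      moreover have "deriv h (1/3) = poly (pderiv ?p) (1/3)" unfolding pd dW(2) unfolding c5_def by (simp add: field_simps)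
      ultimately show ?thesis using that by (metis empty_iff insert_iff)
    qed
    have deg: "degree ?p \<le> 5" "coeff ?p 5 = c5"
      by (simp_all add: newton_poly_def eval_nat_numeral)
    have "\<exists>\<xi>\<in>{-1<..<1}. (deriv ^^ 5) h \<xi> = fact 5 * coeff ?p 5"
      by (rule interpolation_leading_coeff[OF h deg(1), where Z = "{-1, -1/3, 0, 1/3}" and Z\<^sub>2 = "{0, 1/3}"];
          (erule nodes | erule ders | simp))
    then obtain \<xi> where \<xi>: "\<xi> \<in> {-1<..<1}" "(deriv ^^ 5) h \<xi> = fact 5 * c5" unfolding deg(2) by blast
    have "(deriv ^^ 5) h \<xi> \<ge> 0" using \<xi>(1) h by (simp add: absolutely_monotone_def)
    then have "c5 \<ge> 0" unfolding \<xi>(2) by (simp add: fact_numeral)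
    moreover have "\<exists>\<xi>\<in>{-1<..<1}. \<exists>r>0. h t - poly ?p t = (deriv ^^ 6) h \<xi> * r"
      if t: "t \<in> {-1..<1}" "t \<notin> T" "t \<notin> lp_nodes" for t
    proof -
      have wt: "poly ?w t = (t + 1) * (t + 1/3) * (t * (t - 1/3))\<^sup>2"
        by (simp add: field_simps eval_nat_numeral)
      have "t > -1/3" "t \<noteq> 0" "t \<noteq> 1/3" using t left by (auto simp: lp_nodes_def)
      then have pos: "poly ?w t > 0" unfolding wt by (intro mult_pos_pos) auto
      have "\<exists>\<xi>\<in>{-1<..<1}. h t - poly ?p t = (deriv ^^ Suc 5) h \<xi> / fact (Suc 5) * poly ?w t"
      proof -
        have W0: "poly ?w s = 0" if "s \<in> {-1, -1/3, 0, 1/3}" for s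
          using W[OF that] by (simp only: poly_mult mult_zero_left)
        have W1: "poly (pderiv ?w) s = 0" if "s \<in> {0, 1/3}" for s
        proof -
          have "poly (pderiv ?w) 0 = 0" "poly (pderiv ?w) (1/3) = 0" by (simp_all add: pderiv_pCons pderiv_mult)
          then show ?thesis using that by (metis empty_iff insert_iff)
        qed
        have nz: "poly ?w t \<noteq> 0" using pos by linarith
        have tn: "t \<notin> {-1, -1/3, 0, 1/3}" using t(3) unfolding lp_nodes_def .
        show ?thesis
          by (rule interpolation_remainder[OF h deg(1), where Z = "{-1, -1/3, 0, 1/3}" and Z\<^sub>2 = "{0, 1/3}"];
              (rule t(1) tn nz | erule nodes | erule ders | erule W0 | erule W1 | simp))
      qed
      then obtain \<xi> where "\<xi> \<in> {-1<..<1}" "h t - poly ?p t = (deriv ^^ 6) h \<xi> * (poly ?w t / fact (Suc 5))"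
        by (auto simp: numeral_eq_Suc)
      then show ?thesis using pos by (metis divide_pos_pos fact_gt_zero)
    qed
    ultimately show thesis
      using nodes c(3-6) unfolding lp_nodes_def[symmetric] by (intro that[of c0 c1 c2 c3 c4 c5 6]) simp_all
  next
    case (other e)
    obtain c0 c1 c2 c3 c4 where c:
      "\<And>t. t \<in> {-1, -1/3, 0, 1/3} \<Longrightarrow> h t = poly (newton_poly c0 c1 c2 c3 c4 0) t"
      "deriv h e = poly (pderiv (newton_poly c0 c1 c2 c3 c4 0)) e"
      "divided_difference h 1 c1" "divided_difference h 2 c2"
      "divided_difference h 3 c3" "divided_difference h 4 c4"
      using newton_interpolation[OF h, of e] other(1) by blast
    have "\<exists>\<xi>\<in>{-1<..<1}. \<exists>r>0. h t - poly (newton_poly c0 c1 c2 c3 c4 0) t = (deriv ^^ 5) h \<xi> * r"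
      if t: "t \<in> {-1..<1}" "t \<notin> T" "t \<notin> lp_nodes" for t
      by (rule newton_remainder[OF h other(1) c(1,2) t(1) _ other(2)[OF t]])
         (use t(3) in \<open>simp_all add: lp_nodes_def\<close>)
    then show thesis
      using c(1,3-6) unfolding lp_nodes_def[symmetric] by (intro that[of c0 c1 c2 c3 c4 0 5]) simp_all
  qed
qed

text \<open>Strict positivity is claimed only up to \<open>a4\<close>: the last coefficient is
  \<open>c5\<close>, which is 0 for the two intervals with one double node.\<close>

lemma lp_interpolant:
  assumes T: "T \<in> {{-1<..<-1/3}, {-1/3<..<0}, {0<..<1/3}}" and h: "absolutely_monotone h"
  obtains a0 a1 a2 a3 a4 a5 where
    "a1 \<ge> 0" "a2 \<ge> 0" "a3 \<ge> 0" "a4 \<ge> 0" "a5 \<ge> 0"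
    "\<And>t. t \<in> lp_nodes \<Longrightarrow> h t = lp_fun a0 a1 a2 a3 a4 a5 t"
    "\<And>t. t \<in> {-1..<1} \<Longrightarrow> t \<notin> T \<Longrightarrow> lp_fun a0 a1 a2 a3 a4 a5 t \<le> h t"
    "\<forall>t\<in>{-1<..<1}. (deriv ^^ 6) h t > 0 \<Longrightarrow> a1 > 0 \<and> a2 > 0 \<and> a3 > 0 \<and> a4 > 0 \<and>
       (\<forall>t\<in>{-1..<1}. t \<notin> T \<longrightarrow> t \<notin> lp_nodes \<longrightarrow> lp_fun a0 a1 a2 a3 a4 a5 t < h t)"
proof -
  obtain c0 c1 c2 c3 c4 c5 k where c:
    "\<And>t. t \<in> lp_nodes \<Longrightarrow> h t = poly (newton_poly c0 c1 c2 c3 c4 c5) t"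
    "divided_difference h 1 c1" "divided_difference h 2 c2"
    "divided_difference h 3 c3" "divided_difference h 4 c4"
    "c5 \<ge> 0" "k \<in> {1..6}"
    "\<And>t. t \<in> {-1..<1} \<Longrightarrow> t \<notin> T \<Longrightarrow> t \<notin> lp_nodes \<Longrightarrow>
       \<exists>\<xi>\<in>{-1<..<1}. \<exists>r>0. h t - poly (newton_poly c0 c1 c2 c3 c4 c5) t = (deriv ^^ k) h \<xi> * r"
    using newton_interpolant[OF T h] by blast
  have nn: "(deriv ^^ j) h \<xi> \<ge> 0" if "j \<ge> 1" "\<xi> \<in> {-1<..<1}" for j \<xi>
    using that h by (simp add: absolutely_monotone_def)
  have ge: "c \<ge> 0" if "divided_difference h j c" "j \<ge> 1" for j c
    using that nn[of j] unfolding divided_difference_def by (metis fact_gt_zero zero_le_mult_iff not_less)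
  have c_ge: "c1 \<ge> 0" "c2 \<ge> 0" "c3 \<ge> 0" "c4 \<ge> 0" using ge[OF c(2)] ge[OF c(3)] ge[OF c(4)] ge[OF c(5)] by simp_all
  let ?a0 = "c0 + c1 + c2 / 3 + (c2 + 4/3 * c3 + (c4 + c5) / 72) / 22"
  let ?a1 = "c1 + 4/3 * c2 + 11/24 * c3 + c4 / 72 + c5 / 576"
  let ?a2 = "c2 + 4/3 * c3 + (c4 + c5) / 72"
  let ?a3 = "c3 + c4 + c5 / 72"
  let ?a4 = "c4 + c5"
  show thesis
  proof (rule that[of ?a1 ?a2 ?a3 ?a4 c5 ?a0])
    show nodes: "h t = lp_fun ?a0 ?a1 ?a2 ?a3 ?a4 c5 t" if "t \<in> lp_nodes" for t
      using c(1)[OF that] unfolding newton_poly_lp_fun .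
    show "lp_fun ?a0 ?a1 ?a2 ?a3 ?a4 c5 t \<le> h t" if t: "t \<in> {-1..<1}" "t \<notin> T" for t
    proof (cases "t \<in> lp_nodes")
      case True
      then show ?thesis using nodes[of t] by simp
    next
      case False
      obtain \<xi> r where r: "\<xi> \<in> {-1<..<1}" "r > 0" "h t - lp_fun ?a0 ?a1 ?a2 ?a3 ?a4 c5 t = (deriv ^^ k) h \<xi> * r"
        using c(8)[OF t False] unfolding newton_poly_lp_fun by blast
      have "(deriv ^^ k) h \<xi> * r \<ge> 0"
        using nn[of k \<xi>] c(7) r(1,2) by simp
      then show ?thesis unfolding r(3)[symmetric] by (simp only: diff_ge_0_iff_ge)
    qed
    assume "\<forall>t\<in>{-1<..<1}. (deriv ^^ 6) h t > 0"
    then have pos: "(deriv ^^ j) h t > 0" if "j \<in> {1..6}" "t \<in> {-1<..<1}" for j t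
      using absolutely_monotone_strict_6[OF h] that by blast
    have gt: "c > 0" if "divided_difference h j c" "j \<in> {1..6}" for j c
      using that pos[of j] unfolding divided_difference_def by (metis fact_gt_zero zero_less_mult_pos)
    have cpos: "c1 > 0" "c2 > 0" "c3 > 0" "c4 > 0" using gt[OF c(2)] gt[OF c(3)] gt[OF c(4)] gt[OF c(5)] by simp_all
    have "?a1 > 0" using cpos c(6) by argo
    moreover have "?a2 > 0" using cpos c(6) by argo
    moreover have "?a3 > 0" using cpos c(6) by argo
    moreover have "?a4 > 0" using cpos c(6) by argo
    moreover have "lp_fun ?a0 ?a1 ?a2 ?a3 ?a4 c5 t < h t"
      if t: "t \<in> {-1..<1}" "t \<notin> T" "t \<notin> lp_nodes" for t
    proof -
      obtain \<xi> r where r: "\<xi> \<in> {-1<..<1}" "r > 0" "h t - lp_fun ?a0 ?a1 ?a2 ?a3 ?a4 c5 t = (deriv ^^ k) h \<xi> * r"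
        using c(8)[OF t] unfolding newton_poly_lp_fun by blast
      have "(deriv ^^ k) h \<xi> * r > 0"
        using pos[of k \<xi>] c(7) r(1,2) by simp
      then show ?thesis unfolding r(3)[symmetric] by (simp only: diff_gt_0_iff_gt)
    qed
    ultimately show "?a1 > 0 \<and> ?a2 > 0 \<and> ?a3 > 0 \<and> ?a4 > 0 \<and>
       (\<forall>t\<in>{-1..<1}. t \<notin> T \<longrightarrow> t \<notin> lp_nodes \<longrightarrow> lp_fun ?a0 ?a1 ?a2 ?a3 ?a4 c5 t < h t)"
      by blast
  next
    show "?a1 \<ge> 0" using c_ge c(6) by argo
    show "?a2 \<ge> 0" using c_ge c(6) by argo
    show "?a3 \<ge> 0" using c_ge c(6) by argo
    show "?a4 \<ge> 0" using c_ge c(6) by argo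
    show "c5 \<ge> 0" by (rule c(6))
  qed
qed

section \<open>Moments of the sphere measure\<close>

lemma borel_measurable_orthogonal:
  fixes f :: "'a::euclidean_space \<Rightarrow> 'a"
  assumes "orthogonal_transformation f"
  shows "f \<in> borel_measurable borel"
  using orthogonal_transformation_linear[OF assms]
  by (intro borel_measurable_continuous_onI linear_continuous_on) (simp add: linear_conv_bounded_linear)

text \<open>It is enough to compare boxes, and the preimage of a box is its image under the
  orthogonal map \<open>inv f\<close>, which preserves Lebesgue measure.\<close>

lemma lborel_orthogonal_invariant:
  fixes f :: "real ^ 'n::{finite,wellorder} \<Rightarrow> real ^ 'n::_"
  assumes "orthogonal_transformation f"
  shows "distr lborel borel f = lborel"
proof (rule lborel_eqI[symmetric])
  fix l u :: "real ^ 'n::_"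
  assume lu: "\<And>b. b \<in> Basis \<Longrightarrow> l \<bullet> b \<le> u \<bullet> b"
  have inv: "orthogonal_transformation (inv f)" by (rule orthogonal_transformation_inv[OF assms])
  note meas = borel_measurable_orthogonal[OF assms]
  have vimage: "f -` box l u = inv f ` box l u"
    by (rule bij_vimage_eq_inv_image[OF orthogonal_transformation_bij[OF assms]])
  have "f -` box l u \<in> sets borel" using measurable_sets[OF meas, of "box l u"] by simp
  then have "emeasure (distr lborel borel f) (box l u) = emeasure lebesgue (f -` box l u)"
    using meas by (simp add: emeasure_distr emeasure_completion)
  also have "\<dots> = emeasure lebesgue (inv f ` box l u)" unfolding vimage ..
  also have "\<dots> = ennreal (measure lebesgue (inv f ` box l u))"
    by (rule emeasure_eq_measure2[OF measurable_orthogonal_image[OF inv lmeasurable_box]])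
  also have "\<dots> = ennreal (measure lebesgue (box l u))"
    by (simp add: measure_orthogonal_image[OF inv lmeasurable_box])
  also have "\<dots> = emeasure lborel (box l u)"
    using emeasure_eq_measure2[OF lmeasurable_box, of l u] by simp
  finally show "emeasure (distr lborel borel f) (box l u) = ennreal (\<Prod>b\<in>Basis. (u - l) \<bullet> b)"
    using lu by (simp add: emeasure_lborel_box)
qed simp

lemma unit_ball_emeasure:
  "emeasure lborel (ball 0 1 :: (real ^ 'n) set) \<noteq> 0" "emeasure lborel (ball 0 1 :: (real ^ 'n) set) \<noteq> \<infinity>"
proof -
  show "emeasure lborel (ball 0 1 :: (real ^ 'n) set) \<noteq> 0"
    using content_ball_pos[of 1 "0 :: real ^ 'n"] by (auto simp: measure_def)
  show "emeasure lborel (ball 0 1 :: (real ^ 'n) set) \<noteq> \<infinity>"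
    using emeasure_lborel_ball_finite[of "0 :: real ^ 'n" 1] by auto
qed

lemma radial_measurable [measurable]: "(\<lambda>x :: real ^ 'n. x /\<^sub>R norm x) \<in> borel_measurable borel"
  by measurable

abbreviation ball_measure :: "(real ^ 'n) measure" where
  "ball_measure \<equiv> uniform_measure lborel (ball 0 1)"

lemma radial_measurable_ball: "(\<lambda>x :: real ^ 'n. x /\<^sub>R norm x) \<in> measurable ball_measure borel"
  by (subst measurable_cong_sets[of _ borel _ borel]) auto

lemma emeasure_ball_measure: "emeasure (ball_measure :: (real ^ 'n) measure) UNIV = 1"
  using emeasure_uniform_measure_1[OF unit_ball_emeasure[where 'n = 'n]] by simp

lemma finite_ball_measure: "finite_measure (ball_measure :: (real ^ 'n) measure)"
  by (rule finite_measureI) (simp del: emeasure_uniform_measure add: emeasure_ball_measure)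

lemma sets_sphere_measure [simp]: "sets sphere_measure = sets borel"
  by (simp add: sphere_measure_def)

lemma space_sphere_measure [simp]: "space sphere_measure = UNIV"
  by (simp add: sphere_measure_def)

lemma measurable_sphere_measure [simp]: "measurable sphere_measure M = measurable borel M"
  by (rule measurable_cong_sets) auto

lemma measure_sphere_measure: "measure (sphere_measure :: (real ^ 'n) measure) UNIV = 1"
proof -
  have "emeasure (sphere_measure :: (real ^ 'n) measure) UNIV = 1"
    unfolding sphere_measure_def
    by (subst emeasure_distr[OF radial_measurable_ball]) (simp_all del: emeasure_uniform_measure add: emeasure_ball_measure)
  then show ?thesis by (simp add: measure_def)
qed

text \<open>The ball is invariant under \<open>f\<close>, and the radial projection commutes with
  \<open>f\<close>.\<close>

lemma sphere_measure_orthogonal_invariant: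
  fixes f :: "real ^ 'n::{finite,wellorder} \<Rightarrow> real ^ 'n::_"
  assumes f: "orthogonal_transformation f"
  shows "distr sphere_measure borel f = sphere_measure"
proof -
  note meas = borel_measurable_orthogonal[OF f]
  have ball: "distr ball_measure borel f = ball_measure"
  proof (rule measure_eqI)
    fix A assume "A \<in> sets (distr ball_measure borel f)"
    then have A: "A \<in> sets borel" by simp
    have fA: "f -` A \<in> sets borel" using measurable_sets[OF meas A] by simp
    have pre: "f -` (ball 0 1 \<inter> A) = ball 0 1 \<inter> f -` A"
      using orthogonal_transformation_norm[OF f] by auto
    have "emeasure (distr ball_measure borel f) A = emeasure ball_measure (f -` A)"
      using A meas by (subst emeasure_distr) auto
    also have "\<dots> = emeasure lborel (f -` (ball 0 1 \<inter> A)) / emeasure lborel (ball 0 1 :: (real ^ 'n::_) set)"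
      unfolding pre using fA by (subst emeasure_uniform_measure) simp_all
    also have "emeasure lborel (f -` (ball 0 1 \<inter> A)) = emeasure (distr lborel borel f) (ball 0 1 \<inter> A)"
      using A meas by (subst emeasure_distr) auto
    also have "\<dots> = emeasure lborel (ball 0 1 \<inter> A)"
      by (simp add: lborel_orthogonal_invariant[OF f])
    finally show "emeasure (distr ball_measure borel f) A = emeasure ball_measure A"
      using A by simp
  qed simp
  have comm: "f (x /\<^sub>R norm x) = f x /\<^sub>R norm (f x)" for x
    using orthogonal_transformation_norm[OF f] orthogonal_transformation_linear[OF f] by (simp add: linear_cmul)
  have "distr sphere_measure borel f = distr ball_measure borel (f \<circ> (\<lambda>x. x /\<^sub>R norm x))"
    unfolding sphere_measure_def by (rule distr_distr[OF meas radial_measurable_ball])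
  also have "\<dots> = distr ball_measure borel ((\<lambda>x. x /\<^sub>R norm x) \<circ> f)"
    by (simp add: comp_def comm)
  also have "\<dots> = distr (distr ball_measure borel f) borel (\<lambda>x. x /\<^sub>R norm x)"
    by (rule distr_distr[symmetric, OF radial_measurable]) (use meas in \<open>simp cong: measurable_cong_sets\<close>)
  also have "\<dots> = sphere_measure" unfolding ball sphere_measure_def ..
  finally show ?thesis .
qed

lemma sphere_integrable:
  fixes p :: "real ^ 'n \<Rightarrow> real"
  assumes "continuous_on UNIV p"
  shows "integrable sphere_measure p"
proof -
  have meas: "p \<in> borel_measurable borel" by (rule borel_measurable_continuous_onI[OF assms])
  have "compact (p ` cball 0 1)"
    by (intro compact_continuous_image compact_cball continuous_on_subset[OF assms]) simp
  then obtain B where B: "\<And>x. x \<in> cball 0 1 \<Longrightarrow> norm (p x) \<le> B"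
    using compact_imp_bounded[of "p ` cball 0 1"] unfolding bounded_iff by blast
  interpret finite_measure "ball_measure :: (real ^ 'n) measure" by (rule finite_ball_measure)
  have "integrable ball_measure (\<lambda>x. p (x /\<^sub>R norm x))"
  proof (rule integrable_const_bound)
    \<comment> \<open>The bound is taken on the whole closed ball because the projection sends the
      centre to 0.\<close>
    show "AE x in ball_measure. norm (p (x /\<^sub>R norm x)) \<le> B"
    proof (intro always_eventually allI B)
      show "x /\<^sub>R norm x \<in> cball 0 1" for x :: "real ^ 'n" by (cases "x = 0") auto
    qed
    show "(\<lambda>x. p (x /\<^sub>R norm x)) \<in> borel_measurable ball_measure"
      using measurable_compose[OF radial_measurable_ball meas] by simp
  qed
  then show ?thesis
    unfolding sphere_measure_def using meas by (simp add: integrable_distr_eq[OF radial_measurable_ball])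
qed

lemma AE_sphere_measure_norm: "AE x in sphere_measure. norm x = 1"
proof -
  have "AE x in lborel. x \<noteq> (0 :: real ^ 'n)" by (rule AE_lborel_singleton)
  then have "AE x in ball_measure. norm (x /\<^sub>R norm x :: real ^ 'n) = 1"
    by (intro AE_uniform_measureI) (auto elim!: eventually_mono)
  then show ?thesis
    unfolding sphere_measure_def by (subst AE_distr_iff[OF radial_measurable_ball]) auto
qed

lemma sphere_integral_invariant:
  fixes p :: "real ^ 'n::{finite,wellorder} \<Rightarrow> real" and f :: "real ^ 'n::_ \<Rightarrow> real ^ 'n::_"
  assumes "continuous_on UNIV p" "orthogonal_transformation f"
  shows "(\<integral>x. p (f x) \<partial>sphere_measure) = (\<integral>x. p x \<partial>sphere_measure)"
proof -
  have "(\<integral>x. p x \<partial>distr sphere_measure borel f) = (\<integral>x. p (f x) \<partial>sphere_measure)"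
    using borel_measurable_continuous_onI[OF assms(1)] borel_measurable_orthogonal[OF assms(2)]
    by (intro integral_distr) simp_all
  then show ?thesis by (simp add: sphere_measure_orthogonal_invariant[OF assms(2)])
qed

lemma sphere_integral_odd:
  fixes p :: "real ^ 'n::{finite,wellorder} \<Rightarrow> real" and f :: "real ^ 'n::_ \<Rightarrow> real ^ 'n::_"
  assumes "continuous_on UNIV p" "orthogonal_transformation f" "\<And>x. p (f x) = - p x"
  shows "(\<integral>x. p x \<partial>sphere_measure) = 0"
  using sphere_integral_invariant[OF assms(1,2)] by (simp add: assms(3))

section \<open>Monomial moments up to degree 5\<close>

definition monom_at :: "'n list \<Rightarrow> real ^ 'n \<Rightarrow> real" where
  "monom_at xs x = prod_list (map (\<lambda>i. x $ i) xs)"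

lemma monom_at_simps [simp]: "monom_at [] x = 1" "monom_at (i # xs) x = x $ i * monom_at xs x"
  by (simp_all add: monom_at_def)

lemma continuous_monom_at: "continuous_on UNIV (monom_at xs)"
proof -
  have "continuous_on UNIV (\<lambda>x. monom_at xs x)"
    by (induction xs) (auto intro!: continuous_intros)
  then show ?thesis by simp
qed

definition sphere_moment :: "'n::finite list \<Rightarrow> real" where
  "sphere_moment xs = (\<integral>x. monom_at xs x \<partial>sphere_measure)"

definition coord_flip :: "'n \<Rightarrow> real ^ 'n \<Rightarrow> real ^ 'n" where
  "coord_flip m x = (\<chi> i. (if i = m then - 1 else 1) * x $ i)"

definition coord_swap :: "'n \<Rightarrow> 'n \<Rightarrow> real ^ 'n \<Rightarrow> real ^ 'n" where
  "coord_swap i j x = (\<chi> k. x $ (if k = i then j else if k = j then i else k))"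

text \<open>For distinct \<open>i\<close>, \<open>j\<close> a reflection of their coordinate plane.
  Sign changes and permutations alone cannot relate the moments of \<open>x_i^4\<close> and
  \<open>x_i^2 x_j^2\<close>.\<close>

definition coord_mix :: "'n \<Rightarrow> 'n \<Rightarrow> real ^ 'n \<Rightarrow> real ^ 'n" where
  "coord_mix i j x = (\<chi> k. if k = i then (x $ i + x $ j) / sqrt 2
      else if k = j then (x $ i - x $ j) / sqrt 2 else x $ k)"

lemma orthogonal_transformationI_sum:
  fixes f :: "real ^ 'n \<Rightarrow> real ^ 'n"
  assumes "linear f" "\<And>x. (\<Sum>k\<in>UNIV. (f x $ k)\<^sup>2) = (\<Sum>k\<in>UNIV. (x $ k)\<^sup>2)"
  shows "orthogonal_transformation f"
  using assms by (simp add: orthogonal_transformation norm_vec_def L2_set_def)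

lemma orthogonal_coord_flip: "orthogonal_transformation (coord_flip m)"
  by (rule orthogonal_transformationI_sum)
     (auto simp: coord_flip_def vec_eq_iff algebra_simps power_mult_distrib intro!: linearI sum.cong)

lemma orthogonal_coord_swap: "orthogonal_transformation (coord_swap i j)"
proof (rule orthogonal_transformationI_sum)
  fix x :: "real ^ 'a"
  let ?\<tau> = "\<lambda>k. if k = i then j else if k = j then i else k"
  have "(\<Sum>k\<in>UNIV. (x $ ?\<tau> k)\<^sup>2) = (\<Sum>k\<in>UNIV. (x $ k)\<^sup>2)"
    by (rule sum.reindex_bij_witness[where i = ?\<tau> and j = ?\<tau>]) auto
  then show "(\<Sum>k\<in>UNIV. (coord_swap i j x $ k)\<^sup>2) = (\<Sum>k\<in>UNIV. (x $ k)\<^sup>2)"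
    by (simp add: coord_swap_def)
qed (auto simp: coord_swap_def vec_eq_iff intro!: linearI)

lemma orthogonal_coord_mix:
  assumes "i \<noteq> j"
  shows "orthogonal_transformation (coord_mix i j)"
proof (rule orthogonal_transformationI_sum)
  fix x :: "real ^ 'a"
  have "(\<Sum>k\<in>UNIV. (coord_mix i j x $ k)\<^sup>2 - (x $ k)\<^sup>2) = (\<Sum>k\<in>{i, j}. (coord_mix i j x $ k)\<^sup>2 - (x $ k)\<^sup>2)"
    by (rule sum.mono_neutral_right) (auto simp: coord_mix_def)
  also have "\<dots> = 0"
    using assms by (simp add: coord_mix_def power_divide field_simps power2_eq_square)
  finally show "(\<Sum>k\<in>UNIV. (coord_mix i j x $ k)\<^sup>2) = (\<Sum>k\<in>UNIV. (x $ k)\<^sup>2)"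
    by (simp add: sum_subtractf)
qed (auto simp: coord_mix_def vec_eq_iff algebra_simps add_divide_distrib diff_divide_distrib intro!: linearI)

lemma sphere_moment_Nil: "sphere_moment [] = 1"
  by (simp add: sphere_moment_def measure_sphere_measure)

lemma sphere_moment_odd_length:
  fixes xs :: "'n::{finite,wellorder} list"
  assumes "odd (length xs)"
  shows "sphere_moment xs = 0"
  unfolding sphere_moment_def
proof (rule sphere_integral_odd[OF continuous_monom_at])
  show "orthogonal_transformation (uminus :: real ^ 'n::_ \<Rightarrow> _)"
    by (simp add: orthogonal_transformation_def linear_uminus)
  have "monom_at ys (- x) = (- 1) ^ length ys * monom_at ys x" for ys and x :: "real ^ 'n::_"
    by (induction ys) simp_all
  then show "monom_at xs (- x) = - monom_at xs x" for x :: "real ^ 'n::_" using assms by simp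
qed

lemma sphere_moment_odd_index:
  fixes xs :: "'n::{finite,wellorder} list"
  assumes "odd (count_list xs m)"
  shows "sphere_moment xs = 0"
  unfolding sphere_moment_def
proof (rule sphere_integral_odd[OF continuous_monom_at orthogonal_coord_flip[of m]])
  have "monom_at ys (coord_flip m x) = (- 1) ^ count_list ys m * monom_at ys x" for ys and x :: "real ^ 'n::_"
    by (induction ys) (simp_all add: coord_flip_def)
  then show "monom_at xs (coord_flip m x) = - monom_at xs x" for x :: "real ^ 'n::_" using assms by simp
qed

lemma sphere_moment_swap:
  fixes xs :: "'n::{finite,wellorder} list"
  shows "sphere_moment (map (\<lambda>k. if k = i then j else if k = j then i else k) xs) = sphere_moment xs"
proof -
  have "monom_at xs (coord_swap i j x) = monom_at (map (\<lambda>k. if k = i then j else if k = j then i else k) xs) x" for x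
    by (induction xs) (simp_all add: coord_swap_def)
  then show ?thesis
    using sphere_integral_invariant[OF continuous_monom_at orthogonal_coord_swap, of xs i j]
    by (simp add: sphere_moment_def)
qed

lemma sphere_integral_eq_1:
  assumes "\<And>x. norm x = 1 \<Longrightarrow> p x = 1" and cont: "continuous_on UNIV p"
  shows "(\<integral>x. p x \<partial>(sphere_measure :: (real ^ 'n) measure)) = (1 :: real)"
proof -
  have "(\<integral>x. p x \<partial>(sphere_measure :: (real ^ 'n) measure)) = (\<integral>x. 1 \<partial>(sphere_measure :: (real ^ 'n) measure))"
    using AE_sphere_measure_norm borel_measurable_continuous_onI[OF cont]
    by (intro integral_cong_AE) (auto elim!: eventually_mono simp: assms)
  then show ?thesis by (simp add: measure_sphere_measure)
qed

lemma sphere_moment_2: "sphere_moment [i, j] = kron i j / CARD('n)" for i j :: "'n::{finite,wellorder}"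
proof (cases "i = j")
  case True
  have eq: "sphere_moment [k, k] = sphere_moment [i, i]" for k :: 'n
    using sphere_moment_swap[of i k "[i, i]"] by simp
  have "(\<Sum>k\<in>(UNIV :: 'n set). sphere_moment [k, k]) = (\<integral>x. (\<Sum>k\<in>UNIV. monom_at [k, k] x) \<partial>(sphere_measure :: (real ^ 'n::_) measure))"
    unfolding sphere_moment_def
    by (rule Bochner_Integration.integral_sum[symmetric]) (intro sphere_integrable continuous_monom_at)
  also have "\<dots> = 1"
    by (rule sphere_integral_eq_1)
       (auto simp: norm_eq_1 inner_vec_def intro!: continuous_intros)
  finally have total: "(\<Sum>k\<in>(UNIV :: 'n set). sphere_moment [k, k]) = 1" .
  have "(\<Sum>k\<in>(UNIV :: 'n set). sphere_moment [k, k]) = (\<Sum>k\<in>(UNIV :: 'n set). sphere_moment [i, i])"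
    by (intro sum.cong refl eq)
  then show ?thesis using total True by (simp add: kron_def field_simps)
next
  case False
  then show ?thesis using sphere_moment_odd_index[of "[i, j]" i] by (simp add: kron_def)
qed

text \<open>Invariance under \<open>coord_mix\<close> makes the pure fourth moment three times the
  mixed one. The square of \<open>\<Sum> x_k^2 = 1\<close> has integral 1 and fixes the
  scale.\<close>

lemma sphere_moment_iiii_iijj:
  fixes i j :: "'n::{finite,wellorder}"
  shows "sphere_moment [i, i, i, i] = 3 / (CARD('n) * (CARD('n) + 2))"
    and "i \<noteq> j \<Longrightarrow> sphere_moment [i, i, j, j] = 1 / (CARD('n) * (CARD('n) + 2))"
proof -
  have eq: "sphere_moment [k, k, k, k] = sphere_moment [i, i, i, i]" for k :: 'n
    using sphere_moment_swap[of i k "[i, i, i, i]"] by simp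
  have third: "sphere_moment [k, k, l, l] = sphere_moment [i, i, i, i] / 3" if kl: "k \<noteq> l" for k l :: 'n
  proof -
    have "monom_at [k, k, k, k] (coord_mix k l x) = 1/4 * monom_at [k, k, k, k] x + monom_at [k, k, k, l] x
       + 3/2 * monom_at [k, k, l, l] x + monom_at [k, l, l, l] x + 1/4 * monom_at [l, l, l, l] x" for x
    proof -
      have "sqrt 2 * (sqrt 2 * (sqrt 2 * sqrt 2)) = 4" by (simp flip: mult.assoc)
      then show ?thesis by (simp add: coord_mix_def) (simp add: field_simps)
    qed
    then have "sphere_moment [k, k, k, k] = (\<integral>x. 1/4 * monom_at [k, k, k, k] x + monom_at [k, k, k, l] x
       + 3/2 * monom_at [k, k, l, l] x + monom_at [k, l, l, l] x + 1/4 * monom_at [l, l, l, l] x \<partial>sphere_measure)"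
      using sphere_integral_invariant[OF continuous_monom_at orthogonal_coord_mix[OF kl], of "[k, k, k, k]"]
      unfolding sphere_moment_def by (simp only:)
    also have "\<dots> = 1/4 * sphere_moment [k, k, k, k] + sphere_moment [k, k, k, l]
       + 3/2 * sphere_moment [k, k, l, l] + sphere_moment [k, l, l, l] + 1/4 * sphere_moment [l, l, l, l]"
      unfolding sphere_moment_def
      by (simp only: Bochner_Integration.integral_add Bochner_Integration.integrable_add integrable_mult_right
          integral_mult_right_zero sphere_integrable[OF continuous_monom_at])
    finally show ?thesis
      using sphere_moment_odd_index[of "[k, k, k, l]" l] sphere_moment_odd_index[of "[k, l, l, l]" k] kl
        eq[of k] eq[of l] by simp
  qed
  have "(\<Sum>k\<in>(UNIV :: 'n set). \<Sum>l\<in>UNIV. sphere_moment [k, k, l, l]) =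
      (\<integral>x. (\<Sum>k\<in>UNIV. \<Sum>l\<in>UNIV. monom_at [k, k, l, l] x) \<partial>(sphere_measure :: (real ^ 'n::_) measure))"
    unfolding sphere_moment_def
    by (subst Bochner_Integration.integral_sum Bochner_Integration.integral_sum,
        intro Bochner_Integration.integrable_sum sphere_integrable continuous_monom_at,
        intro sum.cong refl, rule Bochner_Integration.integral_sum[symmetric],
        intro sphere_integrable continuous_monom_at)
  also have "\<dots> = 1"
  proof (rule sphere_integral_eq_1)
    fix x :: "real ^ 'n::_" assume "norm x = 1"
    then have "(\<Sum>k\<in>UNIV. x $ k * x $ k) = 1" by (simp add: norm_eq_1 inner_vec_def)
    moreover have "(\<Sum>k\<in>UNIV. \<Sum>l\<in>UNIV. monom_at [k, k, l, l] x) = (\<Sum>k\<in>UNIV. x $ k * x $ k) * (\<Sum>k\<in>UNIV. x $ k * x $ k)"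
      by (simp add: sum_product mult_ac)
    ultimately show "(\<Sum>k\<in>UNIV. \<Sum>l\<in>UNIV. monom_at [k, k, l, l] x) = 1" by simp
  qed (auto intro!: continuous_intros)
  finally have total: "(\<Sum>k\<in>UNIV. \<Sum>l\<in>UNIV. sphere_moment [k, k, l, l :: 'n]) = 1" .
  define a where "a = sphere_moment [i, i, i, i]"
  have "sphere_moment [k, k, l, l] = a / 3 + kron k l * (2 * a / 3)" for k l :: 'n
    using third[of k l] eq[of k] by (cases "k = l") (simp_all add: kron_def a_def)
  then have "(\<Sum>k\<in>(UNIV :: 'n set). \<Sum>l\<in>(UNIV :: 'n set). a / 3 + kron k l * (2 * a / 3)) = 1"
    using total by simp
  then have "CARD('n) * (CARD('n) * (a / 3)) + CARD('n) * (2 * a / 3) = 1"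
    by (simp only: sum.distrib sum_kron) simp
  then have mult: "a * (real CARD('n) * (real CARD('n) + 2)) = 3"
    by (simp add: field_simps)
  have nz: "real CARD('n) * (real CARD('n) + 2) \<noteq> 0"
    by (intro no_zero_divisors) simp_all
  have "a = 3 / (real CARD('n) * (real CARD('n) + 2))"
    unfolding nonzero_eq_divide_eq[OF nz] by (rule mult)
  then have a: "a = 3 / (CARD('n) * (CARD('n) + 2))" by (simp add: algebra_simps)
  show "sphere_moment [i, i, i, i] = 3 / (CARD('n) * (CARD('n) + 2))" using a by (simp add: a_def)
  show "i \<noteq> j \<Longrightarrow> sphere_moment [i, i, j, j] = 1 / (CARD('n) * (CARD('n) + 2))"
  proof -
    assume "i \<noteq> j"
    then have "sphere_moment [i, i, j, j] = a / 3" unfolding a_def by (rule third)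
    moreover have "3 / b / 3 = 1 / b" for b :: real by simp
    ultimately show ?thesis unfolding a by (simp only:)
  qed
qed

lemma sphere_moment_mset: "mset xs = mset ys \<Longrightarrow> sphere_moment xs = sphere_moment ys"
  by (simp add: sphere_moment_def monom_at_def flip: prod_mset_prod_list)

text \<open>Unless the four indices match in pairs, some index occurs an odd number of times and a
  sign change makes the moment vanish.\<close>

lemma sphere_moment_4:
  fixes i j k l :: "'n::{finite,wellorder}"
  shows "sphere_moment [i, j, k, l] =
    (kron i j * kron k l + kron i k * kron j l + kron i l * kron j k) / (CARD('n) * (CARD('n) + 2))"
proof -
  have unpaired: "\<exists>m\<in>{i, j, k, l}. odd (count_list [i, j, k, l] m)"
    if "\<not> (i = j \<and> k = l \<or> i = k \<and> j = l \<or> i = l \<and> j = k)"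
    using that by (cases "i = j"; cases "i = k"; cases "i = l"; cases "j = k"; cases "j = l"; cases "k = l") auto
  consider "i = j" "k = l" "i = k" | "i = j" "k = l" "i \<noteq> k" | "i = k" "j = l" "i \<noteq> j" | "i = l" "j = k" "i \<noteq> j"
    | m where "odd (count_list [i, j, k, l] m)" "\<not> (i = j \<and> k = l \<or> i = k \<and> j = l \<or> i = l \<and> j = k)"
    using unpaired by blast
  then show ?thesis
  proof cases
    case 3
    then have "sphere_moment [i, j, k, l] = sphere_moment [i, i, j, j]" by (intro sphere_moment_mset) simp
    then show ?thesis using 3 by (simp add: sphere_moment_iiii_iijj kron_def)
  next
    case 4
    then have "sphere_moment [i, j, k, l] = sphere_moment [i, i, j, j]" by (intro sphere_moment_mset) simp
    then show ?thesis using 4 by (simp add: sphere_moment_iiii_iijj kron_def)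
  next
    case 5
    show ?thesis using sphere_moment_odd_index[OF 5(1)] 5(2) by (auto simp: kron_def)
  qed (simp_all add: sphere_moment_iiii_iijj kron_def)
qed

text \<open>The recursion expresses that the mean of \<open>harm3 i j k\<close> times a monomial of degree at most 2 vanishes.\<close>

definition spherical_moments :: "('n::finite list \<Rightarrow> real) \<Rightarrow> bool" where
  "spherical_moments E \<longleftrightarrow> E [] = 1 \<and> (\<forall>i. E [i] = 0) \<and> (\<forall>i j. E [i, j] = kron i j / CARD('n)) \<and>
     (\<forall>i j k ys. length ys \<le> 2 \<longrightarrow>
        E (i # j # k # ys) = (kron i j * E (k # ys) + kron i k * E (j # ys) + kron j k * E (i # ys)) / (CARD('n) + 2))"

text \<open>The recursion shortens the list by two. Lists \<open>ys\<close> of length at most 2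
  reach total degree 5.\<close>

lemma spherical_moments_unique:
  assumes "spherical_moments E" "spherical_moments E'" "length xs \<le> 5"
  shows "E xs = E' xs"
  using assms(3)
proof (induction "length xs" arbitrary: xs rule: less_induct)
  case less
  consider "xs = []" | i where "xs = [i]" | i j where "xs = [i, j]" | i j k ys where "xs = i # j # k # ys"
    by (metis list.exhaust)
  then show ?case
  proof cases
    case (4 i j k ys)
    then have "length ys \<le> 2" using less.prems by simp
    moreover have "E (m # ys) = E' (m # ys)" for m using less 4 by simp
    ultimately show ?thesis using assms(1,2) 4 by (simp add: spherical_moments_def)
  qed (use assms(1,2) in \<open>auto simp: spherical_moments_def\<close>)
qed

text \<open>By parity both sides vanish unless \<open>ys\<close> has length 1, where the formulas
  for degrees 2 and 4 apply.\<close>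

lemma spherical_moments_sphere: "spherical_moments (sphere_moment :: 'n::{finite,wellorder} list \<Rightarrow> real)"
  unfolding spherical_moments_def
proof (intro conjI allI impI)
  fix i j k :: 'n and ys :: "'n list" assume len: "length ys \<le> 2"
  show "sphere_moment (i # j # k # ys) = (kron i j * sphere_moment (k # ys) +
      kron i k * sphere_moment (j # ys) + kron j k * sphere_moment (i # ys)) / (CARD('n) + 2)"
  proof (cases "even (length ys)")
    case True
    then show ?thesis by (simp add: sphere_moment_odd_length)
  next
    case False
    then obtain l where "ys = [l]" using len by (cases ys; cases "tl ys") auto
    then show ?thesis by (simp add: sphere_moment_2 sphere_moment_4 field_simps)
  qed
qed (simp_all add: sphere_moment_Nil sphere_moment_odd_length sphere_moment_2)

lemma monomial_list:
  fixes \<alpha> :: "'n::finite \<Rightarrow> nat"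
  shows "\<exists>xs. length xs = (\<Sum>i\<in>UNIV. \<alpha> i) \<and> (\<forall>x :: real ^ 'n. (\<Prod>i\<in>UNIV. (x $ i) ^ \<alpha> i) = monom_at xs x)"
proof (induction "\<Sum>i\<in>UNIV. \<alpha> i" arbitrary: \<alpha>)
  case 0
  then show ?case by (intro exI[of _ "[]"]) simp
next
  case (Suc d)
  then obtain m where m: "\<alpha> m > 0" by (metis gr0I less_numeral_extra(3) sum.neutral zero_less_Suc)
  define \<beta> where "\<beta> = \<alpha>(m := \<alpha> m - 1)"
  have \<alpha>: "\<alpha> i = \<beta> i + (if i = m then 1 else 0)" for i using m by (simp add: \<beta>_def)
  have "(\<Sum>i\<in>UNIV. \<alpha> i) = (\<Sum>i\<in>UNIV. \<beta> i) + 1" unfolding \<alpha> by (simp add: sum.distrib)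
  then have "d = (\<Sum>i\<in>UNIV. \<beta> i)" using Suc(2) by simp
  then obtain xs where xs: "length xs = (\<Sum>i\<in>UNIV. \<beta> i)" "\<And>x :: real ^ 'n. (\<Prod>i\<in>UNIV. (x $ i) ^ \<beta> i) = monom_at xs x"
    using Suc(1) by blast
  have "(\<Prod>i\<in>UNIV. (x $ i) ^ \<alpha> i) = x $ m * (\<Prod>i\<in>UNIV. (x $ i) ^ \<beta> i)" for x :: "real ^ 'n"
  proof -
    have "(x $ i) ^ \<alpha> i = (x $ i) ^ \<beta> i * (if i = m then x $ m else 1)" for i
      unfolding \<alpha> by (simp add: power_add)
    then show ?thesis by (simp add: prod.distrib mult.commute)
  qed
  then have "(\<Prod>i\<in>UNIV. (x $ i) ^ \<alpha> i) = monom_at (m # xs) x" for x :: "real ^ 'n" using xs(2) by simp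
  moreover have "length (m # xs) = (\<Sum>i\<in>UNIV. \<alpha> i)"
    using xs(1) \<open>(\<Sum>i\<in>UNIV. \<alpha> i) = (\<Sum>i\<in>UNIV. \<beta> i) + 1\<close> by simp
  ultimately show ?case by blast
qed

lemma spherical_design_5I:
  fixes C :: "(real ^ 'n::{finite,wellorder}) set"
  assumes C: "spherical_code C" and E: "spherical_moments (\<lambda>xs. (\<Sum>x\<in>C. monom_at xs x) / card C)"
  shows "spherical_design 5 C"
  unfolding spherical_design_def
proof (intro conjI C allI impI)
  fix p :: "real ^ 'n::_ \<Rightarrow> real" assume "polynomial_of_degree_le 5 p"
  then obtain A c where A: "finite A" "\<And>\<alpha>. \<alpha> \<in> A \<Longrightarrow> (\<Sum>i\<in>UNIV. \<alpha> i) \<le> 5"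
    "p = (\<lambda>x. \<Sum>\<alpha>\<in>A. c \<alpha> * (\<Prod>i\<in>UNIV. (x $ i) ^ \<alpha> i))"
    unfolding polynomial_of_degree_le_def by blast
  obtain L where L: "\<And>\<alpha>. length (L \<alpha>) = (\<Sum>i\<in>UNIV. \<alpha> i)"
    "\<And>\<alpha> x. (\<Prod>i\<in>UNIV. (x $ i) ^ \<alpha> i) = monom_at (L \<alpha>) (x :: real ^ 'n::_)"
    using monomial_list[where 'n = 'n] by metis
  have p: "p = (\<lambda>x. \<Sum>\<alpha>\<in>A. c \<alpha> * monom_at (L \<alpha>) x)" using A(3) L(2) by simp
  have "(\<Sum>x\<in>C. p x) / card C = (\<Sum>\<alpha>\<in>A. c \<alpha> * ((\<Sum>x\<in>C. monom_at (L \<alpha>) x) / card C))"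
    unfolding p by (subst sum.swap) (simp add: sum_distrib_left sum_divide_distrib)
  also have "\<dots> = (\<Sum>\<alpha>\<in>A. c \<alpha> * sphere_moment (L \<alpha>))"
    using spherical_moments_unique[OF E spherical_moments_sphere] A(2) L(1) by simp
  also have "\<dots> = (\<integral>x. p x \<partial>sphere_measure)"
    unfolding p sphere_moment_def
    by (subst Bochner_Integration.integral_sum) (auto intro!: sphere_integrable continuous_intros continuous_monom_at
        simp: continuous_on_mult_left[OF continuous_monom_at])
  finally show "(\<Sum>x\<in>C. p x) / real (card C) = (\<integral>x. p x \<partial>sphere_measure)" .
qed

section \<open>The linear programming bound and its equality case\<close>

lemma gegen3_22: "gegen3 TYPE(22) t = t ^ 3 - t / 8"
  by (simp add: gegen3_def)

abbreviation kernel_sum1 :: "(real ^ 22) set \<Rightarrow> real" where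
  "kernel_sum1 C \<equiv> (\<Sum>x\<in>C. \<Sum>y\<in>C. x \<bullet> y)"

abbreviation kernel_sum2 :: "(real ^ 22) set \<Rightarrow> real" where
  "kernel_sum2 C \<equiv> (\<Sum>x\<in>C. \<Sum>y\<in>C. (x \<bullet> y)\<^sup>2 - 1 / CARD(22))"

abbreviation kernel_sum3 :: "(real ^ 22) set \<Rightarrow> real" where
  "kernel_sum3 C \<equiv> (\<Sum>x\<in>C. \<Sum>y\<in>C. gegen3 TYPE(22) (x \<bullet> y))"

abbreviation kernel_sum4 :: "(real ^ 22) set \<Rightarrow> real" where
  "kernel_sum4 C \<equiv> (\<Sum>x\<in>C. \<Sum>y\<in>C. (x \<bullet> y) * gegen3 TYPE(22) (x \<bullet> y))"

abbreviation kernel_sum5 :: "(real ^ 22) set \<Rightarrow> real" where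
  "kernel_sum5 C \<equiv> (\<Sum>x\<in>C. \<Sum>y\<in>C. (x \<bullet> y)\<^sup>2 * gegen3 TYPE(22) (x \<bullet> y))"

lemma lp_sum:
  fixes C :: "(real ^ 22) set"
  shows "(\<Sum>x\<in>C. \<Sum>y\<in>C. lp_fun a0 a1 a2 a3 a4 a5 (x \<bullet> y)) = (real (card C))\<^sup>2 * a0
    + a1 * kernel_sum1 C + a2 * kernel_sum2 C
    + a3 * kernel_sum3 C
    + a4 * kernel_sum4 C
    + a5 * kernel_sum5 C"
proof -
  have "lp_fun a0 a1 a2 a3 a4 a5 t = a0 + a1 * t + a2 * (t\<^sup>2 - 1 / CARD(22)) + a3 * gegen3 TYPE(22) t
     + a4 * (t * gegen3 TYPE(22) t) + a5 * (t\<^sup>2 * gegen3 TYPE(22) t)" for t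
    unfolding lp_fun_def gegen3_22 by (simp add: algebra_simps eval_nat_numeral)
  then show ?thesis
    by (simp only: sum.distrib sum_distrib_left[symmetric] sum_constant) (simp add: power2_eq_square)
qed

lemma lp_kernels_nonneg:
  fixes C :: "(real ^ 22) set"
  assumes "C \<subseteq> sphere 0 1"
  shows "0 \<le> kernel_sum1 C"
    "0 \<le> kernel_sum2 C"
    "0 \<le> kernel_sum3 C"
    "0 \<le> kernel_sum4 C"
    "0 \<le> kernel_sum5 C"
  unfolding sum_inner_kernel sum_harm2_kernel[OF assms] sum_harm3_kernel_0[OF assms]
    sum_harm3_kernel_1[OF assms] sum_harm3_kernel_2[OF assms]
  by (auto intro!: sum_nonneg)

definition C2816_energy :: "(real \<Rightarrow> real) \<Rightarrow> real" where
  "C2816_energy h = 2816 * (h (-1) + 567 * h (-1/3) + 1680 * h 0 + 567 * h (1/3))"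

text \<open>With the diagonal value at 1 added, the weights 1, 567, 1680, 567 average every kernel
  after \<open>a0\<close> to 0. This makes the bound sharp.\<close>

lemma C2816_energy_lp_fun:
  "C2816_energy (lp_fun a0 a1 a2 a3 a4 a5) = 2816\<^sup>2 * a0 - 2816 * lp_fun a0 a1 a2 a3 a4 a5 1"
  by (simp add: C2816_energy_def lp_fun_def power_divide algebra_simps)

lemma energy_eq_double_sum:
  fixes C :: "(real ^ 'n) set" and f :: "real \<Rightarrow> real"
  assumes "finite C" "C \<subseteq> sphere 0 1"
  shows "energy f C = (\<Sum>x\<in>C. \<Sum>y\<in>C. f (x \<bullet> y)) - card C * f 1"
proof -
  have "(\<Sum>y\<in>C - {x}. f (x \<bullet> y)) = (\<Sum>y\<in>C. f (x \<bullet> y)) - f 1" if "x \<in> C" for x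
  proof -
    have "x \<bullet> x = 1" using assms(2) that by (auto simp: norm_eq_1)
    then show ?thesis using assms(1) that by (simp add: sum_diff1)
  qed
  then show ?thesis by (simp add: energy_def sum_subtractf)
qed

lemma avoiding_code_inner:
  assumes "avoiding_code T C" "x \<in> C" "y \<in> C" "x \<noteq> y"
  shows "x \<bullet> y \<in> {-1..<1}" "x \<bullet> y \<notin> T"
proof -
  have n: "norm x = 1" "norm y = 1" using assms by (auto simp: avoiding_code_def spherical_code_def)
  then have "\<bar>x \<bullet> y\<bar> \<le> 1" using Cauchy_Schwarz_ineq2[of x y] by simp
  moreover have "x \<bullet> y \<noteq> 1" using inner_unit_eq_1[OF n] assms(4) by simp
  ultimately show "x \<bullet> y \<in> {-1..<1}" by auto
  show "x \<bullet> y \<notin> T" using assms by (auto simp: avoiding_code_def inner_products_def)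
qed

text \<open>The excess over the bound is split into the interpolation error and the kernel sums, all
  nonnegative for a \<open>T\<close>-avoiding code. One identity thus serves both the bound and the
  equality case.\<close>

lemma energy_lp_bound:
  fixes C :: "(real ^ 22) set"
  assumes C: "avoiding_code T C" "card C = 2816"
    and a: "a1 \<ge> 0" "a2 \<ge> 0" "a3 \<ge> 0" "a4 \<ge> 0" "a5 \<ge> 0"
    and nodes: "\<And>t. t \<in> lp_nodes \<Longrightarrow> h t = lp_fun a0 a1 a2 a3 a4 a5 t"
    and below: "\<And>t. t \<in> {-1..<1} \<Longrightarrow> t \<notin> T \<Longrightarrow> lp_fun a0 a1 a2 a3 a4 a5 t \<le> h t"
  shows "energy h C = C2816_energy h + (energy h C - energy (lp_fun a0 a1 a2 a3 a4 a5) C) +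
    (a1 * kernel_sum1 C + a2 * kernel_sum2 C + a3 * kernel_sum3 C + a4 * kernel_sum4 C + a5 * kernel_sum5 C)" (is ?decomposition)
    and "energy (lp_fun a0 a1 a2 a3 a4 a5) C \<le> energy h C"
proof -
  let ?f = "lp_fun a0 a1 a2 a3 a4 a5"
  have fin: "finite C" "C \<subseteq> sphere 0 1" using C(1) by (auto simp: avoiding_code_def spherical_code_def)
  have "C2816_energy h = C2816_energy ?f"
    using nodes by (simp add: C2816_energy_def lp_nodes_def)
  then show ?decomposition
    unfolding energy_eq_double_sum[OF fin, of ?f] lp_sum C2816_energy_lp_fun C(2) by simp
  show "energy ?f C \<le> energy h C"
    unfolding energy_def
    by (intro sum_mono below) (use avoiding_code_inner[OF C(1)] in auto)
qed

lemma energy_ge: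
  fixes C :: "(real ^ 22) set"
  assumes T: "T \<in> {{-1<..<-1/3}, {-1/3<..<0}, {0<..<1/3}}" and h: "absolutely_monotone h"
    and C: "avoiding_code T C" "card C = 2816"
  shows "C2816_energy h \<le> energy h C"
proof -
  obtain a0 a1 a2 a3 a4 a5 where a: "a1 \<ge> 0" "a2 \<ge> 0" "a3 \<ge> 0" "a4 \<ge> 0" "a5 \<ge> 0"
    "\<And>t. t \<in> lp_nodes \<Longrightarrow> h t = lp_fun a0 a1 a2 a3 a4 a5 t"
    "\<And>t. t \<in> {-1..<1} \<Longrightarrow> t \<notin> T \<Longrightarrow> lp_fun a0 a1 a2 a3 a4 a5 t \<le> h t"
    using lp_interpolant[OF T h] by metis
  have "C \<subseteq> sphere 0 1" using C(1) by (auto simp: avoiding_code_def spherical_code_def)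
  note nn = lp_kernels_nonneg[OF this]
  show ?thesis
    using energy_lp_bound[OF C a] mult_nonneg_nonneg[OF a(1) nn(1)] mult_nonneg_nonneg[OF a(2) nn(2)]
      mult_nonneg_nonneg[OF a(3) nn(3)] mult_nonneg_nonneg[OF a(4) nn(4)] mult_nonneg_nonneg[OF a(5) nn(5)]
    by linarith
qed

section \<open>Distance distribution and the case of equality\<close>

lemma counts_imply_distribution:
  fixes C :: "(real ^ 22) set"
  assumes C: "finite C" "C \<subseteq> sphere 0 1" "card C = 2816"
    and ip: "\<And>x y. x \<in> C \<Longrightarrow> y \<in> C \<Longrightarrow> x \<bullet> y \<in> {-1, -1/3, 0, 1/3, 1}"
    and cnt: "\<And>x. x \<in> C \<Longrightarrow> card {y\<in>C. x \<bullet> y = -1} = 1" "\<And>x. x \<in> C \<Longrightarrow> card {y\<in>C. x \<bullet> y = -1/3} = 567"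
      "\<And>x. x \<in> C \<Longrightarrow> card {y\<in>C. x \<bullet> y = 0} = 1680" "\<And>x. x \<in> C \<Longrightarrow> card {y\<in>C. x \<bullet> y = 1/3} = 567"
  shows "inner_products C = {-1, -1/3, 0, 1/3}" "distance_invariant C"
    "distance_distribution C = [1, 567, 1680, 567]" "energy h C = C2816_energy h"
proof -
  obtain x0 where x0: "x0 \<in> C" using C(3) by fastforce
  have norm: "norm x = 1" if "x \<in> C" for x using C(2) that by auto
  show inner: "inner_products C = {-1, -1/3, 0, 1/3}"
  proof (intro equalityI subsetI)
    fix t assume "t \<in> inner_products C"
    then obtain x y where xy: "x \<in> C" "y \<in> C" "x \<noteq> y" "t = x \<bullet> y" by (auto simp: inner_products_def)
    then have "t \<noteq> 1" using inner_unit_eq_1[OF norm norm] by auto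
    then show "t \<in> {-1, -1/3, 0, 1/3}" using ip[OF xy(1,2)] xy(4) by blast
  next
    fix t :: real assume t: "t \<in> {-1, -1/3, 0, 1/3}"
    then have "card {y\<in>C. x0 \<bullet> y = t} \<noteq> 0"
      using cnt[OF x0] by (elim insertE emptyE; hypsubst; simp)
    then have "{y\<in>C. x0 \<bullet> y = t} \<noteq> {}" by (metis card.empty)
    then obtain y where "y \<in> C" "x0 \<bullet> y = t" by blast
    moreover have "t \<noteq> 1" using t by auto
    ultimately show "t \<in> inner_products C"
      using x0 norm[OF x0] by (auto simp: inner_products_def norm_eq_1)
  qed
  have const: "card {y\<in>C. x \<bullet> y = t} = card {y\<in>C. x' \<bullet> y = t}"
    if "t \<in> {-1, -1/3, 0, 1/3}" "x \<in> C" "x' \<in> C" for t x x'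
    using that(1) by (elim insertE emptyE; hypsubst; simp only: cnt that(2,3))
  then show "distance_invariant C" unfolding distance_invariant_def inner by blast
  have "sorted_list_of_set (set [-1, -1/3, 0, 1/3 :: real]) = [-1, -1/3, 0, 1/3]"
    by (rule sorted_list_of_set.idem_if_sorted_distinct) simp_all
  then have sorted: "sorted_list_of_set {-1, -1/3, 0, 1/3 :: real} = [-1, -1/3, 0, 1/3]"
    by (simp only: list.set)
  have the_count: "(THE a. \<forall>x\<in>C. card {y\<in>C. x \<bullet> y = t} = a) = a"
    if "\<And>x. x \<in> C \<Longrightarrow> card {y\<in>C. x \<bullet> y = t} = a" for t a
    using that x0 by (intro the_equality) auto
  show "distance_distribution C = [1, 567, 1680, 567]"
    unfolding distance_distribution_def inner sorted list.map
    by (simp only: the_count[OF cnt(1)] the_count[OF cnt(2)] the_count[OF cnt(3)] the_count[OF cnt(4)])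
  have "(\<Sum>y\<in>C. h (x \<bullet> y)) = h (-1) + 567 * h (-1/3) + 1680 * h 0 + 567 * h (1/3) + h 1" if x: "x \<in> C" for x
    using sum_by_inner[of C "{-1, -1/3, 0, 1/3, 1}" x h, OF C(1) _ ip[OF x]] cnt[OF x] card_inner_1[OF C(2) x] by simp
  then show "energy h C = C2816_energy h"
    by (simp add: energy_eq_double_sum[OF C(1,2)] C(3) C2816_energy_def)
qed

lemma C2816_distribution:
  assumes "is_C2816 D"
  shows "inner_products D = {-1, -1/3, 0, 1/3}" "distance_invariant D"
    "distance_distribution D = [1, 567, 1680, 567]" "energy h D = C2816_energy h"
  using counts_imply_distribution[OF C2816_properties[OF assms]] by simp_all

lemma C2816_avoiding:
  assumes T: "T \<in> {{-1<..<-1/3}, {-1/3<..<0}, {0<..<1/3}}" and D: "is_C2816 D"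
  shows "avoiding_code T D"
  using T C2816_properties(1,2)[OF D] C2816_distribution(1)[OF D]
  by (auto simp: avoiding_code_def spherical_code_def)

text \<open>A vanishing kernel sum is a vanishing sum of squares, so the sums of coordinates, of
  \<open>harm2\<close> and of \<open>harm3\<close> times short monomials are 0. These are the
  relations of \<open>spherical_moments\<close>, and they also give the power sums seen from a fixed
  point.\<close>

lemma equality_moments:
  fixes C :: "(real ^ 22) set"
  assumes C: "C \<subseteq> sphere 0 1" "finite C" "card C = 2816"
    and ip: "\<And>x y. x \<in> C \<Longrightarrow> y \<in> C \<Longrightarrow> x \<bullet> y \<in> {-1, -1/3, 0, 1/3, 1}"
    and S: "kernel_sum1 C = 0" "kernel_sum2 C = 0"
      "kernel_sum3 C = 0"
      "kernel_sum4 C = 0"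
  shows "spherical_moments (\<lambda>xs. (\<Sum>x\<in>C. monom_at xs x) / card C)"
    and "\<And>x. x \<in> C \<Longrightarrow> (\<Sum>y\<in>C. x \<bullet> y) = 0"
    and "\<And>x. x \<in> C \<Longrightarrow> (\<Sum>y\<in>C. (x \<bullet> y)\<^sup>2) = 128"
    and "\<And>x. x \<in> C \<Longrightarrow> (\<Sum>y\<in>C. (x \<bullet> y) ^ 3) = 0"
proof -
  have d1: "(\<Sum>x\<in>C. x $ i) = 0" for i
    using S(1) unfolding sum_inner_kernel by (subst (asm) sum_nonneg_eq_0_iff) auto
  have "(\<Sum>x\<in>C. \<Sum>y\<in>C. (x \<bullet> y)\<^sup>2) = (real (card C))\<^sup>2 / CARD(22)"
    using S(2) by (simp add: sum_subtractf C(3))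
  note frame = tight_frame[OF C(1) this]
  have d3: "(\<Sum>x\<in>C. harm3 i j k x) = 0" for i j k
  proof -
    have "(\<Sum>(i, j, k)\<in>UNIV. (\<Sum>x\<in>C. harm3 i j k x)\<^sup>2) = 0"
      using S(3) unfolding sum_harm3_kernel_0[OF C(1)] .
    then show ?thesis by (subst (asm) sum_nonneg_eq_0_iff) auto
  qed
  have d4: "(\<Sum>x\<in>C. x $ l * harm3 i j k x) = 0" for i j k l
  proof -
    have "(\<Sum>l\<in>UNIV. \<Sum>(i, j, k)\<in>UNIV. (\<Sum>x\<in>C. x $ l * harm3 i j k x)\<^sup>2) = 0"
      using S(4) unfolding sum_harm3_kernel_1[OF C(1)] .
    then have "(\<Sum>(i, j, k)\<in>UNIV. (\<Sum>x\<in>C. x $ l * harm3 i j k x)\<^sup>2) = 0"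
      by (subst (asm) sum_nonneg_eq_0_iff) (auto intro!: sum_nonneg)
    then show ?thesis by (subst (asm) sum_nonneg_eq_0_iff) auto
  qed
  \<comment> \<open>The linear programming polynomial may have degree 4, so the vanishing of the fifth moment is
    obtained from the inner products: \<open>t\<^sup>5 = (10 t\<^sup>3 - t)/9\<close> for \<open>t \<in> {0, \<plusminus>1/3, \<plusminus>1}\<close>.\<close>
  have d5: "(\<Sum>x\<in>C. x $ l * x $ m * harm3 i j k x) = 0" for i j k l m
  proof -
    have "(x \<bullet> y)\<^sup>2 * gegen3 TYPE(22) (x \<bullet> y) = (10/9 - 1/8) * gegen3 TYPE(22) (x \<bullet> y) + (71/72/8 - 1/9) * (x \<bullet> y)"
      if "x \<in> C" "y \<in> C" for x y
      using ip[OF that] unfolding gegen3_22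
      by (elim insertE emptyE) (simp_all only:, simp_all add: eval_nat_numeral)
    then have "kernel_sum5 C =
      (10/9 - 1/8) * kernel_sum3 C + (71/72/8 - 1/9) * kernel_sum1 C"
      by (simp add: sum.distrib sum_distrib_left)
    then have "(\<Sum>l\<in>UNIV. \<Sum>m\<in>UNIV. \<Sum>(i, j, k)\<in>UNIV. (\<Sum>x\<in>C. x $ l * x $ m * harm3 i j k x)\<^sup>2) = 0"
      unfolding sum_harm3_kernel_2[OF C(1)] S by simp
    then have "(\<Sum>m\<in>UNIV. \<Sum>(i, j, k)\<in>UNIV. (\<Sum>x\<in>C. x $ l * x $ m * harm3 i j k x)\<^sup>2) = 0"
      by (subst (asm) sum_nonneg_eq_0_iff) (auto intro!: sum_nonneg)
    then have "(\<Sum>(i, j, k)\<in>UNIV. (\<Sum>x\<in>C. x $ l * x $ m * harm3 i j k x)\<^sup>2) = 0"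
      by (subst (asm) sum_nonneg_eq_0_iff) (auto intro!: sum_nonneg)
    then show ?thesis by (subst (asm) sum_nonneg_eq_0_iff) auto
  qed
  have d: "(\<Sum>x\<in>C. monom_at ys x * harm3 i j k x) = 0" if "length ys \<le> 2" for ys i j k
  proof -
    consider "ys = []" | l where "ys = [l]" | l m where "ys = [l, m]"
      using \<open>length ys \<le> 2\<close> by (cases ys; cases "tl ys"; cases "tl (tl ys)") auto
    then show ?thesis by cases (simp_all add: d3 d4 d5)
  qed
  show "spherical_moments (\<lambda>xs. (\<Sum>x\<in>C. monom_at xs x) / card C)"
    unfolding spherical_moments_def
  proof (intro conjI allI impI)
    fix i j k :: 22 and ys :: "22 list" assume len: "length ys \<le> 2"
    \<comment> \<open>The definition of \<open>harm3\<close> solved for the cubic monomial and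
      multiplied by \<open>monom_at ys x\<close>; after summation the first term drops out.\<close>
    have "monom_at (i # j # k # ys) x = monom_at ys x * harm3 i j k x +
       (kron i j * monom_at (k # ys) x + kron i k * monom_at (j # ys) x + kron j k * monom_at (i # ys) x) / (CARD(22) + 2)"
      for x :: "real ^ 22"
      by (simp add: harm3_def algebra_simps add_divide_distrib)
    then have "(\<Sum>x\<in>C. monom_at (i # j # k # ys) x) =
       (kron i j * (\<Sum>x\<in>C. monom_at (k # ys) x) + kron i k * (\<Sum>x\<in>C. monom_at (j # ys) x)
         + kron j k * (\<Sum>x\<in>C. monom_at (i # ys) x)) / (CARD(22) + 2)"
      by (simp only: sum.distrib d[OF len] sum_divide_distrib[symmetric] sum_distrib_left[symmetric] add_0_left)
    then show "(\<Sum>x\<in>C. monom_at (i # j # k # ys) x) / real (card C) =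
       (kron i j * ((\<Sum>x\<in>C. monom_at (k # ys) x) / real (card C)) +
        kron i k * ((\<Sum>x\<in>C. monom_at (j # ys) x) / real (card C)) +
        kron j k * ((\<Sum>x\<in>C. monom_at (i # ys) x) / real (card C))) / real (CARD(22) + 2)"
      by (simp add: add_divide_distrib)
  qed (use C(3) frame(1) in \<open>simp_all add: d1\<close>)
  fix x assume x: "x \<in> C"
  then have nx: "norm x = 1" using C(1) by auto
  show sum1: "(\<Sum>y\<in>C. x \<bullet> y) = 0"
    unfolding inner_vec_def by (subst sum.swap) (simp add: d1 flip: sum_distrib_left)
  show "(\<Sum>y\<in>C. (x \<bullet> y)\<^sup>2) = 128"
    using frame(2)[of x] nx by (simp add: C(3) inner_commute)
  \<comment> \<open>The addition formula with \<open>x\<close> fixed turns the vanishing global sums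
    \<open>d3\<close> into a statement about each single point.\<close>
  have "(\<Sum>y\<in>C. gegen3 TYPE(22) (x \<bullet> y)) = (\<Sum>y\<in>C. \<Sum>i\<in>UNIV. \<Sum>j\<in>UNIV. \<Sum>k\<in>UNIV. harm3 i j k x * harm3 i j k y)"
    using harm3_kernel[OF nx] C(1) by (intro sum.cong refl) auto
  also have "\<dots> = (\<Sum>i\<in>UNIV. \<Sum>j\<in>UNIV. \<Sum>k\<in>UNIV. \<Sum>y\<in>C. harm3 i j k x * harm3 i j k y)"
    by (subst sum.swap, intro sum.cong refl, subst sum.swap, intro sum.cong refl, rule sum.swap)
  also have "\<dots> = 0" by (simp add: d3 flip: sum_distrib_left)
  finally have "(\<Sum>y\<in>C. (x \<bullet> y) ^ 3) - (\<Sum>y\<in>C. x \<bullet> y) / 8 = 0"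
    unfolding gegen3_22 by (simp only: sum_subtractf sum_divide_distrib)
  then show "(\<Sum>y\<in>C. (x \<bullet> y) ^ 3) = 0" using sum1 by simp
qed

text \<open>The inner product 1 occurs once, so the power sums of degrees 0 to 3 give a Vandermonde
  system for the four remaining counts.\<close>

lemma equality_counts:
  fixes C :: "(real ^ 22) set"
  assumes C: "C \<subseteq> sphere 0 1" "finite C" "card C = 2816"
    and ip: "\<And>x y. x \<in> C \<Longrightarrow> y \<in> C \<Longrightarrow> x \<bullet> y \<in> {-1, -1/3, 0, 1/3, 1}"
    and x: "x \<in> C"
    and m: "(\<Sum>y\<in>C. x \<bullet> y) = 0" "(\<Sum>y\<in>C. (x \<bullet> y)\<^sup>2) = 128" "(\<Sum>y\<in>C. (x \<bullet> y) ^ 3) = 0"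
  shows "card {y\<in>C. x \<bullet> y = -1} = 1" "card {y\<in>C. x \<bullet> y = -1/3} = 567"
    "card {y\<in>C. x \<bullet> y = 0} = 1680" "card {y\<in>C. x \<bullet> y = 1/3} = 567"
proof -
  let ?A = "\<lambda>t. real (card {y\<in>C. x \<bullet> y = t})"
  note by_inner = sum_by_inner[of C "{-1, -1/3, 0, 1/3, 1}" x, OF C(2) _ ip[OF x]]
  have one: "?A 1 = 1" using card_inner_1[OF C(1) x] by simp
  have "?A (-1) + ?A (-1/3) + ?A 0 + ?A (1/3) = 2815"
    using by_inner[of "\<lambda>t. 1::real"] C(3) one by simp
  moreover have "?A (-1) + ?A (-1/3) / 3 = ?A (1/3) / 3 + 1"
    using by_inner[of "\<lambda>t. t"] m(1) one by simp
  moreover have "?A (-1) + ?A (-1/3) / 9 + ?A (1/3) / 9 = 127"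
    using by_inner[of "\<lambda>t. t\<^sup>2"] m(2) one by (simp add: power2_eq_square)
  moreover have "?A (-1) + ?A (-1/3) / 27 = ?A (1/3) / 27 + 1"
    using by_inner[of "\<lambda>t. t ^ 3"] m(3) one by (simp add: power3_eq_cube)
  ultimately have "?A (-1) = 1" "?A (-1/3) = 567" "?A 0 = 1680" "?A (1/3) = 567" by linarith+
  then show "card {y\<in>C. x \<bullet> y = -1} = 1" "card {y\<in>C. x \<bullet> y = -1/3} = 567"
    "card {y\<in>C. x \<bullet> y = 0} = 1680" "card {y\<in>C. x \<bullet> y = 1/3} = 567" by simp_all
qed

lemma energy_equality:
  fixes C :: "(real ^ 22) set"
  assumes T: "T \<in> {{-1<..<-1/3}, {-1/3<..<0}, {0<..<1/3}}" and h: "absolutely_monotone h"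
    and h6: "\<forall>t\<in>{-1<..<1}. (deriv ^^ 6) h t > 0"
    and C: "avoiding_code T C" "card C = 2816" and eq: "energy h C = C2816_energy h"
  shows "spherical_design 5 C" "inner_products C = {-1, -1/3, 0, 1/3}"
    "distance_invariant C" "distance_distribution C = [1, 567, 1680, 567]"
proof -
  obtain a0 a1 a2 a3 a4 a5 where a: "a1 \<ge> 0" "a2 \<ge> 0" "a3 \<ge> 0" "a4 \<ge> 0" "a5 \<ge> 0"
    "\<And>t. t \<in> lp_nodes \<Longrightarrow> h t = lp_fun a0 a1 a2 a3 a4 a5 t"
    "\<And>t. t \<in> {-1..<1} \<Longrightarrow> t \<notin> T \<Longrightarrow> lp_fun a0 a1 a2 a3 a4 a5 t \<le> h t"
    and pos: "a1 > 0" "a2 > 0" "a3 > 0" "a4 > 0"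
    and strict: "\<And>t. t \<in> {-1..<1} \<Longrightarrow> t \<notin> T \<Longrightarrow> t \<notin> lp_nodes \<Longrightarrow> lp_fun a0 a1 a2 a3 a4 a5 t < h t"
    using lp_interpolant[OF T h] h6 by metis
  let ?f = "lp_fun a0 a1 a2 a3 a4 a5"
  have fin: "finite C" and sph: "C \<subseteq> sphere 0 1"
    using C(1) by (auto simp: avoiding_code_def spherical_code_def)
  note nn = lp_kernels_nonneg[OF sph]
  note terms = mult_nonneg_nonneg[OF a(1) nn(1)] mult_nonneg_nonneg[OF a(2) nn(2)]
    mult_nonneg_nonneg[OF a(3) nn(3)] mult_nonneg_nonneg[OF a(4) nn(4)] mult_nonneg_nonneg[OF a(5) nn(5)]
  note bound = energy_lp_bound[OF C a]
  \<comment> \<open>At equality a sum of nonnegative terms is 0, hence each term; positivity of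
    \<open>a1\<close> to \<open>a4\<close> passes this on to the kernel sums.\<close>
  have "a1 * kernel_sum1 C = 0" using bound terms eq by linarith
  then have S1: "kernel_sum1 C = 0" using pos by simp
  have "a2 * kernel_sum2 C = 0" using bound terms eq by linarith
  then have S2: "kernel_sum2 C = 0" using pos by simp
  have "a3 * kernel_sum3 C = 0" using bound terms eq by linarith
  then have S3: "kernel_sum3 C = 0" using pos by simp
  have "a4 * kernel_sum4 C = 0" using bound terms eq by linarith
  then have S4: "kernel_sum4 C = 0" using pos by simp
  have energies: "energy h C = energy ?f C" using bound terms eq by linarith
  have le: "?f (x \<bullet> y) \<le> h (x \<bullet> y)" if "x \<in> C" "y \<in> C - {x}" for x y
    using a(7) avoiding_code_inner[OF C(1)] that by auto
  have nodes: "x \<bullet> y \<in> lp_nodes" if xy: "x \<in> C" "y \<in> C" "x \<noteq> y" for x y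
  proof (rule ccontr)
    assume "x \<bullet> y \<notin> lp_nodes"
    \<comment> \<open>One inner product off the nodes would already make the interpolation error
      positive.\<close>
    then have lt: "?f (x \<bullet> y) < h (x \<bullet> y)" using strict avoiding_code_inner[OF C(1) xy] by blast
    have "(\<Sum>y\<in>C - {x}. ?f (x \<bullet> y)) < (\<Sum>y\<in>C - {x}. h (x \<bullet> y))"
      using fin xy lt le by (intro sum_strict_mono_ex1) auto
    then have "energy ?f C < energy h C"
      unfolding energy_def using fin xy le by (intro sum_strict_mono_ex1) (auto intro!: sum_mono)
    then show False using energies by simp
  qed
  have ip: "x \<bullet> y \<in> {-1, -1/3, 0, 1/3, 1}" if xy: "x \<in> C" "y \<in> C" for x y
  proof (cases "x = y")
    case True
    then have "x \<bullet> y = 1" using sph xy by (auto simp: norm_eq_1)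
    then show ?thesis by simp
  next
    case False
    then show ?thesis using nodes[OF xy] unfolding lp_nodes_def by blast
  qed
  note mom = equality_moments[OF sph fin C(2) ip S1 S2 S3 S4]
  show "spherical_design 5 C"
    using C(1) by (intro spherical_design_5I mom(1)) (simp add: avoiding_code_def)
  note counts = equality_counts[OF sph fin C(2) ip _ mom(2-4)]
  show "inner_products C = {-1, -1/3, 0, 1/3}" "distance_invariant C" "distance_distribution C = [1, 567, 1680, 567]"
    using counts_imply_distribution(1-3)[OF fin sph C(2) ip counts] by blast+
qed

theorem theorem7p8:
  fixes T :: "real set" and h :: "real \<Rightarrow> real"
  assumes "T \<in> {{-1<..<-1/3}, {-1/3<..<0}, {0<..<1/3}}"
    and "absolutely_monotone h"
    and "\<forall>t\<in>{-1<..<1}. (deriv ^^ 6) h t > 0"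
  shows "(\<forall>C :: (real ^ 22) set. avoiding_code T C \<and> card C = 2816 \<longrightarrow>
            energy h C \<ge> min_energy TYPE(22) h 2816 T) \<and>
         (\<exists>C :: (real ^ 22) set. avoiding_code T C \<and> card C = 2816 \<and>
            energy h C = min_energy TYPE(22) h 2816 T) \<and>
         min_energy TYPE(22) h 2816 T =
           2816 * (h (-1) + 567 * h (-1/3) + 1680 * h 0 + 567 * h (1/3)) \<and>
         (\<exists>D. is_C2816 D) \<and>
         (\<forall>D. is_C2816 D \<longrightarrow> card D = 2816 \<and> avoiding_universally_optimal T D) \<and>
         (\<forall>C :: (real ^ 22) set. avoiding_code T C \<and> card C = 2816 \<and>
            energy h C = min_energy TYPE(22) h 2816 T \<longrightarrow>
              spherical_design 5 C \<and>
              inner_products C = {-1, -1/3, 0, 1/3} \<and>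
              distance_invariant C \<and> distance_distribution C = [1, 567, 1680, 567] \<and>
              (\<forall>D. is_C2816 D \<longrightarrow>
                 inner_products D = inner_products C \<and>
                 distance_invariant D \<and> distance_distribution D = distance_distribution C))"
proof -
  obtain D0 where D0: "is_C2816 D0" using C2816_exists by blast
  have avoid: "avoiding_code T D" "card D = 2816" "energy g D = C2816_energy g" if "is_C2816 D" for D g
    using C2816_avoiding[OF assms(1) that] C2816_properties(3)[OF that] C2816_distribution(4)[OF that] by simp_all
  \<comment> \<open>The \<open>LEAST\<close> value is determined because the bound is attained, by
    the code \<open>D0\<close>.\<close>
  have min: "min_energy TYPE(22) h 2816 T = C2816_energy h"
    unfolding min_energy_def
  proof (rule Least_equality)
    show "\<exists>C :: (real ^ 22) set. avoiding_code T C \<and> card C = 2816 \<and> energy h C = C2816_energy h"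
      using avoid[OF D0] by blast
  qed (use energy_ge[OF assms(1,2)] in blast)
  \<comment> \<open>\<open>energy_ge\<close> holds for every absolutely monotone potential without
    strictness, so it covers all potentials in the definition of optimality and not only
    \<open>h\<close>.\<close>
  have optimal: "avoiding_universally_optimal T D" if "is_C2816 D" for D
    unfolding avoiding_universally_optimal_def
    using avoid[OF that] energy_ge[OF assms(1)] by auto
  have design: "spherical_design 5 C \<and> inner_products C = {-1, -1/3, 0, 1/3} \<and>
      distance_invariant C \<and> distance_distribution C = [1, 567, 1680, 567]"
    if "avoiding_code T C" "card C = 2816" "energy h C = C2816_energy h" for C :: "(real ^ 22) set"
    using energy_equality[OF assms that] by blast
  show ?thesis
    unfolding min
  proof (intro conjI)
    show "\<forall>C :: (real ^ 22) set. avoiding_code T C \<and> card C = 2816 \<longrightarrow> C2816_energy h \<le> energy h C"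
      using energy_ge[OF assms(1,2)] by blast
    show "\<exists>C :: (real ^ 22) set. avoiding_code T C \<and> card C = 2816 \<and> energy h C = C2816_energy h"
      using avoid[OF D0] by blast
    show "C2816_energy h = 2816 * (h (-1) + 567 * h (-1/3) + 1680 * h 0 + 567 * h (1/3))"
      by (rule C2816_energy_def)
    show "\<exists>D. is_C2816 D" using D0 by blast
    show "\<forall>D. is_C2816 D \<longrightarrow> card D = 2816 \<and> avoiding_universally_optimal T D"
      using avoid(2) optimal by blast
    show "\<forall>C :: (real ^ 22) set. avoiding_code T C \<and> card C = 2816 \<and> energy h C = C2816_energy h \<longrightarrow>
        spherical_design 5 C \<and> inner_products C = {-1, -1/3, 0, 1/3} \<and>
        distance_invariant C \<and> distance_distribution C = [1, 567, 1680, 567] \<and>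
        (\<forall>D. is_C2816 D \<longrightarrow> inner_products D = inner_products C \<and>
           distance_invariant D \<and> distance_distribution D = distance_distribution C)"
      using design C2816_distribution(1-3) by simp
  qed
qed

end
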